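(* Assume that $\partial G\in C^4$, that $a=\sigma\sigma^\top$ is uniformly elliptic in $\bar G$, and that $a\in C^3(\bar G)$, $b\in C^2(\bar G)$. Let $\psi\in C^3(\partial G)$, and assume that the solutions $u=u_T$ of the parabolic Neumann problem given in the context satisfy the boundedness assumption (B) of the context. Let $T=Nh$, and with the chain of the algorithm described in the context (step $h$) put $$Z_{1,N-1}=\sum_{k=0}^{N-2}\frac{2r_{k+1}\psi(X^\pi_{k+1})}{\alpha(X^\pi_{k+1})}I_{\bar G^c}(X'_{k+1}),\qquad Z_{2,N-1}=\sum_{k=0}^{N-2}\frac{2r_{k+1}}{\alpha(X^\pi_{k+1})}I_{\bar G^c}(X'_{k+1}).$$ Then there is a constant $C>0$ independent of $T$ and $h$ such that $$\bigg|\frac{\mathbb E(Z_{1,N-1})}{\mathbb E(Z_{2,N-1})}-\bar\psi'\bigg|\le C\Big(h+\frac1T\Big),\qquad \bar\psi'=\int_{\partial G}\psi(z)\rho'(z)\,dz.$$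
   Context: $C^p(\bar G)$, $C^p(\partial G)$, $C^{p/2,p}$ abbreviate the (parabolic) Hölder spaces $C^{p+\epsilon}$, $C^{(p+\epsilon)/2,p+\epsilon}$ for an $\epsilon\in(0,1)$; similarly for $\partial G\in C^4$. $G\subset\mathbb R^d$ is a bounded domain with boundary $\partial G$; $\nu(z)$ is the inward unit normal at $z\in\partial G$; $b:\bar G\to\mathbb R^d$, $\sigma:\bar G\to\mathbb R^{d\times d}$, $a=\sigma\sigma^\top$; $\sigma\in C^2(\bar G)$. Uniform ellipticity: there is $a_0>0$ with $(a(x)y\cdot y)\ge a_0|y|^2$ for all $x\in\bar G$, $y\in\mathbb R^d$. $\mathscr A=\frac12\sum_{i,j}a^{ij}(x)\frac{\partial^2}{\partial x^i\partial x^j}+\sum_i b^i(x)\frac{\partial}{\partial x^i}$. Reflected SDE: $dX(s)=b(X(s))ds+\sigma(X(s))dW(s)+\nu(X(s))I_{\partial G}(X(s))dL(s)$, $X(0)=x\in\bar G$, where $W$ is a $d$-dimensional Wiener process and $L$ is the local time of $X$ on $\partial G$ (continuous, non-decreasing, adapted, increasing only when $X(s)\in\partial G$, keeping $X$ in $\bar G$). Under the first assumptions of the claim $X$ has a unique invariant probability measure, with density $\rho\in C^2(\bar G)$, $\rho>0$. Put $\kappa=\int_{\partial G}\rho(z)\,dz$ (surface integral), $\rho'(z)=\rho(z)/\kappa$ and $\alpha(z)=\tfrac12(\nu(z)\cdot a(z)\nu(z))$ for $z\in\partial G$. Parabolic problem: $\frac{\partial u}{\partial t}+\mathscr Au=0$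 on $[0,T)\times\bar G$; $u(T,x)=0$, $x\in\bar G$; $\frac{\partial u}{\partial\nu}(t,z)=\frac{\psi(z)-\bar\psi'}{\alpha(z)}$, $0\le t<T$, $z\in\partial G$. Boundedness assumption (B): with a constant $C>0$ independent of $T$, $\sum_{p=0}^4\sum_{2i+|j|=p}\sup_{[0,T)\times\bar G}|D_t^iD_x^ju(t,x)|\le C$ ($j$ a multi-index). Algorithm: $X_0=x\in\bar G$; $\xi_k=(\xi_k^1,\dots,\xi_k^d)^\top$ with all $\xi_k^i$ mutually independent and equal to $\pm1$ with probability $1/2$; $X'_{k+1}=X_k+hb(X_k)+h^{1/2}\sigma(X_k)\xi_{k+1}$. If $X'_{k+1}\in\bar G$, set $X_{k+1}=X'_{k+1}$; otherwise let $X^\pi_{k+1}$ be the projection of $X'_{k+1}$ on $\partial G$, $r_{k+1}=|X'_{k+1}-X^\pi_{k+1}|$, and $X_{k+1}=X'_{k+1}+2r_{k+1}\nu(X^\pi_{k+1})$. Throughout, $h>0$ is sufficiently small (so that the projection is unique and $X_{k+1}\in G$). *)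

theory Defs
  imports "HOL-Probability.Probability"
begin

section \<open>Hoelder spaces and smooth domains\<close>

text \<open>Multi-indices on the coordinates of \<open>real^'d\<close> are functions \<open>'d \<Rightarrow> nat\<close>.\<close>

definition mi_order :: "('d::finite \<Rightarrow> nat) \<Rightarrow> nat"
  where "mi_order j = (\<Sum>i\<in>UNIV. j i)"

definition mi_zero :: "'d \<Rightarrow> nat"
  where "mi_zero = (\<lambda>_. 0)"

definition mi_incr :: "'d \<Rightarrow> ('d \<Rightarrow> nat) \<Rightarrow> ('d \<Rightarrow> nat)"
  where "mi_incr i j = j(i := Suc (j i))"

definition has_partial_derivative ::
    "(real^'d \<Rightarrow> real) \<Rightarrow> 'd::finite \<Rightarrow> real \<Rightarrow> real^'d \<Rightarrow> bool"
  where "has_partial_derivative f i c x \<longleftrightarrow>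
    ((\<lambda>s. f (x + s *\<^sub>R axis i 1)) has_real_derivative c) (at 0)"

text \<open>\<open>space_derivatives k G f D\<close>: \<open>f\<close> is \<open>k\<close> times continuously differentiable in the open set
  \<open>G\<close>, and \<open>D j\<close> is the derivative of \<open>f\<close> with multi-index \<open>j\<close>, continuously extended to the
  closure of \<open>G\<close>.  This determines \<open>D j\<close> on the closure of \<open>G\<close> for all \<open>j\<close> of order at most \<open>k\<close>.\<close>

definition space_derivatives ::
    "nat \<Rightarrow> (real^'d::finite) set \<Rightarrow> (real^'d \<Rightarrow> real) \<Rightarrow> (('d \<Rightarrow> nat) \<Rightarrow> real^'d \<Rightarrow> real) \<Rightarrow> bool"
  where "space_derivatives k G f D \<longleftrightarrow>
    (\<forall>x\<in>closure G. D mi_zero x = f x) \<and>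
    (\<forall>j. mi_order j \<le> k \<longrightarrow> continuous_on (closure G) (D j)) \<and>
    (\<forall>i j. mi_order (mi_incr i j) \<le> k \<longrightarrow>
       (\<forall>x\<in>G. has_partial_derivative (D j) i (D (mi_incr i j) x) x))"

text \<open>\<open>f\<close> belongs to the space \<open>C\<close> with exponent \<open>k + \<epsilon>\<close> on the closure of the open set \<open>G\<close>.\<close>

definition holder_class :: "nat \<Rightarrow> real \<Rightarrow> (real^'d::finite) set \<Rightarrow> (real^'d \<Rightarrow> real) \<Rightarrow> bool"
  where "holder_class k \<epsilon> G f \<longleftrightarrow>
    (\<exists>D. space_derivatives k G f D \<and>
      (\<forall>j. mi_order j = k \<longrightarrow>
        (\<exists>H. \<forall>x\<in>closure G. \<forall>y\<in>closure G. \<bar>D j x - D j y\<bar> \<le> H * dist x y powr \<epsilon>)))"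

definition holder_class_vec ::
    "nat \<Rightarrow> real \<Rightarrow> (real^'d::finite) set \<Rightarrow> (real^'d \<Rightarrow> real^'m) \<Rightarrow> bool"
  where "holder_class_vec k \<epsilon> G f \<longleftrightarrow> (\<forall>l. holder_class k \<epsilon> G (\<lambda>x. f x $ l))"

definition holder_class_mat ::
    "nat \<Rightarrow> real \<Rightarrow> (real^'d::finite) set \<Rightarrow> (real^'d \<Rightarrow> real^'n^'m) \<Rightarrow> bool"
  where "holder_class_mat k \<epsilon> G f \<longleftrightarrow> (\<forall>l m. holder_class k \<epsilon> G (\<lambda>x. f x $ l $ m))"

text \<open>Inside the ball around \<open>z\<close>, \<open>G\<close> is the part lying strictly on one side (given by the sign
  \<open>s\<close>) of the graph of \<open>g\<close> over the coordinates other than \<open>i\<close>.  Functions of these \<open>d - 1\<close>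
  coordinates are encoded as functions on \<open>real^'d\<close> not depending on coordinate \<open>i\<close>.\<close>

definition graph_chart ::
    "nat \<Rightarrow> real \<Rightarrow> (real^'d::finite) set \<Rightarrow> real^'d \<Rightarrow> real \<Rightarrow> 'd \<Rightarrow> real \<Rightarrow> (real^'d \<Rightarrow> real) \<Rightarrow> bool"
  where "graph_chart k \<epsilon> G z r i s g \<longleftrightarrow>
    0 < r \<and> (s = 1 \<or> s = -1) \<and>
    (\<forall>y c. g (y + c *\<^sub>R axis i 1) = g y) \<and>
    holder_class k \<epsilon> (ball z r) g \<and>
    G \<inter> ball z r = {y \<in> ball z r. 0 < s * (y $ i - g y)}"

definition graph_point :: "'d::finite \<Rightarrow> (real^'d \<Rightarrow> real) \<Rightarrow> real^'d \<Rightarrow> real^'d"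
  where "graph_point i g y = (\<chi> l. if l = i then g y else y $ l)"

definition holder_boundary :: "nat \<Rightarrow> real \<Rightarrow> (real^'d::finite) set \<Rightarrow> bool"
  where "holder_boundary k \<epsilon> G \<longleftrightarrow>
    (\<forall>z\<in>frontier G. \<exists>r i s g. graph_chart k \<epsilon> G z r i s g)"

text \<open>Functions on the boundary are regular if they are so in local graph coordinates.\<close>

definition holder_class_boundary ::
    "nat \<Rightarrow> real \<Rightarrow> (real^'d::finite) set \<Rightarrow> (real^'d \<Rightarrow> real) \<Rightarrow> bool"
  where "holder_class_boundary k \<epsilon> G \<psi> \<longleftrightarrow>
    (\<forall>z\<in>frontier G. \<exists>r i s g r'. graph_chart k \<epsilon> G z r i s g \<and> 0 < r' \<and> r' \<le> r \<and>
      (\<forall>y\<in>cball z r'. graph_point i g y \<in> frontier G) \<and>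
      holder_class k \<epsilon> (ball z r') (\<lambda>y. \<psi> (graph_point i g y)))"

text \<open>Unit vector at \<open>z\<close> orthogonal to the velocities of all curves in the boundary through \<open>z\<close>
  and pointing into \<open>G\<close>.\<close>

definition inward_unit_normal :: "(real^'d::finite) set \<Rightarrow> real^'d \<Rightarrow> real^'d \<Rightarrow> bool"
  where "inward_unit_normal G z v \<longleftrightarrow>
    norm v = 1 \<and>
    (\<forall>\<gamma> w. \<gamma> 0 = z \<and> (\<forall>\<^sub>F t in at (0::real). \<gamma> t \<in> frontier G) \<and>
       (\<gamma> has_vector_derivative w) (at 0) \<longrightarrow> v \<bullet> w = 0) \<and>
    (\<forall>\<^sub>F t in at_right 0. z + t *\<^sub>R v \<in> G)"

section \<open>Surface measure\<close>

text \<open>The \<open>m\<close>-dimensional Hausdorff (outer) measure, normalised so that on smooth \<open>m\<close>-dimensional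
  surfaces it is the surface area.  For \<open>m = 0\<close> it is the counting measure (as \<open>0 ^ 0 = 1\<close>).\<close>

definition hausdorff_pre :: "nat \<Rightarrow> real \<Rightarrow> 'a::metric_space set \<Rightarrow> ennreal"
  where "hausdorff_pre m \<delta> A =
    (INF U\<in>{U :: nat \<Rightarrow> 'a set. A \<subseteq> (\<Union>n. U n) \<and> (\<forall>n. bounded (U n) \<and> diameter (U n) \<le> \<delta>)}.
      \<Sum>n. ennreal (if U n = {} then 0 else unit_ball_vol (real m) * (diameter (U n) / 2) ^ m))"

definition hausdorff_outer :: "nat \<Rightarrow> 'a::metric_space set \<Rightarrow> ennreal"
  where "hausdorff_outer m A = (SUP \<delta>\<in>{0<..}. hausdorff_pre m \<delta> A)"

definition surface_measure :: "(real^'d::finite) measure"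
  where "surface_measure = measure_of UNIV (sets borel) (hausdorff_outer (CARD('d) - 1))"

definition surface_integral :: "(real^'d::finite) set \<Rightarrow> (real^'d \<Rightarrow> real) \<Rightarrow> real"
  where "surface_integral S f = (LINT z:S|surface_measure. f z)"

definition boundary_mean ::
    "(real^'d::finite) set \<Rightarrow> (real^'d \<Rightarrow> real) \<Rightarrow> (real^'d \<Rightarrow> real) \<Rightarrow> real"
  where "boundary_mean G \<rho> \<psi> =
    (let \<kappa> = surface_integral (frontier G) \<rho>
     in surface_integral (frontier G) (\<lambda>z. \<psi> z * (\<rho> z / \<kappa>)))"

section \<open>Coefficients\<close>

definition diffusion_matrix :: "(real^'d \<Rightarrow> real^'d^'d) \<Rightarrow> real^'d \<Rightarrow> real^'d^'d::finite"
  where "diffusion_matrix \<sigma> x = \<sigma> x ** transpose (\<sigma> x)"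

definition uniformly_elliptic :: "(real^'d::finite) set \<Rightarrow> (real^'d \<Rightarrow> real^'d^'d) \<Rightarrow> bool"
  where "uniformly_elliptic G a \<longleftrightarrow>
    (\<exists>a\<^sub>0>0. \<forall>x\<in>closure G. \<forall>y. (a x *v y) \<bullet> y \<ge> a\<^sub>0 * (norm y)\<^sup>2)"

definition conormal_coeff ::
    "(real^'d \<Rightarrow> real^'d::finite) \<Rightarrow> (real^'d \<Rightarrow> real^'d^'d) \<Rightarrow> real^'d \<Rightarrow> real"
  where "conormal_coeff \<nu> a z = (\<nu> z \<bullet> (a z *v \<nu> z)) / 2"

section \<open>The reflected stochastic differential equation\<close>

definition filtered_prob_space :: "'w measure \<Rightarrow> (real \<Rightarrow> 'w measure) \<Rightarrow> bool"
  where "filtered_prob_space M F \<longleftrightarrow>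
    prob_space M \<and> filtration (space M) F \<and> (\<forall>t. subalgebra M (F t))"

definition wiener_process ::
    "'w measure \<Rightarrow> (real \<Rightarrow> 'w measure) \<Rightarrow> (real \<Rightarrow> 'w \<Rightarrow> real^'d::finite) \<Rightarrow> bool"
  where "wiener_process M F W \<longleftrightarrow>
    (\<forall>t\<ge>0. W t \<in> borel_measurable (F t)) \<and>
    (AE \<omega> in M. W 0 \<omega> = 0 \<and> continuous_on {0..} (\<lambda>t. W t \<omega>)) \<and>
    (\<forall>s t. 0 \<le> s \<and> s < t \<longrightarrow>
      distributed M lborel (\<lambda>\<omega>. W t \<omega> - W s \<omega>)
        (\<lambda>x. ennreal (\<Prod>i\<in>UNIV. normal_density 0 (sqrt (t - s)) (x $ i))) \<and>
      prob_space.indep_set M (sets (F s))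
        (sets (vimage_algebra (space M) (\<lambda>\<omega>. W t \<omega> - W s \<omega>) borel)))"

text \<open>The Ito integral of a continuous adapted matrix process \<open>H\<close> over \<open>{0..t}\<close>, as the limit in
  probability of left-endpoint Riemann sums.\<close>

definition ito_integral_on ::
    "'w measure \<Rightarrow> (real \<Rightarrow> 'w \<Rightarrow> real^'d::finite) \<Rightarrow> (real \<Rightarrow> 'w \<Rightarrow> real^'d^'d) \<Rightarrow> real \<Rightarrow>
     ('w \<Rightarrow> real^'d) \<Rightarrow> bool"
  where "ito_integral_on M W H t I \<longleftrightarrow>
    I \<in> borel_measurable M \<and>
    (\<forall>e>0. (\<lambda>n. measure M {\<omega> \<in> space M.
        e < norm ((\<Sum>k<n. H (t * real k / real n) \<omega> *v
                  (W (t * real (k + 1) / real n) \<omega> - W (t * real k / real n) \<omega>)) - I \<omega>)})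
      \<longlonglongrightarrow> 0)"

text \<open>\<open>X\<close> solves the equation reflected along \<open>\<nu>\<close> in the closure of \<open>G\<close> with \<open>X(0) = x\<close>, and \<open>L\<close>
  is its local time on the boundary.  That \<open>L\<close> increases only when \<open>X\<close> is on the boundary is
  expressed by \<open>dL = I(X \<in> \<partial>G) dL\<close>; integrals with respect to \<open>L\<close> are Lebesgue--Stieltjes integrals.\<close>

definition reflected_sde_solution ::
    "'w measure \<Rightarrow> (real \<Rightarrow> 'w measure) \<Rightarrow> (real \<Rightarrow> 'w \<Rightarrow> real^'d::finite) \<Rightarrow>
     (real^'d) set \<Rightarrow> (real^'d \<Rightarrow> real^'d) \<Rightarrow> (real^'d \<Rightarrow> real^'d) \<Rightarrow> (real^'d \<Rightarrow> real^'d^'d) \<Rightarrow>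
     real^'d \<Rightarrow> (real \<Rightarrow> 'w \<Rightarrow> real^'d) \<Rightarrow> (real \<Rightarrow> 'w \<Rightarrow> real) \<Rightarrow> bool"
  where "reflected_sde_solution M F W G \<nu> b \<sigma> x X L \<longleftrightarrow>
    (\<forall>t\<ge>0. X t \<in> borel_measurable (F t) \<and> L t \<in> borel_measurable (F t)) \<and>
    (AE \<omega> in M. continuous_on {0..} (\<lambda>t. X t \<omega>) \<and> (\<forall>t\<ge>0. X t \<omega> \<in> closure G)) \<and>
    (AE \<omega> in M. L 0 \<omega> = 0 \<and> continuous_on {0..} (\<lambda>t. L t \<omega>) \<and> mono_on {0..} (\<lambda>t. L t \<omega>)) \<and>
    (AE \<omega> in M. \<forall>t\<ge>0. L t \<omega> =
       (LINT s:{0..t}|interval_measure (\<lambda>s. L (max 0 s) \<omega>). indicator (frontier G) (X s \<omega>))) \<and>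
    (\<forall>t\<ge>0. \<exists>I. ito_integral_on M W (\<lambda>s \<omega>. \<sigma> (X s \<omega>)) t I \<and>
      (AE \<omega> in M. X t \<omega> = x + (LINT s:{0..t}|lborel. b (X s \<omega>)) + I \<omega> +
         (LINT s:{0..t}|interval_measure (\<lambda>s. L (max 0 s) \<omega>).
            indicator (frontier G) (X s \<omega>) *\<^sub>R \<nu> (X s \<omega>))))"

text \<open>\<open>\<mu>\<close> is an invariant probability measure on the state space \<open>S\<close> of the Markov family
  \<open>X\<close>, where \<open>X x\<close> is the process started at \<open>x\<close>.\<close>

definition invariant_prob ::
    "'w measure \<Rightarrow> 'a::topological_space set \<Rightarrow> ('a \<Rightarrow> real \<Rightarrow> 'w \<Rightarrow> 'a) \<Rightarrow> 'a measure \<Rightarrow> bool"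
  where "invariant_prob M S X \<mu> \<longleftrightarrow>
    prob_space \<mu> \<and> sets \<mu> = sets borel \<and> emeasure \<mu> (- S) = 0 \<and>
    (\<forall>t\<ge>0. \<forall>A\<in>sets borel.
      (\<integral>\<^sup>+x\<in>S. emeasure M {\<omega> \<in> space M. X x t \<omega> \<in> A} \<partial>\<mu>) = emeasure \<mu> A)"

definition density_on :: "(real^'d::finite) set \<Rightarrow> (real^'d \<Rightarrow> real) \<Rightarrow> (real^'d) measure"
  where "density_on S \<rho> = density lborel (\<lambda>x. ennreal (indicator S x * \<rho> x))"

section \<open>The parabolic Neumann problem\<close>

text \<open>\<open>D i j\<close> is the \<open>i\<close>-th time derivative of the derivative of \<open>u\<close> with multi-index \<open>j\<close> on
  \<open>{0..<T} \<times> closure G\<close>, for \<open>2i + |j| \<le> 4\<close>.  At \<open>t = 0\<close> time derivatives are one-sided; at the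
  boundary space derivatives are continuous extensions from \<open>G\<close>.\<close>

definition parabolic_derivatives ::
    "real \<Rightarrow> (real^'d::finite) set \<Rightarrow> (real \<Rightarrow> real^'d \<Rightarrow> real) \<Rightarrow>
     (nat \<Rightarrow> ('d \<Rightarrow> nat) \<Rightarrow> real \<Rightarrow> real^'d \<Rightarrow> real) \<Rightarrow> bool"
  where "parabolic_derivatives T G u D \<longleftrightarrow>
    (\<forall>t\<in>{0..<T}. \<forall>x\<in>closure G. D 0 mi_zero t x = u t x) \<and>
    (\<forall>i j. 2 * i + mi_order j \<le> 4 \<longrightarrow>
       continuous_on ({0..<T} \<times> closure G) (\<lambda>(t, x). D i j t x)) \<and>
    (\<forall>i l j. 2 * i + mi_order (mi_incr l j) \<le> 4 \<longrightarrow>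
       (\<forall>t\<in>{0..<T}. \<forall>x\<in>G. has_partial_derivative (D i j t) l (D i (mi_incr l j) t x) x)) \<and>
    (\<forall>i j. 2 * Suc i + mi_order j \<le> 4 \<longrightarrow>
       (\<forall>t\<in>{0..<T}. \<forall>x\<in>closure G.
          ((\<lambda>s. D i j s x) has_real_derivative D (Suc i) j t x) (at t within {0..<T})))"

definition solves_neumann_problem ::
    "real \<Rightarrow> (real^'d::finite) set \<Rightarrow> (real^'d \<Rightarrow> real^'d) \<Rightarrow> (real^'d \<Rightarrow> real^'d) \<Rightarrow>
     (real^'d \<Rightarrow> real^'d^'d) \<Rightarrow> (real^'d \<Rightarrow> real) \<Rightarrow> (real \<Rightarrow> real^'d \<Rightarrow> real) \<Rightarrow>
     (nat \<Rightarrow> ('d \<Rightarrow> nat) \<Rightarrow> real \<Rightarrow> real^'d \<Rightarrow> real) \<Rightarrow> bool"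
  where "solves_neumann_problem T G \<nu> b a \<phi> u D \<longleftrightarrow>
    parabolic_derivatives T G u D \<and>
    (\<forall>t\<in>{0..<T}. \<forall>x\<in>closure G.
       D 1 mi_zero t x
       + (1/2) * (\<Sum>i\<in>UNIV. \<Sum>j\<in>UNIV. a x $ i $ j * D 0 (mi_incr i (mi_incr j mi_zero)) t x)
       + (\<Sum>i\<in>UNIV. b x $ i * D 0 (mi_incr i mi_zero) t x) = 0) \<and>
    (\<forall>x\<in>closure G. u T x = 0) \<and>
    (\<forall>t\<in>{0..<T}. \<forall>z\<in>frontier G.
       (\<Sum>i\<in>UNIV. \<nu> z $ i * D 0 (mi_incr i mi_zero) t z) = \<phi> z)"

definition parabolic_norm4 ::
    "real \<Rightarrow> (real^'d::finite) set \<Rightarrow> (nat \<Rightarrow> ('d \<Rightarrow> nat) \<Rightarrow> real \<Rightarrow> real^'d \<Rightarrow> real) \<Rightarrow> ennreal"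
  where "parabolic_norm4 T G D =
    (\<Sum>p=0..4. \<Sum>(i, j)\<in>{(i, j). 2 * i + mi_order j = p}.
       SUP (t, x)\<in>{0..<T} \<times> closure G. ennreal \<bar>D i j t x\<bar>)"

section \<open>The reflected random walk\<close>

text \<open>Independent signs \<open>\<xi> k i\<close>, \<open>k = 1, 2, \<dots>\<close>.\<close>

definition random_signs :: "'p measure \<Rightarrow> (nat \<Rightarrow> 'd::finite \<Rightarrow> 'p \<Rightarrow> real) \<Rightarrow> bool"
  where "random_signs P \<xi> \<longleftrightarrow>
    prob_space P \<and>
    prob_space.indep_vars P (\<lambda>_. borel) (\<lambda>(k, i). \<xi> k i) ({1..} \<times> UNIV) \<and>
    (\<forall>k\<ge>1. \<forall>i. (\<forall>\<omega>\<in>space P. \<xi> k i \<omega> = 1 \<or> \<xi> k i \<omega> = -1) \<and>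
       measure P {\<omega> \<in> space P. \<xi> k i \<omega> = 1} = 1/2 \<and>
       measure P {\<omega> \<in> space P. \<xi> k i \<omega> = -1} = 1/2)"

definition trial_step ::
    "(real^'d \<Rightarrow> real^'d::finite) \<Rightarrow> (real^'d \<Rightarrow> real^'d^'d) \<Rightarrow> real \<Rightarrow> real^'d \<Rightarrow> real^'d \<Rightarrow> real^'d"
  where "trial_step b \<sigma> h y e = y + h *\<^sub>R b y + sqrt h *\<^sub>R (\<sigma> y *v e)"

definition reflect_step :: "(real^'d::finite) set \<Rightarrow> (real^'d \<Rightarrow> real^'d) \<Rightarrow> real^'d \<Rightarrow> real^'d"
  where "reflect_step G \<nu> y =
    (if y \<in> closure G then y
     else (let p = closest_point (frontier G) y in y + (2 * dist y p) *\<^sub>R \<nu> p))"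

text \<open>The chain as a function of the realisation \<open>e 1, e 2, \<dots>\<close> of the noise.\<close>

primrec reflected_walk ::
    "(real^'d::finite) set \<Rightarrow> (real^'d \<Rightarrow> real^'d) \<Rightarrow> (real^'d \<Rightarrow> real^'d) \<Rightarrow> (real^'d \<Rightarrow> real^'d^'d) \<Rightarrow>
     real \<Rightarrow> real^'d \<Rightarrow> (nat \<Rightarrow> real^'d) \<Rightarrow> nat \<Rightarrow> real^'d"
  where
    "reflected_walk G \<nu> b \<sigma> h x e 0 = x"
  | "reflected_walk G \<nu> b \<sigma> h x e (Suc k) =
       reflect_step G \<nu> (trial_step b \<sigma> h (reflected_walk G \<nu> b \<sigma> h x e k) (e (Suc k)))"

text \<open>The sum over \<open>k = 0, \<dots>, n - 1\<close> of \<open>2 r \<phi>(X\<^sup>\<pi>) / \<alpha>(X\<^sup>\<pi>)\<close> at step \<open>k + 1\<close>, restricted to steps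
  whose trial point leaves the closure of \<open>G\<close>.\<close>

definition boundary_sum ::
    "(real^'d::finite) set \<Rightarrow> (real^'d \<Rightarrow> real^'d) \<Rightarrow> (real^'d \<Rightarrow> real^'d) \<Rightarrow> (real^'d \<Rightarrow> real^'d^'d) \<Rightarrow>
     (real^'d \<Rightarrow> real) \<Rightarrow> real \<Rightarrow> real^'d \<Rightarrow> (nat \<Rightarrow> real^'d) \<Rightarrow> nat \<Rightarrow> real"
  where "boundary_sum G \<nu> b \<sigma> \<phi> h x e n =
    (\<Sum>k<n. let y = trial_step b \<sigma> h (reflected_walk G \<nu> b \<sigma> h x e k) (e (Suc k));
                p = closest_point (frontier G) y;
                r = dist y p
            in 2 * r * \<phi> p / conormal_coeff \<nu> (diffusion_matrix \<sigma>) p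
               * indicator (- closure G) y)"

end

theory Submission
  imports Defs
begin

text \<open>
  Let \<open>\<phi> = (\<psi> - \<psi>bar) / \<alpha>\<close> and let \<open>u\<close> solve the Neumann problem.  When a trial point leaves \<open>G\<close>, the
  projection \<open>p\<close> is the midpoint of the trial point and its reflection, so that the reflection changes
  \<open>u\<close> by \<open>2 r \<phi>(p)\<close> up to \<open>O(h r)\<close>; the equation \<open>u\<^sub>t + A u = 0\<close> makes the mean change in the trial
  step \<open>O(h\<^sup>2)\<close>.  Telescoping \<open>u(t\<^sub>n, X\<^sub>n)\<close> gives
  \<open>\<bar>E Z\<^sub>1 - \<psi>bar E Z\<^sub>2\<bar> \<le> C (1 + h T + h E Z\<^sub>2)\<close>.  The growth of \<open>E exp(\<theta> X\<^sub>n)\<close> (one coordinate of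
  the chain, \<open>\<theta>\<close> large) in the interior must be compensated by reflections, hence \<open>E Z\<^sub>2 \<ge> c T - C\<close>; for
  bounded \<open>T\<close> the ratio is bounded by \<open>sup \<bar>\<psi>\<bar>\<close>.

  Trial points may lie outside the closure of \<open>G\<close>, where \<open>u\<close> is undefined.  Instead of extending \<open>u\<close>, its
  cubic Taylor polynomial at the current point is used there.  The Taylor remainders on the closure
  are bounded by integrating along three segments inside \<open>G\<close> (up, across and down in a graph chart).
\<close>

section \<open>Means over sign vectors and cubic polynomials\<close>

text \<open>One step has length of order sqrt h. A cubic polynomial in space, with a first-order
  correction in time, therefore leaves O(h^2) per step and O(h T) in total; lower degrees would not
  do. The reflection error O(h r) sums to h E Z_2. No upper bound for E Z_2 is required to handle
  it, since division by E Z_2 turns it into O(h). The lower bound E Z_2 \<ge> c T - C turns the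
  other two errors, O(h T) and the two end values of u, into O(h) and O(1/T) for large T.

  The chain depends on finitely many signs, so all expectations are finite averages and conditioning
  on the past is splitting off the last noise vector.

  The geometric obstacle is uniformity. The inward normal points into G only for a time depending on
  the boundary point, and straight segments between points of the closure may leave G. Both are
  repaired in graph charts and made uniform by compactness.\<close>

definition sign_vectors :: "(real^'d::finite) set"
  where "sign_vectors = {v. \<forall>i. v $ i = 1 \<or> v $ i = -1}"

definition sign_mean :: "(real^'d::finite \<Rightarrow> real) \<Rightarrow> real"
  where "sign_mean f = (\<Sum>v\<in>sign_vectors. f v) / card (sign_vectors :: (real^'d) set)"

lemma sign_vectors_eq_image:
  "sign_vectors = (\<lambda>f. \<chi> i. f i) ` (PiE (UNIV :: 'd::finite set) (\<lambda>_. {1, -1::real}))"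
proof -
  have "v \<in> (\<lambda>f. \<chi> i. f i) ` (PiE UNIV (\<lambda>_. {1, -1}))" if "v \<in> sign_vectors" for v :: "real^'d"
    using that by (intro image_eqI[where x = "\<lambda>i. v $ i"]) (auto simp: sign_vectors_def vec_eq_iff)
  then show ?thesis
    by (auto simp: sign_vectors_def)
qed

lemma finite_sign_vectors [simp]: "finite (sign_vectors :: (real^'d::finite) set)"
  unfolding sign_vectors_eq_image by (intro finite_imageI finite_PiE) auto

lemma card_sign_vectors: "card (sign_vectors :: (real^'d::finite) set) = 2 ^ CARD('d)"
proof -
  have "inj_on (\<lambda>f. \<chi> i. f i) (PiE (UNIV :: 'd set) (\<lambda>_. {1, -1::real}))"
    by (auto simp: inj_on_def vec_eq_iff)
  then show ?thesis
    unfolding sign_vectors_eq_image by (simp add: card_image card_PiE numeral_2_eq_2)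
qed

lemma sign_mean_add: "sign_mean (\<lambda>v. f v + g v) = sign_mean f + sign_mean g"
  by (simp add: sign_mean_def sum.distrib add_divide_distrib)

lemma sign_mean_diff: "sign_mean (\<lambda>v. f v - g v) = sign_mean f - sign_mean g"
  by (simp add: sign_mean_def sum_subtractf diff_divide_distrib)

lemma sign_mean_cmult: "sign_mean (\<lambda>v. c * f v) = c * sign_mean f"
  by (simp add: sign_mean_def sum_distrib_left)

lemma sign_mean_sum: "sign_mean (\<lambda>v. \<Sum>i\<in>I. f i v) = (\<Sum>i\<in>I. sign_mean (f i))"
  by (simp add: sign_mean_def sum_divide_distrib sum.swap[of _ I])

lemma sign_mean_const: "sign_mean (\<lambda>v::real^'d::finite. c) = c"
  by (simp add: sign_mean_def card_sign_vectors)

lemma sign_mean_mono: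
  assumes "\<And>v. v \<in> sign_vectors \<Longrightarrow> f v \<le> g v"
  shows "sign_mean f \<le> sign_mean g"
  unfolding sign_mean_def by (intro divide_right_mono sum_mono assms) auto

lemma sign_mean_cong:
  assumes "\<And>v. v \<in> sign_vectors \<Longrightarrow> f v = g v"
  shows "sign_mean f = sign_mean g"
  unfolding sign_mean_def using assms by (auto intro!: arg_cong2[where f = "(/)"] sum.cong)

lemma sign_mean_abs: "\<bar>sign_mean f\<bar> \<le> sign_mean (\<lambda>v. \<bar>f v\<bar>)"
  unfolding sign_mean_def by (simp add: divide_right_mono sum_abs)

lemma sign_mean_uminus: "sign_mean (\<lambda>v. f (- v)) = sign_mean f"
proof -
  have "(\<Sum>v\<in>sign_vectors. f (- v)) = (\<Sum>v\<in>sign_vectors. f v)"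
    by (rule sum.reindex_bij_witness[of _ uminus uminus]) (auto simp: sign_vectors_def)
  then show ?thesis
    by (simp add: sign_mean_def)
qed

lemma sign_mean_component: "sign_mean (\<lambda>v. v $ i) = 0"
proof -
  have "sign_mean (\<lambda>v. v $ i) = sign_mean (\<lambda>v. - 1 * v $ i)"
    using sign_mean_uminus[of "\<lambda>v. v $ i"] by simp
  then show ?thesis
    unfolding sign_mean_cmult by simp
qed

lemma sign_mean_component_mult:
  "sign_mean (\<lambda>v::real^'d::finite. v $ i * v $ j) = (if i = j then 1 else 0)"
proof (cases "i = j")
  case True
  have "sign_mean (\<lambda>v::real^'d. v $ i * v $ j) = sign_mean (\<lambda>v::real^'d. 1)"
    using True by (intro sign_mean_cong) (auto simp: sign_vectors_def dest!: spec[of _ j])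
  then show ?thesis
    using True by (simp add: sign_mean_const)
next
  case False
  \<comment> \<open>Reversing the single coordinate i is a bijection of the sign vectors that
    changes the sign of the product, so the mean is its own negative.\<close>
  define flip :: "real^'d \<Rightarrow> real^'d" where "flip v = (\<chi> k. if k = i then - v $ k else v $ k)" for v
  have "(\<Sum>v\<in>sign_vectors. v $ i * v $ j) = (\<Sum>v\<in>sign_vectors. - (v $ i * v $ j))"
    using False
    by (intro sum.reindex_bij_witness[of _ flip flip])
      (auto simp: sign_vectors_def flip_def vec_eq_iff)
  then show ?thesis
    using False by (simp add: sign_mean_def sum_negf)
qed

lemma sign_mean_matrix_vector:
  "sign_mean (\<lambda>v. (A *v v) $ i) = 0" for A :: "real^'d^'n::finite"
  by (simp add: matrix_vector_mult_def sign_mean_sum sign_mean_cmult sign_mean_component)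

text \<open>The signs are uncorrelated with unit variance, so the covariance of the noise is exactly
  the diffusion matrix of the generator.\<close>

lemma sign_mean_matrix_vector_mult:
  fixes A :: "real^'d::finite^'n::finite"
  shows "sign_mean (\<lambda>v. (A *v v) $ i * (A *v v) $ j) = (A ** transpose A) $ i $ j"
proof -
  have "sign_mean (\<lambda>v. (A *v v) $ i * (A *v v) $ j)
      = sign_mean (\<lambda>v. \<Sum>k\<in>UNIV. \<Sum>l\<in>UNIV. (A $ i $ k * A $ j $ l) * (v $ k * v $ l))"
    by (simp add: matrix_vector_mult_def sum_product mult_ac)
  also have "\<dots> = (\<Sum>k\<in>UNIV. \<Sum>l\<in>UNIV. (A $ i $ k * A $ j $ l) * (if k = l then 1 else 0))"
    by (simp only: sign_mean_sum sign_mean_cmult sign_mean_component_mult)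
  also have "\<dots> = (\<Sum>k\<in>UNIV. A $ i $ k * A $ j $ k)"
    by (intro sum.cong refl) (simp add: if_distrib cong: if_cong)
  finally show ?thesis
    by (simp add: matrix_matrix_mult_def transpose_def)
qed

section \<open>Linear, quadratic and cubic forms with coefficient functions\<close>

definition lin :: "('d::finite \<Rightarrow> real) \<Rightarrow> real^'d \<Rightarrow> real"
  where "lin g u = (\<Sum>i\<in>UNIV. g i * u $ i)"

text \<open>Coefficients are functions of indices, so that derivatives indexed by multi-indices can
  be inserted directly. Nesting \<open>lin\<close> lets every algebraic rule and every bound follow
  from the linear case.\<close>

definition quad :: "('d::finite \<Rightarrow> 'd \<Rightarrow> real) \<Rightarrow> real^'d \<Rightarrow> real^'d \<Rightarrow> real"
  where "quad H u v = lin (\<lambda>i. lin (H i) v) u"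

definition tri :: "('d::finite \<Rightarrow> 'd \<Rightarrow> 'd \<Rightarrow> real) \<Rightarrow> real^'d \<Rightarrow> real^'d \<Rightarrow> real^'d \<Rightarrow> real"
  where "tri T u v w = lin (\<lambda>i. quad (T i) v w) u"

lemma lin_add: "lin g (u + v) = lin g u + lin g v"
  and lin_diff: "lin g (u - v) = lin g u - lin g v"
  and lin_scaleR: "lin g (c *\<^sub>R u) = c * lin g u"
  and lin_minus: "lin g (- u) = - lin g u"
  and lin_axis: "lin g (axis l 1) = g l"
  and lin_fun_add: "lin (\<lambda>i. g i + g' i) u = lin g u + lin g' u"
  and lin_fun_diff: "lin (\<lambda>i. g i - g' i) u = lin g u - lin g' u"
  and lin_fun_minus: "lin (\<lambda>i. - g i) u = - lin g u"
  and lin_fun_cmult: "lin (\<lambda>i. c * g i) u = c * lin g u"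
  by (simp_all add: lin_def algebra_simps sum.distrib sum_subtractf sum_distrib_left axis_def
      if_distrib sum_negf cong: if_cong)

lemmas lin_simps = lin_add lin_diff lin_scaleR lin_minus lin_axis
  lin_fun_add lin_fun_diff lin_fun_minus lin_fun_cmult

lemma quad_simps:
  "quad H (u + u') v = quad H u v + quad H u' v"
  "quad H (u - u') v = quad H u v - quad H u' v"
  "quad H (c *\<^sub>R u) v = c * quad H u v"
  "quad H (- u) v = - quad H u v"
  "quad H (axis l 1) v = lin (H l) v"
  "quad H u (v + v') = quad H u v + quad H u v'"
  "quad H u (v - v') = quad H u v - quad H u v'"
  "quad H u (c *\<^sub>R v) = c * quad H u v"
  "quad H u (- v) = - quad H u v"
  by (simp_all add: quad_def lin_simps)

lemma tri_simps:
  "tri T (u + u') v w = tri T u v w + tri T u' v w"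
  "tri T (u - u') v w = tri T u v w - tri T u' v w"
  "tri T (c *\<^sub>R u) v w = c * tri T u v w"
  "tri T (- u) v w = - tri T u v w"
  "tri T (axis l 1) v w = quad (T l) v w"
  "tri T u (v + v') w = tri T u v w + tri T u v' w"
  "tri T u (v - v') w = tri T u v w - tri T u v' w"
  "tri T u (c *\<^sub>R v) w = c * tri T u v w"
  "tri T u (- v) w = - tri T u v w"
  "tri T u v (w + w') = tri T u v w + tri T u v w'"
  "tri T u v (w - w') = tri T u v w - tri T u v w'"
  "tri T u v (c *\<^sub>R w) = c * tri T u v w"
  "tri T u v (- w) = - tri T u v w"
  by (simp_all add: tri_def quad_simps lin_simps)

lemma quad_commute:
  assumes "\<And>i j. H i j = H j i"
  shows "quad H u v = quad H v u"
proof -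
  have "quad H u v = (\<Sum>i\<in>UNIV. \<Sum>j\<in>UNIV. H i j * u $ i * v $ j)"
    by (simp add: quad_def lin_def sum_distrib_right sum_distrib_left mult_ac)
  also have "\<dots> = (\<Sum>i\<in>UNIV. \<Sum>j\<in>UNIV. H i j * u $ j * v $ i)"
    by (subst sum.swap) (simp add: assms[symmetric])
  also have "\<dots> = quad H v u"
    by (simp add: quad_def lin_def sum_distrib_right sum_distrib_left mult_ac)
  finally show ?thesis .
qed

text \<open>The two assumed symmetries are the adjacent transpositions, which generate all
  permutations of the three arguments.\<close>

lemma tri_commute:
  assumes "\<And>i j k. T i j k = T j i k" "\<And>i j k. T i j k = T i k j"
  shows "tri T u v w = tri T v u w" "tri T u v w = tri T u w v"
proof -
  show "tri T u v w = tri T u w v"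
    unfolding tri_def using assms(2) by (subst quad_commute) auto
  have tri_quad: "tri T u v w = quad (\<lambda>i j. lin (T i j) w) u v" for u v
    by (simp add: tri_def quad_def)
  show "tri T u v w = tri T v u w"
    unfolding tri_quad by (rule quad_commute) (metis assms(1) ext)
qed

lemma lin_bound:
  fixes u :: "real^'d::finite" and B :: real
  assumes "\<And>i. \<bar>g i\<bar> \<le> B"
  shows "\<bar>lin g u\<bar> \<le> CARD('d) * B * norm u"
proof -
  have "\<bar>lin g u\<bar> \<le> (\<Sum>i\<in>UNIV. \<bar>g i\<bar> * \<bar>u $ i\<bar>)"
    by (simp add: lin_def sum_abs order_trans[OF sum_abs] abs_mult)
  also have "\<dots> \<le> (\<Sum>i\<in>(UNIV::'d set). B * norm u)"
    using assms by (intro sum_mono mult_mono component_le_norm_cart) (auto intro: order_trans[OF abs_ge_zero])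
  finally show ?thesis by simp
qed

lemma quad_bound:
  fixes u :: "real^'d::finite" and B :: real
  assumes "\<And>i j. \<bar>H i j\<bar> \<le> B"
  shows "\<bar>quad H u v\<bar> \<le> real CARD('d)^2 * B * norm u * norm v"
  using lin_bound[of "\<lambda>i. lin (H i) v", OF lin_bound[OF assms], of u]
  by (simp add: quad_def power2_eq_square mult_ac)

lemma tri_bound:
  fixes u :: "real^'d::finite" and B :: real
  assumes "\<And>i j k. \<bar>T i j k\<bar> \<le> B"
  shows "\<bar>tri T u v w\<bar> \<le> real CARD('d)^3 * B * norm u * norm v * norm w"
  using lin_bound[of "\<lambda>i. quad (T i) v w", OF quad_bound[OF assms], of u]
  by (simp add: tri_def power2_eq_square power3_eq_cube mult_ac)

text \<open>With \<open>v\<close> the midpoint of \<open>v \<plusminus> w\<close>, the even terms of the difference cancel.\<close>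

lemma cubic_midpoint:
  fixes c :: real and g :: "'d::finite \<Rightarrow> real" and v w :: "real^'d"
  assumes "\<And>i j. H i j = H j i" "\<And>i j k. T i j k = T j i k" "\<And>i j k. T i j k = T i k j"
  defines "q \<equiv> \<lambda>v. c + lin g v + quad H v v / 2 + tri T v v v / 6"
  shows "q (v + w) - q (v - w)
    = 2 * lin (\<lambda>i. g i + lin (H i) v + quad (T i) v v / 2) w + tri T w w w / 3"
proof -
  have H: "quad H v w = quad H w v"
    by (rule quad_commute) fact
  have T: "tri T v w v = tri T w v v" "tri T v v w = tri T w v v"
    "tri T w v w = tri T v w w" "tri T w w v = tri T v w w"
    using tri_commute[of T, OF assms(2,3)] by metis+
  have "lin (\<lambda>i. g i + lin (H i) v + quad (T i) v v / 2) w
      = lin g w + quad H w v + tri T w v v / 2"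
    using lin_fun_cmult[of "1/2" "\<lambda>i. quad (T i) v v" w]
    by (simp add: lin_fun_add quad_def tri_def)
  then show ?thesis
    unfolding q_def by (simp add: lin_simps quad_simps tri_simps H T field_simps)
qed

text \<open>This is the weak one-step expansion. In the quadratic part the noise contributes its
  covariance at order h and the drift only h^2. In the cubic part the terms odd in the noise average
  to zero, and every remaining term contains the drift, hence is O(h^2).\<close>

lemma sign_mean_cubic:
  fixes A :: "real^'d::finite^'d" and g :: "'d \<Rightarrow> real" and B :: real
  assumes H: "\<And>i j. \<bar>H i j\<bar> \<le> B" and T: "\<And>i j k. \<bar>T i j k\<bar> \<le> B"
    and h: "0 < h" "h \<le> 1" and m: "norm m \<le> K" and A: "\<And>v. v \<in> sign_vectors \<Longrightarrow> norm (A *v v) \<le> K"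
    and K: "1 \<le> K"
  defines "y \<equiv> \<lambda>v. h *\<^sub>R m + sqrt h *\<^sub>R (A *v v)"
  shows "\<bar>sign_mean (\<lambda>v. lin g (y v) + quad H (y v) (y v) / 2 + tri T (y v) (y v) (y v) / 6)
      - h * (lin g m + (\<Sum>i\<in>UNIV. \<Sum>j\<in>UNIV. (A ** transpose A) $ i $ j * H i j) / 2)\<bar>
    \<le> 2 * real CARD('d)^3 * B * K^3 * h^2"
proof -
  let ?s = "\<lambda>v. A *v v"
  let ?d = "real CARD('d)"
  have B: "0 \<le> B"
    using H[of undefined undefined] by simp
  have sq: "sqrt h * sqrt h = h"
    using h by simp
  have lin0: "sign_mean (\<lambda>v. lin g (?s v)) = 0" for g
    by (simp add: lin_def sign_mean_sum sign_mean_cmult sign_mean_matrix_vector)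
  have m1: "sign_mean (\<lambda>v. lin g (y v)) = h * lin g m"
    by (simp add: y_def lin_simps sign_mean_add sign_mean_cmult sign_mean_const lin0)
  have qq: "sign_mean (\<lambda>v. quad H (?s v) (?s v)) = (\<Sum>i\<in>UNIV. \<Sum>j\<in>UNIV. (A ** transpose A) $ i $ j * H i j)"
  proof -
    have "sign_mean (\<lambda>v. quad H (?s v) (?s v))
        = sign_mean (\<lambda>v. \<Sum>i\<in>UNIV. \<Sum>j\<in>UNIV. H i j * ((?s v) $ i * (?s v) $ j))"
      by (simp add: quad_def lin_def sum_distrib_left sum_distrib_right mult_ac)
    then show ?thesis
      by (simp add: sign_mean_sum sign_mean_cmult sign_mean_matrix_vector_mult mult.commute)
  qed
  have ql: "quad H (?s v) m = lin (\<lambda>i. lin (H i) m) (?s v)" "quad H m (?s v) = lin (\<lambda>j. lin (\<lambda>i. H i j) m) (?s v)" for v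
    by (simp_all add: quad_def lin_def sum_distrib_right sum_distrib_left mult_ac) (rule sum.swap)
  have "sign_mean (\<lambda>v. quad H (y v) (y v)) = sign_mean (\<lambda>v. h^2 * quad H m m
      + (h * sqrt h) * lin (\<lambda>i. lin (H i) m) (?s v) + (h * sqrt h) * lin (\<lambda>j. lin (\<lambda>i. H i j) m) (?s v)
      + (sqrt h * sqrt h) * quad H (?s v) (?s v))"
    by (intro sign_mean_cong) (simp only: y_def quad_simps ql power2_eq_square algebra_simps)
  then have m2: "sign_mean (\<lambda>v. quad H (y v) (y v)) = h^2 * quad H m m
      + h * (\<Sum>i\<in>UNIV. \<Sum>j\<in>UNIV. (A ** transpose A) $ i $ j * H i j)"
    by (simp only: sign_mean_add sign_mean_cmult sign_mean_const lin0 qq sq)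
  have b2: "\<bar>h^2 * quad H m m\<bar> \<le> ?d^3 * B * K^3 * h^2"
  proof -
    have "\<bar>quad H m m\<bar> \<le> ?d^2 * B * norm m * norm m"
      by (rule quad_bound[OF H])
    also have "\<dots> \<le> ?d^3 * B * K^3"
    proof -
      have "norm m * norm m \<le> K * K"
        using m K by (intro mult_mono) auto
      also have "K * K \<le> K^3"
        using K by (simp add: power3_eq_cube mult_le_cancel_left1)
      finally have "norm m * norm m \<le> K^3" .
      moreover have "?d^2 \<le> ?d^3"
        by (intro power_increasing) (auto simp: Suc_le_eq)
      ultimately have "(?d^2 * B) * (norm m * norm m) \<le> (?d^3 * B) * K^3"
        using B by (intro mult_mono mult_right_mono) auto
      then show ?thesis by (simp add: mult_ac)
    qed
    finally show ?thesis
      by (simp add: abs_mult mult.commute[of _ "h\<^sup>2"] mult_left_mono)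
  qed
  have tb: "\<bar>tri T a b c\<bar> \<le> ?d^3 * B * K^3" if "norm a \<le> K" "norm b \<le> K" "norm c \<le> K" for a b c
  proof -
    have "\<bar>tri T a b c\<bar> \<le> ?d^3 * B * norm a * norm b * norm c"
      by (rule tri_bound[OF T])
    also have "\<dots> \<le> ?d^3 * B * K * K * K"
      using that K B by (intro mult_mono) auto
    finally show ?thesis by (simp add: power3_eq_cube mult_ac)
  qed
  have m3: "\<bar>sign_mean (\<lambda>v. tri T (y v) (y v) (y v))\<bar> \<le> 4 * (?d^3 * B * K^3 * h^2)"
  proof -
    \<comment> \<open>The even part in v of the cubic form: three drifts give h^3, and one drift
      with two noise factors gives h * h.\<close>
    let ?e = "\<lambda>v. h^3 * tri T m m m
      + h^2 * (tri T m (?s v) (?s v) + tri T (?s v) m (?s v) + tri T (?s v) (?s v) m)"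
    have "sign_mean (\<lambda>v. tri T (y v) (y v) (y v))
        = (sign_mean (\<lambda>v. tri T (y v) (y v) (y v)) + sign_mean (\<lambda>v. tri T (y (-v)) (y (-v)) (y (-v)))) / 2"
      by (simp only: sign_mean_uminus[of "\<lambda>v. tri T (y v) (y v) (y v)"]) simp
    also have "\<dots> = sign_mean (\<lambda>v. (1/2) * (tri T (y v) (y v) (y v) + tri T (y (-v)) (y (-v)) (y (-v))))"
      by (simp only: sign_mean_add[symmetric] sign_mean_cmult)
    also have "\<dots> = sign_mean ?e"
    proof (intro sign_mean_cong)
      fix v :: "real^'d"
      have minus: "?s (- v) = - ?s v"
        by (simp add: vec_eq_iff matrix_vector_mult_def sum_negf)
      have "tri T (y v) (y v) (y v) + tri T (y (-v)) (y (-v)) (y (-v))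
        = 2 * (h^3 * tri T m m m + h * (sqrt h * sqrt h) * (tri T m (?s v) (?s v) + tri T (?s v) m (?s v) + tri T (?s v) (?s v) m))"
        unfolding y_def minus
        by (simp add: tri_simps power3_eq_cube algebra_simps del: real_sqrt_mult_self)
      then show "1/2 * (tri T (y v) (y v) (y v) + tri T (y (-v)) (y (-v)) (y (-v))) = ?e v"
        by (simp only: sq) (simp add: power2_eq_square)
    qed
    finally have "\<bar>sign_mean (\<lambda>v. tri T (y v) (y v) (y v))\<bar> \<le> sign_mean (\<lambda>v. \<bar>?e v\<bar>)"
      using sign_mean_abs[of ?e] by simp
    also have "\<dots> \<le> sign_mean (\<lambda>v::real^'d. 4 * (?d^3 * B * K^3 * h^2))"
    proof (intro sign_mean_mono)
      fix v :: "real^'d" assume v: "v \<in> sign_vectors"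
      have h3: "h^3 \<le> h^2"
        using h by (simp add: power_decreasing)
      have "\<bar>h^3 * tri T m m m\<bar> \<le> h^2 * (?d^3 * B * K^3)"
        using h h3 tb[OF m m m] by (auto simp: abs_mult intro!: mult_mono)
      moreover have "\<bar>h^2 * tri T a b c\<bar> \<le> h^2 * (?d^3 * B * K^3)"
        if "norm a \<le> K" "norm b \<le> K" "norm c \<le> K" for a b c
        using tb[OF that] by (simp add: abs_mult mult_left_mono)
      note this[OF m A[OF v] A[OF v]] this[OF A[OF v] m A[OF v]] this[OF A[OF v] A[OF v] m]
      ultimately show "\<bar>?e v\<bar> \<le> 4 * (?d^3 * B * K^3 * h^2)"
        by (simp add: algebra_simps)
    qed
    finally show ?thesis by (simp only: sign_mean_const)
  qed
  have "sign_mean (\<lambda>v. lin g (y v) + quad H (y v) (y v) / 2 + tri T (y v) (y v) (y v) / 6)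
    = sign_mean (\<lambda>v. lin g (y v)) + sign_mean (\<lambda>v. quad H (y v) (y v)) / 2
      + sign_mean (\<lambda>v. tri T (y v) (y v) (y v)) / 6"
    using sign_mean_cmult[of "1/2" "\<lambda>v. quad H (y v) (y v)"] sign_mean_cmult[of "1/6" "\<lambda>v. tri T (y v) (y v) (y v)"]
    by (simp add: sign_mean_add)
  then have "sign_mean (\<lambda>v. lin g (y v) + quad H (y v) (y v) / 2 + tri T (y v) (y v) (y v) / 6)
      - h * (lin g m + (\<Sum>i\<in>UNIV. \<Sum>j\<in>UNIV. (A ** transpose A) $ i $ j * H i j) / 2)
    = h^2 * quad H m m / 2 + sign_mean (\<lambda>v. tri T (y v) (y v) (y v)) / 6"
    unfolding m1 m2 by (simp add: field_simps)
  \<comment> \<open>The quadratic remainder contributes 1/2 and the cubic one 4/6 of the common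
    bound, together less than the factor 2.\<close>
  then show ?thesis
    using b2 m3 abs_ge_zero[of "h\<^sup>2 * quad H m m"] by linarith
qed

section \<open>Mean values along segments\<close>

text \<open>The coordinates are changed one at a time, and the one-dimensional mean value theorem is
  applied to each change. Continuity of the partial derivatives then replaces the intermediate
  points by z.\<close>

lemma continuous_partials_has_derivative:
  fixes f :: "real^'d::finite \<Rightarrow> real"
  assumes "open G" "z \<in> G"
    and part: "\<And>i y. y \<in> G \<Longrightarrow> has_partial_derivative f i (f' i y) y"
    and cont: "\<And>i. continuous_on G (f' i)"
  shows "(f has_derivative (\<lambda>h. \<Sum>i\<in>UNIV. f' i z * h $ i)) (at z)"
  unfolding has_derivative_at_alt
proof (intro conjI allI impI)
  show "bounded_linear (\<lambda>h. \<Sum>i\<in>UNIV. f' i z * h $ i)"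
    by (intro bounded_linear_sum
        bounded_linear_compose[OF bounded_linear_mult_right bounded_linear_vec_nth])
next
  fix e :: real assume "0 < e"
  define e' where "e' = e / CARD('d)"
  have "0 < e'"
    using \<open>0 < e\<close> by (simp add: e'_def)
  have "\<exists>d>0. \<forall>y. dist y z < d \<longrightarrow> y \<in> G \<and> \<bar>f' i y - f' i z\<bar> < e'" for i
  proof -
    have "isCont (f' i) z"
      using cont assms(1,2) continuous_on_eq_continuous_at by blast
    then obtain d1 where "d1 > 0" "\<And>y. dist y z < d1 \<Longrightarrow> dist (f' i y) (f' i z) < e'"
      unfolding continuous_at_eps_delta using \<open>0 < e'\<close> by (metis)
    moreover obtain d2 where "d2 > 0" "\<And>y. dist y z < d2 \<Longrightarrow> y \<in> G"
      using assms(1,2) unfolding open_dist by blast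
    ultimately show ?thesis
      by (intro exI[of _ "min d1 d2"]) (auto simp: dist_real_def)
  qed
  then obtain d where d: "\<And>i. d i > 0" "\<And>i y. dist y z < d i \<Longrightarrow> y \<in> G \<and> \<bar>f' i y - f' i z\<bar> < e'"
    by metis
  define d0 where "d0 = Min (range d)"
  have "d0 > 0"
    using d by (auto simp: d0_def)
  have d0: "y \<in> G" "\<bar>f' i y - f' i z\<bar> < e'" if "dist y z < d0" for i y
    using d that by (auto simp: d0_def)
  \<comment> \<open>Induction over a set S of coordinates outside which the increment vanishes; each
    coordinate costs at most \<open>e' * norm h\<close>, and \<open>e'\<close> is e divided by the
    dimension.\<close>
  have step: "\<bar>f (z + h) - f z - (\<Sum>i\<in>S. f' i z * h $ i)\<bar> \<le> card S * e' * norm h"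
    if "finite S" "\<And>i. i \<notin> S \<Longrightarrow> h $ i = 0" "norm h < d0" for S h
    using that
  proof (induction S arbitrary: h rule: finite_induct)
    case empty
    then have "h = 0" by (simp add: vec_eq_iff)
    then show ?case by simp
  next
    case (insert l S)
    define h' where "h' = h - (h $ l) *\<^sub>R axis l 1"
    have h'_nth: "h' $ i = (if i = l then 0 else h $ i)" for i
      by (simp add: h'_def axis_def)
    \<comment> \<open>Only coordinate l is rescaled, by a factor in [0, 1], so the path from h' to h
      never leaves the ball on which the estimates hold.\<close>
    have partial: "norm (h' + (h $ l * s) *\<^sub>R axis l 1) \<le> norm h" if "s \<in> {0..1}" for s
      by (rule norm_le_componentwise_cart)
        (use that in \<open>auto simp: h'_nth axis_def abs_mult mult_left_le\<close>)
    have n': "norm h' \<le> norm h"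
      using partial[of 0] by simp
    then have IH: "\<bar>f (z + h') - f z - (\<Sum>i\<in>S. f' i z * h' $ i)\<bar> \<le> card S * e' * norm h'"
      using insert.prems by (intro insert.IH) (auto simp: h'_nth)
    have eqS: "(\<Sum>i\<in>S. f' i z * h' $ i) = (\<Sum>i\<in>S. f' i z * h $ i)"
      using insert.hyps by (intro sum.cong) (auto simp: h'_nth)
    define w where "w s = z + h' + (h $ l * s) *\<^sub>R axis l 1" for s
    have wd: "dist (w s) z < d0" if "s \<in> {0..1}" for s
      using partial[OF that] insert.prems by (simp add: w_def dist_norm)
    have der: "((\<lambda>s. f (w s)) has_derivative (\<lambda>t. f' l (w s) * h $ l * t)) (at s within {0..1})"
      if "s \<in> {0..1}" for s
    proof -
      have "((\<lambda>t. f (w s + t *\<^sub>R axis l 1)) has_real_derivative f' l (w s)) (at (h $ l * (s - s)))"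
        using part[OF d0(1)[OF wd[OF that]], of l] by (simp add: has_partial_derivative_def)
      then have "((\<lambda>t. f (w s + (h $ l * (t - s)) *\<^sub>R axis l 1)) has_real_derivative f' l (w s) * h $ l) (at s)"
        by (rule DERIV_chain2) (auto intro!: derivative_eq_intros)
      moreover have "w s + (h $ l * (t - s)) *\<^sub>R axis l 1 = w t" for t
        by (simp add: w_def algebra_simps)
      ultimately show ?thesis
        by (simp add: has_field_derivative_def has_derivative_at_withinI)
    qed
    obtain s where s: "s \<in> {0..1}" "f (w 1) - f (w 0) = f' l (w s) * h $ l"
      using mvt_very_simple[of 0 1, OF _ der] by auto
    have w01: "w 1 = z + h" "w 0 = z + h'"
      by (simp_all add: w_def h'_def)
    have "f (z + h) - f z - (\<Sum>i\<in>insert l S. f' i z * h $ i)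
        = (f (z + h') - f z - (\<Sum>i\<in>S. f' i z * h' $ i)) + (f' l (w s) - f' l z) * h $ l"
      using s insert.hyps eqS by (simp add: w01 algebra_simps)
    also have "\<bar>\<dots>\<bar> \<le> card S * e' * norm h' + e' * norm h"
    proof -
      have "\<bar>(f' l (w s) - f' l z) * h $ l\<bar> \<le> e' * norm h"
        unfolding abs_mult
        using d0(2)[OF wd[OF s(1)], of l] component_le_norm_cart[of h l] \<open>0 < e'\<close>
        by (intro mult_mono) auto
      then show ?thesis using IH by linarith
    qed
    also have "\<dots> \<le> card S * e' * norm h + e' * norm h"
      using n' \<open>0 < e'\<close> by (intro add_mono mult_left_mono) auto
    finally show ?case
      using insert.hyps by (simp add: algebra_simps)
  qed
  show "\<exists>d>0. \<forall>y. norm (y - z) < d \<longrightarrow>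
      norm (f y - f z - (\<Sum>i\<in>UNIV. f' i z * (y - z) $ i)) \<le> e * norm (y - z)"
  proof (intro exI[of _ d0] conjI allI impI \<open>d0 > 0\<close>)
    fix y assume "norm (y - z) < d0"
    with step[of UNIV "y - z"] show "norm (f y - f z - (\<Sum>i\<in>UNIV. f' i z * (y - z) $ i)) \<le> e * norm (y - z)"
      by (simp add: e'_def)
  qed
qed

text \<open>Only the open segment has to lie in G. The endpoints may be boundary points, where f is
  merely continuous; this makes Taylor expansion on the closure possible.\<close>

lemma mvt_open_segment:
  fixes f :: "real^'d::finite \<Rightarrow> real"
  assumes G: "open G" "open_segment p q \<subseteq> G"
    and part: "\<And>i y. y \<in> G \<Longrightarrow> has_partial_derivative f i (f' i y) y"
    and cont: "\<And>i. continuous_on G (f' i)"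
    and cont_f: "continuous_on (closed_segment p q) f"
    and "p \<noteq> q"
  obtains z where "z \<in> open_segment p q" "f q - f p = (\<Sum>i\<in>UNIV. f' i z * (q - p) $ i)"
proof -
  define w where "w s = p + s *\<^sub>R (q - p)" for s
  have w_eq: "w s = (1 - s) *\<^sub>R p + s *\<^sub>R q" for s
    by (simp add: w_def algebra_simps)
  have w_open: "w s \<in> open_segment p q" if "0 < s" "s < 1" for s
    using that \<open>p \<noteq> q\<close> unfolding w_eq by (auto simp: in_segment)
  have "continuous_on {0..1} (\<lambda>s. f (w s))"
  proof (rule continuous_on_compose2[OF cont_f])
    show "continuous_on {0..1} w"
      unfolding w_def by (intro continuous_intros)
    show "w ` {0..1} \<subseteq> closed_segment p q"
      by (auto simp: w_eq in_segment)
  qed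
  moreover have "((\<lambda>s. f (w s)) has_derivative (\<lambda>t. \<Sum>i\<in>UNIV. f' i (w s) * (t *\<^sub>R (q - p)) $ i)) (at s)"
    if "0 < s" "s < 1" for s
  proof -
    have "(w has_derivative (\<lambda>t. t *\<^sub>R (q - p))) (at s)"
      unfolding w_def by (auto intro!: derivative_eq_intros)
    moreover have "(f has_derivative (\<lambda>h. \<Sum>i\<in>UNIV. f' i (w s) * h $ i)) (at (w s))"
      using w_open[OF that] G(2) by (intro continuous_partials_has_derivative[OF G(1) _ part cont]) auto
    ultimately show ?thesis
      by (rule has_derivative_compose)
  qed
  ultimately obtain s where "0 < s" "s < 1"
    "f (w 1) - f (w 0) = (\<Sum>i\<in>UNIV. f' i (w s) * ((1 - 0) *\<^sub>R (q - p)) $ i)"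
    by (rule mvt[OF zero_less_one])
  then show ?thesis
    using that[of "w s"] w_open by (simp add: w_def)
qed

lemma mvt_open_segment_bound:
  fixes f :: "real^'d::finite \<Rightarrow> real" and B :: real
  assumes G: "open G" "open_segment p q \<subseteq> G"
    and part: "\<And>i y. y \<in> G \<Longrightarrow> has_partial_derivative f i (f' i y) y"
    and cont: "\<And>i. continuous_on G (f' i)"
    and cont_f: "continuous_on (closed_segment p q) f"
    and B: "\<And>i z. z \<in> open_segment p q \<Longrightarrow> \<bar>f' i z\<bar> \<le> B" "0 \<le> B"
  shows "\<bar>f q - f p\<bar> \<le> CARD('d) * B * dist p q"
proof (cases "p = q")
  case False
  then obtain z where z: "z \<in> open_segment p q" "f q - f p = (\<Sum>i\<in>UNIV. f' i z * (q - p) $ i)"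
    using mvt_open_segment[OF G part cont cont_f] by blast
  have "\<bar>\<Sum>i\<in>UNIV. f' i z * (q - p) $ i\<bar> \<le> (\<Sum>i\<in>(UNIV::'d set). B * dist p q)"
  proof (intro order_trans[OF sum_abs] sum_mono)
    fix i
    have "\<bar>(q - p) $ i\<bar> \<le> dist p q"
      by (metis component_le_norm_cart dist_norm norm_minus_commute)
    then show "\<bar>f' i z * (q - p) $ i\<bar> \<le> B * dist p q"
      unfolding abs_mult using B z by (intro mult_mono) auto
  qed
  then show ?thesis
    using z by simp
qed simp

text \<open>A finite subcover leaves finitely many local constants, and monotonicity in k allows
  taking their maximum. Inserting 1 covers the empty subcover and gives
  \<open>1 \<le> k\<close>.\<close>

lemma compact_uniform:
  fixes Q :: "real \<Rightarrow> 'a::metric_space \<Rightarrow> bool"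
  assumes "compact S"
    and mono: "\<And>k k' y. y \<in> S \<Longrightarrow> k \<le> k' \<Longrightarrow> Q k y \<Longrightarrow> Q k' y"
    and local: "\<And>z. z \<in> S \<Longrightarrow> \<exists>r>0. \<exists>k. \<forall>y\<in>S \<inter> ball z r. Q k y"
  obtains k where "1 \<le> k" "\<And>y. y \<in> S \<Longrightarrow> Q k y"
proof -
  obtain r k where rk: "\<And>z. z \<in> S \<Longrightarrow> r z > 0" "\<And>z y. z \<in> S \<Longrightarrow> y \<in> S \<inter> ball z (r z) \<Longrightarrow> Q (k z) y"
    using local by metis
  have "S \<subseteq> (\<Union>z\<in>S. ball z (r z))"
    using rk(1) by auto
  then obtain F where F: "F \<subseteq> S" "finite F" "S \<subseteq> (\<Union>z\<in>F. ball z (r z))"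
    using compactE_image[OF assms(1), of S "\<lambda>z. ball z (r z)"] by auto
  show thesis
  proof (rule that[of "Max (insert 1 (k ` F))"])
    fix y assume "y \<in> S"
    then obtain z where z: "z \<in> F" "y \<in> ball z (r z)"
      using F by auto
    moreover have "k z \<le> Max (insert 1 (k ` F))"
      using z F by (intro Max_ge) auto
    ultimately show "Q (Max (insert 1 (k ` F))) y"
      using mono[OF \<open>y \<in> S\<close>] rk(2) F \<open>y \<in> S\<close> by blast
  next
    show "1 \<le> Max (insert 1 (k ` F))"
      using F(2) by simp
  qed
qed

section \<open>Geometry of the domain\<close>

text \<open>Needed because \<open>D mi_zero\<close> is tied to the function only on the closure of
  G; in the open set G a derivative depends on nearby values alone.\<close>

lemma has_partial_derivative_cong:
  assumes "open U" "x \<in> U" "\<And>y. y \<in> U \<Longrightarrow> f y = f' y"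
    and "has_partial_derivative f i c x"
  shows "has_partial_derivative f' i c x"
proof -
  have "((\<lambda>s. x + s *\<^sub>R axis i 1) \<longlongrightarrow> x + 0 *\<^sub>R axis i 1) (at (0::real))"
    by (intro tendsto_intros)
  then have ev: "\<forall>\<^sub>F s in at (0::real). x + s *\<^sub>R axis i 1 \<in> U"
    using assms(1,2) by (auto dest: topological_tendstoD)
  show ?thesis
    using assms(4) unfolding has_partial_derivative_def has_field_derivative_def
    by (rule has_derivative_transform_eventually) (use ev assms(2,3) in \<open>auto elim!: eventually_mono\<close>)
qed

lemma space_derivatives_gradient:
  fixes f :: "real^'d::finite \<Rightarrow> real"
  assumes "space_derivatives k G f D" "open G" "1 \<le> k"
  shows "continuous_on (closure G) f"
    and "continuous_on (closure G) (D (mi_incr i mi_zero))"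
    and "x \<in> G \<Longrightarrow> has_partial_derivative f i (D (mi_incr i mi_zero) x) x"
proof -
  have o0: "mi_order (mi_zero :: 'd \<Rightarrow> nat) = 0" and o1: "mi_order (mi_incr i mi_zero) = 1" for i :: 'd
    by (simp_all add: mi_order_def mi_zero_def mi_incr_def sum.remove[of _ i])
  have eq: "D mi_zero x = f x" if "x \<in> closure G" for x
    using assms(1) that by (auto simp: space_derivatives_def)
  have "continuous_on (closure G) (D mi_zero)"
    using assms(1) o0 unfolding space_derivatives_def by (metis le0)
  then show "continuous_on (closure G) f"
    by (rule continuous_on_eq) (rule eq)
  show "continuous_on (closure G) (D (mi_incr i mi_zero))"
    using assms(1,3) o1 by (auto simp: space_derivatives_def)
  show "has_partial_derivative f i (D (mi_incr i mi_zero) x) x" if "x \<in> G"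
  proof (rule has_partial_derivative_cong[OF \<open>open G\<close> that])
    show "D mi_zero y = f y" if "y \<in> G" for y
      using eq that closure_subset by blast
    show "has_partial_derivative (D mi_zero) i (D (mi_incr i mi_zero) x) x"
      using assms(1,3) o1 that by (auto simp: space_derivatives_def)
  qed
qed

lemma holder_class_continuous_on:
  fixes f :: "real^'d::finite \<Rightarrow> real"
  assumes "holder_class k \<epsilon> G f"
  shows "continuous_on (closure G) f"
proof -
  obtain D where D: "space_derivatives k G f D"
    using assms by (auto simp: holder_class_def)
  have "continuous_on (closure G) (D mi_zero)"
  proof -
    have "mi_order (mi_zero :: 'd \<Rightarrow> nat) \<le> k"
      by (simp add: mi_order_def mi_zero_def)
    then show ?thesis
      using D unfolding space_derivatives_def by blast
  qed
  moreover have "D mi_zero x = f x" if "x \<in> closure G" for x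
    using D that by (auto simp: space_derivatives_def)
  ultimately show ?thesis
    by (rule continuous_on_eq)
qed

text \<open>Names the velocities in \<open>inward_unit_normal\<close>. The normal and the
  displacement to a closest point are both orthogonal to them, which is how the two get
  compared.\<close>

definition tangent_velocity :: "(real^'d::finite) set \<Rightarrow> real^'d \<Rightarrow> real^'d \<Rightarrow> bool"
  where "tangent_velocity G z w \<longleftrightarrow>
    (\<exists>\<gamma>. \<gamma> 0 = z \<and> (\<forall>\<^sub>F t in at (0::real). \<gamma> t \<in> frontier G) \<and> (\<gamma> has_vector_derivative w) (at 0))"

text \<open>A graph chart reduced to first-order data. The derivatives are continuous up to the
  closed ball, so compactness provides bounds and uniform continuity.\<close>

locale chart =
  fixes G :: "(real^'d::finite) set" and z0 r i s g g'
  assumes open_G: "open G" and r: "0 < r" and s: "s = 1 \<or> s = (-1::real)"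
    and g_shift: "\<And>y c. g (y + c *\<^sub>R axis i 1) = g y"
    and g_cont: "continuous_on (cball z0 r) g"
    and g_part: "\<And>l y. y \<in> ball z0 r \<Longrightarrow> has_partial_derivative g l (g' l y) y"
    and g'_cont: "\<And>l. continuous_on (cball z0 r) (g' l)"
    and G_ball: "G \<inter> ball z0 r = {y \<in> ball z0 r. 0 < s * (y $ i - g y)}"
begin

definition height :: "real^'d \<Rightarrow> real"
  where "height y = s * (y $ i - g y)"

text \<open>The gradient of \<open>y $ i - g y\<close>, since g does not vary in direction i. It is
  normal to the graph, up to length and sign.\<close>

definition conormal :: "real^'d \<Rightarrow> real^'d"
  where "conormal y = (\<chi> l. if l = i then 1 else - g' l y)"

lemma height_shift: "height (y + (s * c) *\<^sub>R axis i 1) = height y + c"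
proof -
  have "s * s = 1" using s by auto
  then have "s * (s * c) = c" by (simp add: mult.assoc[symmetric])
  moreover have "(y + (s * c) *\<^sub>R axis i 1) $ i = y $ i + s * c"
    by (simp add: axis_def)
  ultimately show ?thesis
    unfolding height_def g_shift by (simp add: algebra_simps)
qed

lemma mem_G_iff: "y \<in> ball z0 r \<Longrightarrow> y \<in> G \<longleftrightarrow> 0 < height y"
  using equalityD1[OF G_ball] equalityD2[OF G_ball] unfolding height_def by blast

lemma height_continuous: "continuous_on (ball z0 r) height"
  unfolding height_def
  by (intro continuous_intros continuous_on_subset[OF g_cont]) auto

lemma height_nonneg:
  assumes "y \<in> closure G" "y \<in> ball z0 r"
  shows "0 \<le> height y"
proof (rule ccontr)
  assume "\<not> 0 \<le> height y"
  define U where "U = {y \<in> ball z0 r. height y < 0}"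
  have "open U"
  proof -
    have "open (height -` {..<0} \<inter> ball z0 r)"
      using continuous_on_open_vimage[OF open_ball, THEN iffD1, OF height_continuous]
      by (rule allE[of _ "{..<0}"]) (simp only: open_lessThan simp_thms)
    moreover have "height -` {..<0} \<inter> ball z0 r = U"
      unfolding U_def by auto
    ultimately show ?thesis
      by metis
  qed
  moreover have "y \<in> U"
    using \<open>\<not> 0 \<le> height y\<close> assms by (auto simp: U_def)
  moreover have "U \<inter> G = {}"
    using mem_G_iff by (auto simp: U_def)
  ultimately show False
    using assms(1) open_Int_closure_eq_empty[of U G] by blast
qed

lemma frontier_iff:
  assumes "y \<in> ball z0 r"
  shows "y \<in> frontier G \<longleftrightarrow> height y = 0"
proof
  assume "y \<in> frontier G"
  then have "y \<in> closure G" "y \<notin> G"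
    using open_G by (auto simp: frontier_def interior_open)
  then show "height y = 0"
    using height_nonneg[OF _ assms] mem_G_iff[OF assms] by fastforce
next
  assume h0: "height y = 0"
  have "y \<in> closure G"
    unfolding closure_approachable
  proof (intro allI impI)
    fix e :: real assume "0 < e"
    \<comment> \<open>The shift along the axis has to stay below e and must not leave the ball,
      where positive height means membership in G.\<close>
    define e' where "e' = min (e / 2) ((r - dist z0 y) / 2)"
    have e': "0 < e'" "e' < e" "e' < r - dist z0 y"
      using assms \<open>0 < e\<close> by (auto simp: e'_def min_less_iff_disj)
    let ?y = "y + (s * e') *\<^sub>R axis i 1"
    have d: "dist ?y y = e'"
      using s e' by (auto simp: dist_norm)
    then have "?y \<in> ball z0 r"
      using e' dist_triangle[of z0 ?y y] by (auto simp: dist_commute)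
    then have "?y \<in> G"
      using height_shift[of y e'] h0 e' by (simp add: mem_G_iff)
    then show "\<exists>y'\<in>G. dist y' y < e"
      using d e'(2) by metis
  qed
  then show "y \<in> frontier G"
    using open_G mem_G_iff[OF assms] h0 by (auto simp: frontier_def interior_open)
qed

lemma g'_i: "y \<in> ball z0 r \<Longrightarrow> g' i y = 0"
proof -
  assume "y \<in> ball z0 r"
  then have "((\<lambda>t. g (y + t *\<^sub>R axis i 1)) has_real_derivative g' i y) (at 0)"
    using g_part by (auto simp: has_partial_derivative_def)
  then have "((\<lambda>t. g y) has_real_derivative g' i y) (at 0)"
    by (simp add: g_shift)
  then show ?thesis
    using DERIV_const DERIV_unique by blast
qed

text \<open>Follow the graph of g above the coordinate line in direction l: this curve has height 0,
  so it runs in the boundary while it is in the ball.\<close>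

lemma tangent_velocity_graph:
  assumes z: "z \<in> ball z0 r" "z \<in> frontier G" and "l \<noteq> i"
  shows "tangent_velocity G z (axis l 1 + g' l z *\<^sub>R axis i 1)"
proof -
  define \<gamma> where "\<gamma> t = z + t *\<^sub>R axis l 1 + (g (z + t *\<^sub>R axis l 1) - g z) *\<^sub>R axis i 1" for t
  have "((\<lambda>t. g (z + t *\<^sub>R axis l 1)) has_real_derivative g' l z) (at 0)"
    using g_part[OF z(1)] by (auto simp: has_partial_derivative_def)
  then have der: "(\<gamma> has_vector_derivative axis l 1 + g' l z *\<^sub>R axis i 1) (at 0)"
    unfolding \<gamma>_def by (auto intro!: derivative_eq_intros simp: has_real_derivative_iff_has_vector_derivative)
  then have "isCont \<gamma> 0"
    by (rule has_vector_derivative_continuous)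
  then have "(\<gamma> \<longlongrightarrow> z) (at 0)"
    by (simp add: isCont_def \<gamma>_def)
  then have "\<forall>\<^sub>F t in at 0. \<gamma> t \<in> ball z0 r"
    using z(1) by (intro topological_tendstoD) auto
  moreover have "height (\<gamma> t) = 0" for t
  proof -
    have "g z = z $ i"
      using frontier_iff z s by (auto simp: height_def)
    then show ?thesis
      using \<open>l \<noteq> i\<close> by (simp add: height_def \<gamma>_def g_shift) (simp add: axis_def)
  qed
  ultimately have "\<forall>\<^sub>F t in at 0. \<gamma> t \<in> frontier G"
    by (auto simp: frontier_iff elim!: eventually_mono)
  then show ?thesis
    unfolding tangent_velocity_def using der by (intro exI[of _ \<gamma>]) (auto simp: \<gamma>_def)
qed

text \<open>Orthogonality to the d - 1 graph velocities expresses every component of v through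
  \<open>v $ i\<close>, leaving a single direction.\<close>

lemma normal_parallel:
  assumes z: "z \<in> ball z0 r" "z \<in> frontier G"
    and v: "\<And>w. tangent_velocity G z w \<Longrightarrow> v \<bullet> w = 0"
  shows "v = (v $ i) *\<^sub>R conormal z"
proof -
  have "v $ l = - g' l z * v $ i" if "l \<noteq> i" for l
    using v[OF tangent_velocity_graph[OF z that]]
    by (simp add: inner_add_right inner_axis)
  then show ?thesis
    by (auto simp: vec_eq_iff conormal_def)
qed

lemma height_lipschitz:
  obtains \<Lambda> where "0 \<le> \<Lambda>" "\<And>x y. x \<in> ball z0 r \<Longrightarrow> y \<in> ball z0 r \<Longrightarrow> \<bar>height x - height y\<bar> \<le> \<Lambda> * dist x y"
proof -
  have "\<exists>B. \<forall>y\<in>cball z0 r. \<bar>g' l y\<bar> \<le> B" for l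
    using compact_imp_bounded[OF compact_continuous_image[OF g'_cont[of l] compact_cball]]
    unfolding bounded_iff by auto
  then obtain B where B: "\<And>l y. y \<in> cball z0 r \<Longrightarrow> \<bar>g' l y\<bar> \<le> B l"
    by metis
  define B' where "B' = Max (insert 0 (range B))"
  have B': "0 \<le> B'" "\<bar>g' l y\<bar> \<le> B'" if "y \<in> cball z0 r" for l y
  proof -
    have "B l \<le> B'"
      unfolding B'_def by (rule Max_ge) auto
    then show "\<bar>g' l y\<bar> \<le> B'"
      using B[OF that, of l] by linarith
  qed (simp add: B'_def)
  have B'0: "0 \<le> B'" by (simp add: B'_def)
  have "\<bar>g y - g x\<bar> \<le> CARD('d) * B' * dist x y" if "x \<in> ball z0 r" "y \<in> ball z0 r" for x y
  proof (rule mvt_open_segment_bound[OF open_ball])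
    have cs: "closed_segment x y \<subseteq> ball z0 r"
      using that by (intro closed_segment_subset convex_ball)
    then show "open_segment x y \<subseteq> ball z0 r"
      using segment_open_subset_closed by blast
    then show "\<bar>g' l z\<bar> \<le> B'" if "z \<in> open_segment x y" for l z
      using that B'(2) ball_subset_cball by blast
    show "continuous_on (closed_segment x y) g"
      using cs by (intro continuous_on_subset[OF g_cont]) auto
  qed (use g_part continuous_on_subset[OF g'_cont ball_subset_cball] B'0 in auto)
  then have "\<bar>height x - height y\<bar> \<le> (1 + CARD('d) * B') * dist x y" if "x \<in> ball z0 r" "y \<in> ball z0 r" for x y
  proof -
    have "\<bar>height x - height y\<bar> = \<bar>(x - y) $ i - (g x - g y)\<bar>"
      using s by (auto simp: height_def abs_if)
    moreover have "\<bar>(x - y) $ i\<bar> \<le> dist x y"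
      using component_le_norm_cart[of "x - y" i] by (simp add: dist_norm)
    ultimately show ?thesis
      using \<open>\<And>x y. x \<in> ball z0 r \<Longrightarrow> y \<in> ball z0 r \<Longrightarrow> \<bar>g y - g x\<bar> \<le> CARD('d) * B' * dist x y\<close>[OF that]
      by (simp add: algebra_simps)
  qed
  then show ?thesis
    using B'0 by (intro that[of "1 + CARD('d) * B'"]) auto
qed

end

section \<open>Normals, closest points and connecting paths\<close>

lemma graph_chart_chart:
  assumes c: "graph_chart k \<epsilon> G z0 r i s g" and "1 \<le> k" "open G"
  obtains g' where "chart G z0 r i s g g'"
proof -
  have r: "0 < r"
    using c by (simp add: graph_chart_def)
  obtain D where D: "space_derivatives k (ball z0 r) g D"
    using c by (auto simp: graph_chart_def holder_class_def)
  note D' = space_derivatives_gradient[OF D open_ball assms(2)]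
  show thesis
    using that[of "\<lambda>l. D (mi_incr l mi_zero)"] c D' r assms(3)
    by (auto simp: graph_chart_def chart_def)
qed

lemma holder_boundary_chart:
  assumes "holder_boundary k \<epsilon> G" "1 \<le> k" "open G" "z0 \<in> frontier G"
  obtains r i s g g' where "chart G z0 r i s g g'"
  using assms graph_chart_chart unfolding holder_boundary_def by metis

lemma tangent_velocity_orthogonal:
  assumes "inward_unit_normal G z v" "tangent_velocity G z w"
  shows "v \<bullet> w = 0"
  using assms unfolding inward_unit_normal_def tangent_velocity_def by blast

text \<open>Along every boundary curve through z the squared distance to y is minimal at z, so
  \<open>y - z\<close> is orthogonal to all tangent velocities. So is v, and both are multiples of
  one conormal. The sign of c stays open; it is settled in
  \<open>reflect_step_geometry\<close>.\<close>

lemma closest_point_parallel_normal: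
  assumes bd: "holder_boundary k \<epsilon> G" "1 \<le> k" "open G"
    and z: "z \<in> frontier G" and n: "inward_unit_normal G z v"
    and closest: "\<And>z'. z' \<in> frontier G \<Longrightarrow> dist y z \<le> dist y z'"
  obtains c where "y = z + c *\<^sub>R v" "\<bar>c\<bar> = dist y z"
proof -
  obtain r i s g g' where "chart G z r i s g g'"
    using holder_boundary_chart[OF bd z] .
  then interpret chart G z r i s g g' .
  have zb: "z \<in> ball z r"
    using r by simp
  have "(y - z) \<bullet> w = 0" if w: "tangent_velocity G z w" for w
  proof -
    obtain \<gamma> where \<gamma>: "\<gamma> 0 = z" "\<forall>\<^sub>F t in at (0::real). \<gamma> t \<in> frontier G" "(\<gamma> has_vector_derivative w) (at 0)"
      using w unfolding tangent_velocity_def by blast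
    define f where "f t = (y - \<gamma> t) \<bullet> (y - \<gamma> t)" for t
    have "(f has_derivative (\<lambda>t. (y - \<gamma> 0) \<bullet> (0 - t *\<^sub>R w) + (0 - t *\<^sub>R w) \<bullet> (y - \<gamma> 0))) (at 0)"
      unfolding f_def using \<gamma>(3) unfolding has_vector_derivative_def
      by (intro has_derivative_inner has_derivative_diff has_derivative_const) auto
    then have f': "(f has_real_derivative - 2 * ((y - z) \<bullet> w)) (at 0)"
      unfolding has_field_derivative_def \<gamma>(1)
      by (rule has_derivative_eq_rhs) (auto simp: fun_eq_iff inner_commute algebra_simps)
    have "\<forall>\<^sub>F t in at 0. f 0 \<le> f t"
      using \<gamma>(2) by eventually_elim
        (use closest \<gamma>(1) in \<open>auto simp: f_def dist_norm dot_square_norm intro!: power_mono\<close>)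
    then obtain e where e: "0 < e" "\<And>t. t \<noteq> 0 \<Longrightarrow> dist t 0 < e \<Longrightarrow> f 0 \<le> f t"
      unfolding eventually_at by blast
    have "f 0 \<le> f t" if "\<bar>0 - t\<bar> < e" for t
      using e(2)[of t] that by (cases "t = 0") auto
    then have "- 2 * ((y - z) \<bullet> w) = 0"
      by (intro DERIV_local_min[OF f' e(1)]) auto
    then show ?thesis by simp
  qed
  then have y: "y - z = ((y - z) $ i) *\<^sub>R conormal z"
    by (rule normal_parallel[OF zb z])
  have v: "v = (v $ i) *\<^sub>R conormal z"
    by (rule normal_parallel[OF zb z]) (rule tangent_velocity_orthogonal[OF n])
  have nv: "norm v = 1"
    using n by (simp add: inward_unit_normal_def)
  then have "v $ i \<noteq> 0"
    using v by (metis norm_zero scaleR_zero_left zero_neq_one)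
  define c where "c = (y - z) $ i / v $ i"
  have "y - z = c *\<^sub>R v"
  proof -
    have "c *\<^sub>R v = c *\<^sub>R ((v $ i) *\<^sub>R conormal z)"
      by (rule arg_cong[OF v])
    also have "\<dots> = ((y - z) $ i) *\<^sub>R conormal z"
      using \<open>v $ i \<noteq> 0\<close> by (simp add: c_def)
    finally show ?thesis
      using y by simp
  qed
  moreover from this have "dist y z = \<bar>c\<bar>"
    using nv by (simp add: dist_norm)
  ultimately show thesis
    by (intro that[of c]) (auto simp: algebra_simps)
qed

text \<open>A quantitative quasiconvexity. Open segments are used because x and y may lie on the
  boundary.\<close>

definition linked :: "real \<Rightarrow> (real^'d::finite) set \<Rightarrow> real^'d \<Rightarrow> real^'d \<Rightarrow> bool"
  where "linked k G x y \<longleftrightarrow> (\<exists>p\<in>closure G. \<exists>q\<in>closure G.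
    open_segment x p \<subseteq> G \<and> open_segment p q \<subseteq> G \<and> open_segment q y \<subseteq> G \<and>
    dist x p \<le> k * dist x y \<and> dist p q \<le> k * dist x y \<and> dist q y \<le> k * dist x y)"

lemma linked_mono: "linked k G x y \<Longrightarrow> k \<le> k' \<Longrightarrow> linked k' G x y"
  unfolding linked_def by (meson mult_right_mono order_trans zero_le_dist)

lemma linked_convex:
  assumes "convex U" "U \<subseteq> G" "x \<in> U" "y \<in> U"
  shows "linked 1 G x y"
proof -
  have "open_segment x y \<subseteq> G"
    using closed_segment_subset[OF assms(3,4,1)] segment_open_subset_closed[of x y] assms(2)
    by (meson order_trans)
  moreover have "x \<in> closure G"
    using assms(2,3) closure_subset by (meson subsetD)
  ultimately show ?thesis
    unfolding linked_def by (intro bexI[of _ x] conjI) simp_all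
qed

context chart
begin

text \<open>Raising both points by a multiple of their distance lifts the connecting segment above
  any dip that the Lipschitz height function can have over that distance.\<close>

lemma linked_local:
  obtains \<rho> k where "0 < \<rho>" "1 \<le> k"
    "\<And>x y. x \<in> closure G \<Longrightarrow> y \<in> closure G \<Longrightarrow> x \<in> ball z0 \<rho> \<Longrightarrow> dist x y < \<rho> \<Longrightarrow> linked k G x y"
proof -
  obtain \<Lambda> where \<Lambda>: "0 \<le> \<Lambda>"
    "\<And>x y. x \<in> ball z0 r \<Longrightarrow> y \<in> ball z0 r \<Longrightarrow> \<bar>height x - height y\<bar> \<le> \<Lambda> * dist x y"
    using height_lipschitz by blast
  \<comment> \<open>The height drops by at most \<open>\<Lambda> * D\<close> along a segment of
    length D; the additional 1 leaves a margin D.\<close>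
  define M where "M = \<Lambda> + 1"
  \<comment> \<open>Points of the path are within \<open>\<rho> + D + M * D\<close> of
    \<open>z0\<close>, with \<open>D < \<rho>\<close>; this choice keeps them in the ball of radius
    r.\<close>
  define \<rho> where "\<rho> = r / (2 * (M + 1))"
  have M: "1 \<le> M"
    using \<Lambda> by (simp add: M_def)
  have \<rho>: "0 < \<rho>" "2 * (M + 1) * \<rho> = r"
    using M r by (auto simp: \<rho>_def)
  have \<rho>_le: "\<rho> \<le> r / 2"
    using M r by (simp add: \<rho>_def field_simps)
  have "linked M G x y" if xy: "x \<in> closure G" "y \<in> closure G" "x \<in> ball z0 \<rho>" "dist x y < \<rho>" for x y
  proof (cases "x = y")
    case True
    then show ?thesis
      using xy(1) by (auto simp: linked_def)
  next
    case False
    define D where "D = dist x y"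
    have D: "0 < D" using False by (simp add: D_def)
    define up where "up c w = w + (s * c) *\<^sub>R axis i 1" for c and w :: "real^'d"
    have up_h: "height (up c w) = height w + c" for c w
      by (simp add: up_def height_shift)
    have up_d: "dist w (up c w) = c" if "0 \<le> c" for c w
      using s that by (auto simp: up_def dist_norm)
    have near: "up c w \<in> ball z0 r" if "dist x w \<le> D" "0 \<le> c" "c \<le> M * D" for c w
    proof -
      have "dist z0 (up c w) \<le> dist z0 x + dist x w + dist w (up c w)"
        by (meson add_right_mono dist_triangle order_trans)
      also have "\<dots> < \<rho> + D + M * D"
        using that xy up_d[of c w] by auto
      also have "\<dots> \<le> \<rho> + (1 + M) * \<rho>"
        using xy M by (simp add: D_def distrib_right add_mono mult_left_mono less_imp_le)
      also have "\<dots> \<le> r"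
      proof -
        have "\<rho> + (1 + M) * \<rho> = r - M * \<rho>"
          by (simp add: \<rho>(2)[symmetric] algebra_simps)
        moreover have "0 \<le> M * \<rho>"
          using \<rho>(1) M by simp
        ultimately show ?thesis by linarith
      qed
      finally show ?thesis by simp
    qed
    have up_G: "up c w \<in> G" if "w \<in> closure G" "dist x w \<le> D" "0 < c" "c \<le> M * D" for c w
    proof -
      have "w \<in> ball z0 r"
        using near[of w 0] that M D by (simp add: up_def)
      then have "0 \<le> height w"
        using height_nonneg that by blast
      then show ?thesis
        using that near[of w c] up_h[of c w] by (subst mem_G_iff) auto
    qed
    \<comment> \<open>The lower endpoint may have height 0, but every other point of the segment has
      been raised by a positive amount.\<close>
    have vert: "open_segment w (up (M * D) w) \<subseteq> G" if "w \<in> closure G" "dist x w \<le> D" for w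
    proof
      fix v assume "v \<in> open_segment w (up (M * D) w)"
      then obtain t where t: "0 < t" "t < 1" "v = (1 - t) *\<^sub>R w + t *\<^sub>R up (M * D) w"
        by (auto simp: in_segment)
      then have "v = up (t * (M * D)) w"
        by (simp add: up_def algebra_simps)
      then show "v \<in> G"
        using up_G[OF that, of "t * (M * D)"] t D M by (auto simp: mult_le_cancel_right1)
    qed
    have horiz: "open_segment (up (M * D) x) (up (M * D) y) \<subseteq> G"
    proof
      fix v assume "v \<in> open_segment (up (M * D) x) (up (M * D) y)"
      then obtain t where t: "0 < t" "t < 1" "v = (1 - t) *\<^sub>R up (M * D) x + t *\<^sub>R up (M * D) y"
        by (auto simp: in_segment)
      define w where "w = (1 - t) *\<^sub>R x + t *\<^sub>R y"
      have v: "v = up (M * D) w"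
        by (simp add: t(3) w_def up_def algebra_simps)
      have "x - w = t *\<^sub>R (x - y)"
        by (simp add: w_def algebra_simps)
      then have dw: "dist x w \<le> D"
        using t by (simp add: dist_norm D_def mult_left_le_one_le)
      have b: "x \<in> ball z0 r" "w \<in> ball z0 r"
        using near[of x 0] near[of w 0] dw M D by (simp_all add: up_def)
      have "0 \<le> height x"
        using height_nonneg b xy by blast
      moreover have "\<bar>height x - height w\<bar> \<le> \<Lambda> * D"
        using \<Lambda>(2)[OF b] mult_left_mono[OF dw \<Lambda>(1)] by linarith
      \<comment> \<open>The height of v is at least
        \<open>- \<Lambda> * D + M * D = D\<close>.\<close>
      ultimately have "0 < height v"
        using D unfolding v up_h by (simp add: M_def algebra_simps)
      moreover have "v \<in> ball z0 r"
        using near[OF dw, of "M * D"] M D by (simp add: v)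
      ultimately show "v \<in> G"
        by (simp add: mem_G_iff)
    qed
    have "open_segment (up (M * D) y) y \<subseteq> G"
      using vert[of y] xy by (simp add: open_segment_commute D_def)
    moreover have "dist (up (M * D) x) (up (M * D) y) \<le> M * D"
      using M D by (simp add: up_def D_def)
    moreover have "dist x (up (M * D) x) \<le> M * D" "dist (up (M * D) y) y \<le> M * D"
      using up_d M D by (simp_all add: dist_commute)
    moreover have "up (M * D) x \<in> closure G" "up (M * D) y \<in> closure G"
      using up_G[of x "M * D"] up_G[of y "M * D"] xy M D closure_subset by (auto simp: D_def)
    ultimately show ?thesis
      using vert[of x] horiz xy D unfolding linked_def D_def[symmetric]
      by (intro bexI[of _ "up (M * D) x"] bexI[of _ "up (M * D) y"]) auto
  qed
  then show thesis
    using that \<rho> M by blast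
qed

lemma gradient_uniformly_continuous:
  assumes "0 < e"
  obtains \<delta> where "0 < \<delta>"
    "\<And>l x y. x \<in> ball z0 r \<Longrightarrow> y \<in> ball z0 r \<Longrightarrow> dist x y < \<delta> \<Longrightarrow> \<bar>g' l x - g' l y\<bar> < e"
proof -
  have "\<exists>\<delta>>0. \<forall>x\<in>cball z0 r. \<forall>y\<in>cball z0 r. dist x y < \<delta> \<longrightarrow> \<bar>g' l x - g' l y\<bar> < e" for l
    using compact_uniformly_continuous[OF g'_cont[of l] compact_cball] assms
    unfolding uniformly_continuous_on_def by (metis dist_real_def)
  then obtain \<delta> where \<delta>: "\<And>l. \<delta> l > 0"
    "\<And>l x y. x \<in> cball z0 r \<Longrightarrow> y \<in> cball z0 r \<Longrightarrow> dist x y < \<delta> l \<Longrightarrow> \<bar>g' l x - g' l y\<bar> < e"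
    by metis
  show thesis
  proof (rule that[of "Min (range \<delta>)"])
    show "0 < Min (range \<delta>)"
      using \<delta> by simp
    fix l x y assume "x \<in> ball z0 r" "y \<in> ball z0 r" "dist x y < Min (range \<delta>)"
    moreover have "Min (range \<delta>) \<le> \<delta> l" by simp
    ultimately show "\<bar>g' l x - g' l y\<bar> < e"
      by (intro \<delta>(2)) auto
  qed
qed

text \<open>Along v the height is linear in t with slope
  \<open>s * (conormal z \<bullet> v)\<close>, up to the oscillation of the gradient. The slope has
  modulus \<open>norm (conormal z)\<close>, at least 1 because component i is 1. The bound 1 / (2 d)
  on each oscillation keeps the error below t / 2, so the slope decides the sign of the
  height.\<close>

lemma height_along_normal:
  assumes z: "z \<in> ball z0 r" "z \<in> frontier G" and v: "v = (v $ i) *\<^sub>R conormal z" "norm v = 1"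
    and t: "0 < t" and b: "z + t *\<^sub>R v \<in> ball z0 r"
    and osc: "\<And>l x. x \<in> ball z0 r \<Longrightarrow> dist x z \<le> t \<Longrightarrow> \<bar>g' l x - g' l z\<bar> < 1 / (2 * CARD('d))"
  shows "\<bar>height (z + t *\<^sub>R v) - t * (s * (conormal z \<bullet> v))\<bar> \<le> t / 2" "1 \<le> \<bar>s * (conormal z \<bullet> v)\<bar>"
proof -
  have ci: "conormal z $ i = 1"
    by (simp add: conormal_def)
  have "conormal z \<bullet> v = v $ i * (norm (conormal z))\<^sup>2"
    by (subst v(1)) (simp add: power2_norm_eq_inner)
  moreover have "\<bar>v $ i\<bar> * norm (conormal z) = 1"
    using v by (metis norm_scaleR real_norm_def)
  ultimately have "\<bar>conormal z \<bullet> v\<bar> = norm (conormal z)"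
    by (simp add: abs_mult power2_eq_square)
  also have "\<dots> \<ge> 1"
    using component_le_norm_cart[of "conormal z" i] ci by simp
  finally show "1 \<le> \<bar>s * (conormal z \<bullet> v)\<bar>"
    using s by (auto simp: abs_mult)
  have seg: "closed_segment z (z + t *\<^sub>R v) \<subseteq> ball z0 r"
    using z b by (intro closed_segment_subset convex_ball)
  have "z \<noteq> z + t *\<^sub>R v"
    using t v(2) by auto
  have seg': "open_segment z (z + t *\<^sub>R v) \<subseteq> ball z0 r"
    by (rule subset_trans[OF segment_open_subset_closed seg])
  have g_seg: "continuous_on (closed_segment z (z + t *\<^sub>R v)) g"
    by (rule continuous_on_subset[OF g_cont subset_trans[OF seg ball_subset_cball]])
  obtain \<xi> where \<xi>: "\<xi> \<in> open_segment z (z + t *\<^sub>R v)"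
    "g (z + t *\<^sub>R v) - g z = (\<Sum>l\<in>UNIV. g' l \<xi> * (z + t *\<^sub>R v - z) $ l)"
    using mvt_open_segment[OF open_ball seg' g_part continuous_on_subset[OF g'_cont ball_subset_cball]
        g_seg \<open>z \<noteq> _\<close>] by blast
  have "\<xi> \<in> ball z0 r" "dist \<xi> z \<le> t"
    using \<xi>(1) seg' dist_in_open_segment[OF \<xi>(1)] t v(2)
    by (blast, simp add: dist_norm norm_minus_commute)
  note osc = osc[OF this]
  have hz: "height z = 0"
    using z frontier_iff by blast
  have dv: "conormal z \<bullet> v = v $ i - (\<Sum>l\<in>UNIV. g' l z * v $ l)"
  proof -
    have "conormal z $ l * v $ l = (if l = i then v $ l else 0) - g' l z * v $ l" for l
      using g'_i[OF z(1)] by (auto simp: conormal_def)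
    then show ?thesis
      by (simp add: inner_vec_def sum_subtractf)
  qed
  have "height (z + t *\<^sub>R v) = height (z + t *\<^sub>R v) - height z"
    by (simp add: hz)
  also have "\<dots> = s * (t * v $ i - (g (z + t *\<^sub>R v) - g z))"
    unfolding height_def by (simp add: algebra_simps)
  also have "\<dots> = t * (s * (conormal z \<bullet> v)) - s * t * (\<Sum>l\<in>UNIV. (g' l \<xi> - g' l z) * v $ l)"
    unfolding \<xi>(2) dv by (simp add: algebra_simps sum_subtractf sum_distrib_left)
  finally have eq: "height (z + t *\<^sub>R v) - t * (s * (conormal z \<bullet> v))
      = - s * t * (\<Sum>l\<in>UNIV. (g' l \<xi> - g' l z) * v $ l)" by simp
  have "\<bar>\<Sum>l\<in>UNIV. (g' l \<xi> - g' l z) * v $ l\<bar> \<le> (\<Sum>l\<in>(UNIV::'d set). 1 / (2 * CARD('d)) * 1)"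
  proof (intro order_trans[OF sum_abs] sum_mono)
    fix l
    show "\<bar>(g' l \<xi> - g' l z) * v $ l\<bar> \<le> 1 / (2 * CARD('d)) * 1"
      unfolding abs_mult using osc[of l] component_le_norm_cart[of v l] v(2) by (intro mult_mono) auto
  qed
  also have "\<dots> = 1 / 2" by simp
  finally have "t * \<bar>\<Sum>l\<in>UNIV. (g' l \<xi> - g' l z) * v $ l\<bar> \<le> t * (1 / 2)"
    using t by (intro mult_left_mono) auto
  then show "\<bar>height (z + t *\<^sub>R v) - t * (s * (conormal z \<bullet> v))\<bar> \<le> t / 2"
    unfolding eq using s t by (auto simp: abs_mult)
qed

text \<open>\<open>inward_unit_normal\<close> guarantees interior points only for t below a
  threshold depending on z. One such point fixes the sign of the slope, and the linear estimate then
  extends the inclusion to all \<open>t < \<rho>\<close>, with \<rho> the same for all nearby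
  z.\<close>

lemma normal_interior_local:
  assumes n: "\<And>z. z \<in> frontier G \<Longrightarrow> inward_unit_normal G z (\<nu> z)"
  obtains \<rho> where "0 < \<rho>"
    "\<And>z t. z \<in> frontier G \<Longrightarrow> z \<in> ball z0 \<rho> \<Longrightarrow> 0 < t \<Longrightarrow> t < \<rho> \<Longrightarrow> z + t *\<^sub>R \<nu> z \<in> G"
proof -
  have "0 < 1 / (2 * real CARD('d))" by simp
  then obtain \<delta> where \<delta>: "0 < \<delta>" "\<And>l x y. x \<in> ball z0 r \<Longrightarrow> y \<in> ball z0 r \<Longrightarrow> dist x y < \<delta>
      \<Longrightarrow> \<bar>g' l x - g' l y\<bar> < 1 / (2 * real CARD('d))"
    using gradient_uniformly_continuous by blast
  define \<rho> where "\<rho> = min \<delta> (r / 2)"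
  have "z + t *\<^sub>R \<nu> z \<in> G" if z: "z \<in> frontier G" "z \<in> ball z0 \<rho>" and t: "0 < t" "t < \<rho>" for z t
  proof -
    have zb: "z \<in> ball z0 r"
      using z r by (auto simp: \<rho>_def)
    have v: "\<nu> z = (\<nu> z $ i) *\<^sub>R conormal z" "norm (\<nu> z) = 1"
      using normal_parallel[OF zb z(1)] tangent_velocity_orthogonal[OF n[OF z(1)]] n[OF z(1)]
      by (blast, simp add: inward_unit_normal_def)
    have b: "z + t *\<^sub>R \<nu> z \<in> ball z0 r" if "0 < t" "t < \<rho>" for t
    proof -
      have "dist z0 (z + t *\<^sub>R \<nu> z) \<le> dist z0 z + t"
        using dist_triangle[of z0 "z + t *\<^sub>R \<nu> z" z] that v by (simp add: dist_norm)
      then show ?thesis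
        using z that by (auto simp: \<rho>_def)
    qed
    have h: "\<bar>height (z + t *\<^sub>R \<nu> z) - t * (s * (conormal z \<bullet> \<nu> z))\<bar> \<le> t / 2"
      "1 \<le> \<bar>s * (conormal z \<bullet> \<nu> z)\<bar>" if "0 < t" "t < \<rho>" for t
      using \<delta>(2) zb that
      by (intro height_along_normal[OF zb z(1) v that(1) b[OF that]]; force simp: \<rho>_def)+
    have "\<forall>\<^sub>F t in at_right 0. z + t *\<^sub>R \<nu> z \<in> G \<and> 0 < t \<and> t < \<rho>"
    proof (intro eventually_conj)
      show "\<forall>\<^sub>F t in at_right 0. z + t *\<^sub>R \<nu> z \<in> G"
        using n[OF z(1)] by (simp add: inward_unit_normal_def)
      show "\<forall>\<^sub>F t in at_right 0. t < \<rho>"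
        using t eventually_at_right_field[of "\<lambda>t. t < \<rho>" 0] by force
    qed (simp add: eventually_at_right_less)
    \<comment> \<open>At t' a slope of at most -1 would force the height to be at most - t' / 2,
      contradicting membership in G.\<close>
    then obtain t' where t': "z + t' *\<^sub>R \<nu> z \<in> G" "0 < t'" "t' < \<rho>"
      using eventually_happens'[OF trivial_limit_at_right_real] by blast
    have "0 < s * (conormal z \<bullet> \<nu> z)"
    proof (rule ccontr)
      assume "\<not> ?thesis"
      with h(2)[OF t] have "s * (conormal z \<bullet> \<nu> z) \<le> - 1" by linarith
      then have "t' * (s * (conormal z \<bullet> \<nu> z)) \<le> t' * (- 1)"
        using t'(2) by (intro mult_left_mono) auto
      moreover have "0 < height (z + t' *\<^sub>R \<nu> z)"
        using mem_G_iff b[OF t'(2,3)] t'(1) by blast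
      ultimately show False
        using h(1)[OF t'(2,3)] t'(2) by linarith
    qed
    with h(2)[OF t] have "1 \<le> s * (conormal z \<bullet> \<nu> z)" by linarith
    then have "t * 1 \<le> t * (s * (conormal z \<bullet> \<nu> z))"
      using t(1) by (intro mult_left_mono) auto
    then have "0 < height (z + t *\<^sub>R \<nu> z)"
      using h(1)[OF t] t by linarith
    then show ?thesis
      using mem_G_iff b[OF t] by blast
  qed
  then show thesis
    using that[of \<rho>] \<delta> r by (simp add: \<rho>_def)
qed

end

text \<open>The number k serves both as stretch factor and as inverse radius. The combined property
  is monotone in k, as \<open>compact_uniform\<close> requires.\<close>

lemma linked_uniform:
  assumes "open G" "bounded G" "holder_boundary m \<epsilon> G" "1 \<le> m"
  obtains k where "1 \<le> k"
    "\<And>x y. x \<in> closure G \<Longrightarrow> y \<in> closure G \<Longrightarrow> dist x y < 1 / k \<Longrightarrow> linked k G x y"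
proof -
  define Q where "Q k x \<longleftrightarrow> 1 \<le> k \<and> (\<forall>y\<in>closure G. dist x y < 1 / k \<longrightarrow> linked k G x y)" for k :: real and x
  have mono: "Q k' x" if "k \<le> k'" "Q k x" for k k' x
  proof -
    have "1 / k' \<le> 1 / k"
      using that by (auto simp: Q_def intro!: divide_left_mono)
    then show ?thesis
      using that linked_mono[of k G x _ k'] unfolding Q_def by fastforce
  qed
  have "\<exists>\<rho>>0. \<exists>k. \<forall>x\<in>closure G \<inter> ball z \<rho>. Q k x" if z: "z \<in> closure G" for z
  proof -
    have "\<exists>\<rho> k. 0 < \<rho> \<and> 1 \<le> k \<and> (\<forall>x\<in>closure G. \<forall>y\<in>closure G. x \<in> ball z \<rho> \<longrightarrow> dist x y < \<rho> \<longrightarrow> linked k G x y)"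
    proof (cases "z \<in> G")
      case True
      then obtain e where e: "0 < e" "ball z e \<subseteq> G"
        using assms(1) open_contains_ball by blast
      have "linked 1 G x y" if "x \<in> ball z (e / 2)" "dist x y < e / 2" for x y
      proof (rule linked_convex[OF convex_ball e(2)])
        show "x \<in> ball z e" "y \<in> ball z e"
          using that dist_triangle[of z y x] e by auto
      qed
      then show ?thesis
        using e by (intro exI[of _ "e / 2"] exI[of _ 1]) auto
    next
      case False
      then have "z \<in> frontier G"
        using z assms(1) by (simp add: frontier_def interior_open)
      then obtain r i s g g' where "chart G z r i s g g'"
        using holder_boundary_chart[OF assms(3,4,1)] by blast
      then show ?thesis
        using chart.linked_local by metis
    qed
    then obtain \<rho> k where \<rho>k: "0 < \<rho>" "1 \<le> k"
      "\<And>x y. x \<in> closure G \<Longrightarrow> y \<in> closure G \<Longrightarrow> x \<in> ball z \<rho> \<Longrightarrow> dist x y < \<rho> \<Longrightarrow> linked k G x y"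
      by blast
    \<comment> \<open>Large enough that the radius 1 / K does not exceed the local radius
      \<rho>.\<close>
    define K where "K = max k (1 / \<rho>)"
    have K: "1 \<le> K" "k \<le> K" "1 / \<rho> \<le> K"
      using \<rho>k by (auto simp: K_def)
    then have "1 / K \<le> \<rho>"
      using \<rho>k(1) by (simp add: divide_le_eq mult.commute)
    note K = K(1,2) this
    have "Q K x" if "x \<in> closure G" "x \<in> ball z \<rho>" for x
      unfolding Q_def using \<rho>k(3)[OF that(1) _ that(2)] K linked_mono[OF _ K(2), of G x] by force
    then show ?thesis
      using \<rho>k(1) by blast
  qed
  note loc = this
  have comp: "compact (closure G)"
    using assms(2) by simp
  show thesis
  proof (rule compact_uniform[of "closure G" Q])
    fix k assume 12: "1 \<le> k" "\<And>x. x \<in> closure G \<Longrightarrow> Q k x"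
    then show thesis
      using 12 that unfolding Q_def by blast
  qed (use comp mono loc in blast)+
qed

lemma normal_interior_uniform:
  assumes G: "open G" "bounded G" "holder_boundary m \<epsilon> G" "1 \<le> m"
    and n: "\<And>z. z \<in> frontier G \<Longrightarrow> inward_unit_normal G z (\<nu> z)"
  obtains \<delta> where "0 < \<delta>" "\<And>z t. z \<in> frontier G \<Longrightarrow> 0 < t \<Longrightarrow> t < \<delta> \<Longrightarrow> z + t *\<^sub>R \<nu> z \<in> G"
proof -
  define Q where "Q k z \<longleftrightarrow> 1 \<le> k \<and> (\<forall>t. 0 < t \<and> t < 1 / k \<longrightarrow> z + t *\<^sub>R \<nu> z \<in> G)" for k :: real and z
  have mono: "Q k' x" if "k \<le> k'" "Q k x" for k k' x
  proof -
    have "1 / k' \<le> 1 / k"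
      using that by (auto simp: Q_def intro!: divide_left_mono)
    then show ?thesis
      using that unfolding Q_def by fastforce
  qed
  have "\<exists>\<rho>>0. \<exists>k. \<forall>x\<in>frontier G \<inter> ball z \<rho>. Q k x" if z: "z \<in> frontier G" for z
  proof -
    obtain r i s g g' where "chart G z r i s g g'"
      using holder_boundary_chart[OF G(3,4,1) z] by blast
    then obtain \<rho> where \<rho>: "0 < \<rho>"
      "\<And>x t. x \<in> frontier G \<Longrightarrow> x \<in> ball z \<rho> \<Longrightarrow> 0 < t \<Longrightarrow> t < \<rho> \<Longrightarrow> x + t *\<^sub>R \<nu> x \<in> G"
      using chart.normal_interior_local[OF _ n] by blast
    define K where "K = max 1 (1 / \<rho>)"
    have K: "1 \<le> K" "1 / \<rho> \<le> K"
      using \<rho> by (auto simp: K_def)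
    then have "1 / K \<le> \<rho>"
      using \<rho>(1) by (simp add: divide_le_eq mult.commute)
    note K = K(1) this
    have "Q K x" if "x \<in> frontier G" "x \<in> ball z \<rho>" for x
      unfolding Q_def using \<rho>(2)[OF that] K by force
    then show ?thesis
      using \<rho>(1) by blast
  qed
  note loc = this
  have comp: "compact (frontier G)"
    using assms(2) by (rule compact_frontier_bounded)
  show thesis
  proof (rule compact_uniform[of "frontier G" Q])
    fix k assume 12: "1 \<le> k" "\<And>x. x \<in> frontier G \<Longrightarrow> Q k x"
    then show thesis
      using 12 that[of "1 / k"] unfolding Q_def by auto
  qed (use comp mono loc in blast)+
qed

text \<open>The segment from x to y meets the frontier, so the projection is no farther from y than
  x is. Hence r is below the uniform length for which inward normals stay in G; this fixes the side
  on which y lies and puts the reflected point into G.\<close>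

lemma reflect_step_geometry:
  assumes G: "open G" "bounded G" "holder_boundary m \<epsilon> G" "1 \<le> m"
    and n: "\<And>z. z \<in> frontier G \<Longrightarrow> inward_unit_normal G z (\<nu> z)"
  obtains \<delta> where "0 < \<delta>"
    "\<And>x y p r. x \<in> closure G \<Longrightarrow> y \<notin> closure G \<Longrightarrow> dist x y < \<delta> \<Longrightarrow>
       p = closest_point (frontier G) y \<Longrightarrow> r = dist y p \<Longrightarrow>
       p \<in> frontier G \<and> norm (\<nu> p) = 1 \<and> r \<le> dist x y \<and> y = p - r *\<^sub>R \<nu> p \<and>
       reflect_step G \<nu> y = p + r *\<^sub>R \<nu> p \<and> p + r *\<^sub>R \<nu> p \<in> G"
proof -
  obtain \<delta> where \<delta>: "0 < \<delta>" "\<And>z t. z \<in> frontier G \<Longrightarrow> 0 < t \<Longrightarrow> t < \<delta> \<Longrightarrow> z + t *\<^sub>R \<nu> z \<in> G"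
    using normal_interior_uniform[OF G n] by blast
  show thesis
  proof (rule that[OF \<delta>(1)])
    fix x y p r
    assume x: "x \<in> closure G" and y: "y \<notin> closure G" and d: "dist x y < \<delta>"
      and p: "p = closest_point (frontier G) y" and r: "r = dist y p"
    have "connected (closed_segment x y)"
      by simp
    then have "closed_segment x y \<inter> frontier (closure G) \<noteq> {}"
      using x y by (intro connected_Int_frontier) auto
    moreover have "frontier (closure G) \<subseteq> frontier G"
      using interior_mono[OF closure_subset[of G]] by (auto simp: frontier_def)
    ultimately obtain q where q: "q \<in> closed_segment x y" "q \<in> frontier G"
      by blast
    then have ne: "frontier G \<noteq> {}" by blast
    have pf: "p \<in> frontier G"
      unfolding p by (rule closest_point_in_set[OF frontier_closed ne])
    have le: "dist y p \<le> dist y z" if "z \<in> frontier G" for z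
      unfolding p by (rule closest_point_le[OF frontier_closed that])
    have rle: "r \<le> dist x y"
      using le[OF q(2)] dist_in_closed_segment[OF q(1)] by (simp add: r dist_commute)
    have nv: "norm (\<nu> p) = 1"
      using n[OF pf] by (simp add: inward_unit_normal_def)
    obtain c where c: "y = p + c *\<^sub>R \<nu> p" "\<bar>c\<bar> = r"
      using closest_point_parallel_normal[OF G(3,4,1) pf n[OF pf] le] r by blast
    have "y \<noteq> p"
      using y pf by (auto simp: frontier_def)
    then have "0 < r" by (simp add: r)
    \<comment> \<open>With the positive sign y would lie on the inward normal at distance less than
      \<delta>, that is, in G.\<close>
    have "c \<noteq> r"
    proof
      assume "c = r"
      then have "y \<in> G"
        using \<delta>(2)[OF pf \<open>0 < r\<close>] rle d c by simp
      then show False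
        using y closure_subset by blast
    qed
    then have "c = - r"
      using c by linarith
    then have yp: "y = p - r *\<^sub>R \<nu> p"
      using c by simp
    have "reflect_step G \<nu> y = p + r *\<^sub>R \<nu> p"
    proof -
      have "reflect_step G \<nu> y = y + (2 * r) *\<^sub>R \<nu> p"
        using y by (simp add: reflect_step_def p r Let_def)
      also have "\<dots> = (p - r *\<^sub>R \<nu> p) + (2 * r) *\<^sub>R \<nu> p"
        by (rule arg_cong[where f = "\<lambda>v. v + (2 * r) *\<^sub>R \<nu> p", OF yp])
      also have "\<dots> = p + r *\<^sub>R \<nu> p"
        by (simp only: mult_2 scaleR_left_distrib) simp
      finally show ?thesis .
    qed
    moreover have "p + r *\<^sub>R \<nu> p \<in> G"
      using \<delta>(2)[OF pf \<open>0 < r\<close>] rle d by simp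
    ultimately show "p \<in> frontier G \<and> norm (\<nu> p) = 1 \<and> r \<le> dist x y \<and> y = p - r *\<^sub>R \<nu> p \<and>
       reflect_step G \<nu> y = p + r *\<^sub>R \<nu> p \<and> p + r *\<^sub>R \<nu> p \<in> G"
      using pf nv rle yp by blast
  qed
qed

text \<open>\<open>graph_point\<close> fixes boundary points near z, so there \<psi> agrees with a
  continuous function on a compact ball.\<close>

lemma holder_class_boundary_bounded:
  assumes "holder_class_boundary m \<epsilon> G \<psi>" "1 \<le> m" "open G" "bounded G"
  obtains B where "1 \<le> B" "\<And>z. z \<in> frontier G \<Longrightarrow> \<bar>\<psi> z\<bar> \<le> B"
proof -
  have "\<exists>\<rho>>0. \<exists>k. \<forall>y\<in>frontier G \<inter> ball z \<rho>. \<bar>\<psi> y\<bar> \<le> k" if z: "z \<in> frontier G" for z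
  proof -
    obtain r i s g r' where c: "graph_chart m \<epsilon> G z r i s g" "0 < r'" "r' \<le> r"
      and \<psi>: "holder_class m \<epsilon> (ball z r') (\<lambda>y. \<psi> (graph_point i g y))"
      using assms(1) z unfolding holder_class_boundary_def by blast
    obtain g' where "chart G z r i s g g'"
      using graph_chart_chart[OF c(1) assms(2,3)] .
    then interpret chart G z r i s g g' .
    have "continuous_on (cball z r') (\<lambda>y. \<psi> (graph_point i g y))"
      using holder_class_continuous_on[OF \<psi>] c(2) by simp
    from compact_imp_bounded[OF compact_continuous_image[OF this compact_cball]]
    obtain B where B: "\<forall>y\<in>cball z r'. \<bar>\<psi> (graph_point i g y)\<bar> \<le> B"
      unfolding bounded_iff by auto
    have "\<bar>\<psi> y\<bar> \<le> B" if y: "y \<in> frontier G" "y \<in> ball z r'" for y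
    proof -
      have "height y = 0"
        using frontier_iff[of y] y c(3) by simp
      then have "g y = y $ i"
        using s by (auto simp: height_def)
      then have "graph_point i g y = y"
        by (simp add: graph_point_def vec_eq_iff)
      then show ?thesis
        using bspec[OF B, of y] y(2) by simp
    qed
    then show ?thesis
      using c(2) by blast
  qed
  note loc = this
  show thesis
  proof (rule compact_uniform[of "frontier G" "\<lambda>k z. \<bar>\<psi> z\<bar> \<le> k"])
    show "compact (frontier G)"
      using assms(4) by (rule compact_frontier_bounded)
  qed (use loc that in force)+
qed

section \<open>Taylor expansion on the closure\<close>

text \<open>The whole path stays within \<open>3 * k * dist x y\<close> of x, so the gradient has to
  be controlled only at such points of G. This is the origin of all factors 3 k below.\<close>

lemma linked_increment:
  fixes f :: "real^'d::finite \<Rightarrow> real" and B :: real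
  assumes G: "open G" and l: "linked k G x y" and xy: "x \<in> closure G" "y \<in> closure G" and k: "1 \<le> k"
    and cont_f: "continuous_on (closure G) f"
    and part: "\<And>i z. z \<in> G \<Longrightarrow> has_partial_derivative f i (f' i z) z"
    and cont: "\<And>i. continuous_on G (f' i)"
    and B: "\<And>i z. z \<in> G \<Longrightarrow> dist x z \<le> 3 * k * dist x y \<Longrightarrow> \<bar>f' i z\<bar> \<le> B" "0 \<le> B"
  shows "\<bar>f y - f x\<bar> \<le> CARD('d) * B * (3 * k * dist x y)"
proof -
  define D where "D = k * dist x y"
  obtain p q where pq: "p \<in> closure G" "q \<in> closure G" "open_segment x p \<subseteq> G"
    "open_segment p q \<subseteq> G" "open_segment q y \<subseteq> G" "dist x p \<le> D" "dist p q \<le> D" "dist q y \<le> D"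
    using l unfolding linked_def D_def by blast
  have D0: "0 \<le> D"
    using k by (simp add: D_def)
  have seg: "\<bar>f v - f u\<bar> \<le> CARD('d) * B * D"
    if "u \<in> closure G" "v \<in> closure G" "open_segment u v \<subseteq> G" "dist x u \<le> 2 * D" "dist u v \<le> D" for u v
  proof -
    have "\<bar>f v - f u\<bar> \<le> CARD('d) * B * dist u v"
    proof (rule mvt_open_segment_bound[OF G that(3) part cont _ _ B(2)])
      have "closed_segment u v \<subseteq> closure G"
        using that(1-3) closure_subset[of G] by (auto simp: closed_segment_eq_open)
      then show "continuous_on (closed_segment u v) f"
        by (rule continuous_on_subset[OF cont_f])
      show "\<bar>f' i z\<bar> \<le> B" if z: "z \<in> open_segment u v" for i z
      proof (rule B(1))
        show "z \<in> G"
          using z \<open>open_segment u v \<subseteq> G\<close> by blast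
        have "dist z u \<le> dist u v"
          using dist_in_open_segment[OF z] by (simp add: dist_commute)
        then show "dist x z \<le> 3 * k * dist x y"
          using dist_triangle[of x z u] \<open>dist x u \<le> 2 * D\<close> \<open>dist u v \<le> D\<close>
          by (simp add: D_def dist_commute)
      qed
    qed auto
    also have "\<dots> \<le> CARD('d) * B * D"
      using that B(2) by (intro mult_left_mono) auto
    finally show ?thesis .
  qed
  have "\<bar>f p - f x\<bar> \<le> CARD('d) * B * D"
    using pq xy D0 by (intro seg) auto
  moreover have "\<bar>f q - f p\<bar> \<le> CARD('d) * B * D"
    using pq D0 by (intro seg) auto
  moreover have "\<bar>f y - f q\<bar> \<le> CARD('d) * B * D"
    using pq xy dist_triangle[of x q p] by (intro seg) auto
  moreover have "CARD('d) * B * (3 * k * dist x y) = 3 * (CARD('d) * B * D)"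
    by (simp add: D_def)
  ultimately show ?thesis by linarith
qed

section \<open>Partial derivatives of the Taylor polynomials\<close>

lemma has_partial_derivative_diff:
  assumes "has_partial_derivative f i c x" "has_partial_derivative g i c' x"
  shows "has_partial_derivative (\<lambda>y. f y - g y) i (c - c') x"
  using assms unfolding has_partial_derivative_def by (rule DERIV_diff)

lemma has_partial_derivative_const: "has_partial_derivative (\<lambda>y. c) i 0 x"
  unfolding has_partial_derivative_def by simp

lemma has_partial_derivative_diff_const:
  "has_partial_derivative f i c x \<Longrightarrow> has_partial_derivative (\<lambda>y. f y - a) i c x"
  using has_partial_derivative_diff[OF _ has_partial_derivative_const] by fastforce

lemma has_partial_derivative_lin: "has_partial_derivative (\<lambda>y. lin a (y - x)) l (a l) z"
  unfolding has_partial_derivative_def by (auto simp: lin_simps intro!: derivative_eq_intros)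

lemma has_partial_derivative_quad:
  assumes "\<And>i j. H i j = H j i"
  shows "has_partial_derivative (\<lambda>y. quad H (y - x) (y - x) / 2) l (lin (H l) (z - x)) z"
proof -
  \<comment> \<open>The form is an explicit polynomial in s; its partial derivative is the
    coefficient of s.\<close>
  have eq: "quad H (z + s *\<^sub>R axis l 1 - x) (z + s *\<^sub>R axis l 1 - x) / 2
      = quad H (z - x) (z - x) / 2 + s * lin (H l) (z - x) + s^2 * H l l / 2" for s
  proof -
    have c: "quad H (z - x) (axis l 1) = lin (H l) (z - x)"
      by (subst quad_commute) (simp_all only: assms quad_simps(5))
    have "z + s *\<^sub>R axis l 1 - x = (z - x) + s *\<^sub>R axis l 1" by simp
    then show ?thesis
      by (simp only: quad_simps(1,3,5,6,8) c lin_axis) (simp add: field_simps power2_eq_square)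
  qed
  show ?thesis
    unfolding has_partial_derivative_def eq by (auto intro!: derivative_eq_intros)
qed

lemma has_partial_derivative_tri:
  assumes "\<And>i j k. T i j k = T j i k" "\<And>i j k. T i j k = T i k j"
  shows "has_partial_derivative (\<lambda>y. tri T (y - x) (y - x) (y - x) / 6) l (quad (T l) (z - x) (z - x) / 2) z"
proof -
  let ?e = "axis l 1 :: real^'a"
  note c = tri_commute[of T, OF assms]
  have eq: "tri T (z + s *\<^sub>R ?e - x) (z + s *\<^sub>R ?e - x) (z + s *\<^sub>R ?e - x) / 6
      = tri T (z - x) (z - x) (z - x) / 6 + s * (quad (T l) (z - x) (z - x) / 2)
        + s^2 * (quad (T l) ?e (z - x) / 2) + s^3 * (quad (T l) ?e ?e / 6)" for s
  proof -
    let ?v = "z - x"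
    have "tri T ?v ?e ?v = tri T ?e ?v ?v" "tri T ?v ?v ?e = tri T ?e ?v ?v"
      "tri T ?v ?e ?e = tri T ?e ?e ?v" "tri T ?e ?v ?e = tri T ?e ?e ?v"
      using c by metis+
    moreover have "z + s *\<^sub>R ?e - x = ?v + s *\<^sub>R ?e" by simp
    ultimately show ?thesis
      by (simp only: tri_simps(1,3,6,8,10,12)) (simp add: tri_simps(5) field_simps power2_eq_square power3_eq_cube)
  qed
  show ?thesis
    unfolding has_partial_derivative_def eq by (auto intro!: derivative_eq_intros)
qed

text \<open>A time slice of the solution with one bound for all derivatives. Order 4 is used for u
  and order 2 for its time derivative, matching the parabolic count 2 i + |j| \<le> 4.\<close>

definition smooth_jet ::
    "nat \<Rightarrow> (real^'d::finite) set \<Rightarrow> real \<Rightarrow> (('d \<Rightarrow> nat) \<Rightarrow> real^'d \<Rightarrow> real) \<Rightarrow> bool"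
  where "smooth_jet n G B D \<longleftrightarrow>
    (\<forall>j. mi_order j \<le> n \<longrightarrow> continuous_on (closure G) (D j) \<and> (\<forall>x\<in>closure G. \<bar>D j x\<bar> \<le> B)) \<and>
    (\<forall>l j. mi_order (mi_incr l j) \<le> n \<longrightarrow>
      (\<forall>x\<in>G. has_partial_derivative (D j) l (D (mi_incr l j) x) x))"

lemma mi_order_incr [simp]: "mi_order (mi_incr i j) = Suc (mi_order j)"
  by (simp add: mi_order_def mi_incr_def sum.remove[of UNIV i])

lemma mi_order_zero [simp]: "mi_order (mi_zero :: 'd::finite \<Rightarrow> nat) = 0"
  by (simp add: mi_order_def mi_zero_def)

lemma mi_incr_commute: "mi_incr i (mi_incr l j) = mi_incr l (mi_incr i j)"
  by (auto simp: mi_incr_def fun_eq_iff)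

locale quasiconvex =
  fixes G :: "(real^'d::finite) set" and k :: real
  assumes open_G: "open G" and k: "1 \<le> k"
    and linked: "\<And>x y. x \<in> closure G \<Longrightarrow> y \<in> closure G \<Longrightarrow> dist x y < 1 / k \<Longrightarrow> linked k G x y"
begin

text \<open>The dimension comes from summing over the partial derivatives; (3 k)^4 dominates the
  powers (3 k)^(m+1) for all m \<le> 3.\<close>

definition taylor_const :: real
  where "taylor_const = CARD('d) * (3 * k) ^ 4"

lemma taylor_const_pos: "0 < taylor_const"
  using k by (simp add: taylor_const_def)

text \<open>The induction step of Taylor's theorem: integrating a gradient of order m along the
  connecting path gains one order. The path can stray 3 k times as far as y, so the admissible
  radius shrinks by that factor.\<close>

lemma remainder_step:
  fixes f :: "real^'d \<Rightarrow> real" and A \<eta> :: real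
  assumes x: "x \<in> closure G" and y: "y \<in> closure G" and fx: "f x = 0"
    and cont_f: "continuous_on (closure G) f"
    and part: "\<And>i z. z \<in> G \<Longrightarrow> has_partial_derivative f i (f' i z) z"
    and cont: "\<And>i. continuous_on G (f' i)"
    and A: "0 \<le> A" "\<And>i z. z \<in> G \<Longrightarrow> dist x z < \<eta> \<Longrightarrow> \<bar>f' i z\<bar> \<le> A * dist x z ^ m"
    and m: "m \<le> 3" and \<eta>: "\<eta> \<le> 1" and d: "dist x y < \<eta> / (3 * k)"
  shows "\<bar>f y\<bar> \<le> taylor_const * A * dist x y ^ Suc m"
proof -
  define D where "D = 3 * k * dist x y"
  have D: "0 \<le> D" "D < \<eta>"
    using k d by (auto simp: D_def field_simps)
  have "dist x y < 1 / k"
  proof -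
    have "\<eta> / (3 * k) \<le> 1 / k"
      using k \<eta> by (simp add: field_simps)
    then show ?thesis using d by linarith
  qed
  then have "\<bar>f y - f x\<bar> \<le> CARD('d) * (A * D ^ m) * (3 * k * dist x y)"
  proof (intro linked_increment[OF open_G linked[OF x y] x y k cont_f part cont])
    show "\<bar>f' i z\<bar> \<le> A * D ^ m" if "z \<in> G" "dist x z \<le> 3 * k * dist x y" for i z
    proof -
      have "\<bar>f' i z\<bar> \<le> A * dist x z ^ m"
        using that D by (intro A) (auto simp: D_def)
      also have "\<dots> \<le> A * D ^ m"
        using that A(1) by (intro mult_left_mono power_mono) (auto simp: D_def)
      finally show ?thesis .
    qed
    show "0 \<le> A * D ^ m"
      using A D by simp
  qed auto
  also have "\<dots> = CARD('d) * (3 * k) ^ Suc m * (A * dist x y ^ Suc m)"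
    by (simp add: D_def power_mult_distrib)
  also have "\<dots> \<le> taylor_const * (A * dist x y ^ Suc m)"
  proof -
    have "(3 * k) ^ Suc m \<le> (3 * k) ^ 4"
      using k m by (intro power_increasing) auto
    then show ?thesis
      unfolding taylor_const_def using A(1) by (intro mult_right_mono mult_left_mono) auto
  qed
  finally show ?thesis
    using fx by (simp add: mult.assoc)
qed

definition taylor_radius :: "nat \<Rightarrow> real"
  where "taylor_radius m = 1 / (3 * k) ^ m"

lemma taylor_radius_props: "taylor_radius m \<le> 1" "taylor_radius (Suc m) = taylor_radius m / (3 * k)"
  using k one_le_power[of "3 * k" m] by (auto simp: taylor_radius_def)

context
  fixes n :: nat and B :: real and D :: "('d \<Rightarrow> nat) \<Rightarrow> real^'d \<Rightarrow> real" and x :: "real^'d"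
  assumes jet: "smooth_jet n G B D" and x: "x \<in> closure G"
begin

lemma jet_bound_nonneg: "0 \<le> B"
proof -
  have "\<bar>D mi_zero x\<bar> \<le> B"
    using jet x unfolding smooth_jet_def by (metis mi_order_zero le0)
  then show ?thesis by linarith
qed

lemma jet_cont: "mi_order j \<le> n \<Longrightarrow> continuous_on (closure G) (D j)"
  and jet_cont': "mi_order j \<le> n \<Longrightarrow> continuous_on G (D j)"
  and jet_bound: "mi_order j \<le> n \<Longrightarrow> y \<in> closure G \<Longrightarrow> \<bar>D j y\<bar> \<le> B"
  and jet_part: "Suc (mi_order j) \<le> n \<Longrightarrow> y \<in> G \<Longrightarrow> has_partial_derivative (D j) l (D (mi_incr l j) y) y"
  using jet continuous_on_subset[OF _ closure_subset, of G] unfolding smooth_jet_def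
  by (blast, blast, blast, simp)

lemma lin_cont: "continuous_on S (\<lambda>y. lin a (y - x))"
  unfolding lin_def by (intro continuous_intros)

lemma quad_cont: "continuous_on S (\<lambda>y. quad H (y - x) (y - x))"
  unfolding quad_def lin_def by (intro continuous_intros)

lemma tri_cont: "continuous_on S (\<lambda>y. tri T (y - x) (y - x) (y - x))"
  unfolding tri_def quad_def lin_def by (intro continuous_intros)

lemma taylor0:
  assumes "Suc (mi_order j) \<le> n" "y \<in> closure G" "dist x y < taylor_radius 1"
  shows "\<bar>D j y - D j x\<bar> \<le> taylor_const * B * dist x y"
proof -
  have "\<bar>D j y - D j x\<bar> \<le> taylor_const * B * dist x y ^ Suc 0"
  proof (rule remainder_step[where f = "\<lambda>y. D j y - D j x" and \<eta> = 1, OF x assms(2)])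
    show "has_partial_derivative (\<lambda>y. D j y - D j x) l (D (mi_incr l j) z) z" if "z \<in> G" for l z
      using has_partial_derivative_diff[OF jet_part[OF assms(1) that] has_partial_derivative_const] by simp
    show "\<bar>D (mi_incr l j) z\<bar> \<le> B * dist x z ^ 0" if "z \<in> G" for l z
      using jet_bound[of "mi_incr l j" z] assms(1) that closure_subset[of G] by auto
  qed (use assms taylor_radius_props[of 0] in \<open>auto intro!: continuous_intros jet_cont jet_cont' jet_bound_nonneg simp: taylor_radius_def\<close>)
  then show ?thesis by simp
qed

text \<open>A partial derivative of a remainder is the remainder, one degree lower, of the next
  derivative. The same recursion gives \<open>taylor2\<close> and \<open>taylor3\<close>.\<close>

lemma taylor1:
  assumes "mi_order j + 2 \<le> n" "y \<in> closure G" "dist x y < taylor_radius 2"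
  shows "\<bar>D j y - D j x - lin (\<lambda>l. D (mi_incr l j) x) (y - x)\<bar> \<le> taylor_const^2 * B * dist x y ^ 2"
proof -
  have "\<bar>D j y - D j x - lin (\<lambda>l. D (mi_incr l j) x) (y - x)\<bar>
      \<le> taylor_const * (taylor_const * B) * dist x y ^ Suc 1"
  proof (rule remainder_step[where f = "\<lambda>y. D j y - D j x - lin (\<lambda>l. D (mi_incr l j) x) (y - x)"
        and f' = "\<lambda>l z. D (mi_incr l j) z - D (mi_incr l j) x" and \<eta> = "taylor_radius 1", OF x assms(2)])
    show "has_partial_derivative (\<lambda>y. D j y - D j x - lin (\<lambda>l. D (mi_incr l j) x) (y - x)) l
        (D (mi_incr l j) z - D (mi_incr l j) x) z" if "z \<in> G" for l z
      using has_partial_derivative_diff[OF has_partial_derivative_diff[OF jet_part[of j z l] has_partial_derivative_const]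
          has_partial_derivative_lin] assms(1) that by simp
    show "\<bar>D (mi_incr l j) z - D (mi_incr l j) x\<bar> \<le> taylor_const * B * dist x z ^ 1"
      if "z \<in> G" "dist x z < taylor_radius 1" for l z
      using taylor0[of "mi_incr l j" z] assms(1) that closure_subset[of G] by auto
    show "dist x y < taylor_radius 1 / (3 * k)"
      using assms(3) taylor_radius_props(2)[of 1] by (simp add: numeral_2_eq_2)
    show "0 \<le> taylor_const * B"
      using taylor_const_pos jet_bound_nonneg by simp
  qed (use assms taylor_radius_props(1) in \<open>auto intro!: continuous_intros lin_cont jet_cont jet_cont' simp: lin_def\<close>)
  then show ?thesis by (simp add: power2_eq_square mult_ac)
qed

lemma taylor2:
  assumes "mi_order j + 3 \<le> n" "y \<in> closure G" "dist x y < taylor_radius 3"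
  shows "\<bar>D j y - D j x - lin (\<lambda>l. D (mi_incr l j) x) (y - x)
      - quad (\<lambda>l m. D (mi_incr m (mi_incr l j)) x) (y - x) (y - x) / 2\<bar> \<le> taylor_const^3 * B * dist x y ^ 3"
    (is "\<bar>?f y\<bar> \<le> _")
proof -
  have "\<bar>?f y\<bar> \<le> taylor_const * (taylor_const^2 * B) * dist x y ^ Suc 2"
  proof (rule remainder_step[where f = ?f
        and f' = "\<lambda>l z. D (mi_incr l j) z - D (mi_incr l j) x - lin (\<lambda>m. D (mi_incr m (mi_incr l j)) x) (z - x)"
        and \<eta> = "taylor_radius 2", OF x assms(2)])
    \<comment> \<open>Symmetry of the second derivatives is built into multi-indices: the order of
      increments does not matter.\<close>
    have q: "has_partial_derivative (\<lambda>y. quad (\<lambda>l m. D (mi_incr m (mi_incr l j)) x) (y - x) (y - x) / 2) l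
        (lin (\<lambda>m. D (mi_incr m (mi_incr l j)) x) (z - x)) z" for l z
      by (rule has_partial_derivative_quad) (simp only: mi_incr_commute)
    show "has_partial_derivative ?f l (D (mi_incr l j) z - D (mi_incr l j) x
        - lin (\<lambda>m. D (mi_incr m (mi_incr l j)) x) (z - x)) z" if "z \<in> G" for l z
      by (rule has_partial_derivative_diff[OF has_partial_derivative_diff[OF
              has_partial_derivative_diff_const[OF jet_part] has_partial_derivative_lin] q])
        (use assms(1) that in auto)
    show "\<bar>D (mi_incr l j) z - D (mi_incr l j) x - lin (\<lambda>m. D (mi_incr m (mi_incr l j)) x) (z - x)\<bar>
        \<le> taylor_const^2 * B * dist x z ^ 2" if "z \<in> G" "dist x z < taylor_radius 2" for l z
      using taylor1[of "mi_incr l j" z] assms(1) that closure_subset[of G] by auto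
    show "dist x y < taylor_radius 2 / (3 * k)"
      using assms(3) taylor_radius_props(2)[of 2] by (simp add: numeral_3_eq_3 numeral_2_eq_2)
    show "0 \<le> taylor_const^2 * B"
      using taylor_const_pos jet_bound_nonneg by simp
  qed (use assms taylor_radius_props(1) in \<open>auto intro!: continuous_intros lin_cont quad_cont jet_cont jet_cont' simp: lin_def quad_def\<close>)
  then show ?thesis by (simp add: power2_eq_square power3_eq_cube mult_ac)
qed

lemma taylor3:
  assumes "mi_order j + 4 \<le> n" "y \<in> closure G" "dist x y < taylor_radius 4"
  shows "\<bar>D j y - D j x - lin (\<lambda>l. D (mi_incr l j) x) (y - x)
      - quad (\<lambda>l m. D (mi_incr m (mi_incr l j)) x) (y - x) (y - x) / 2
      - tri (\<lambda>l m p. D (mi_incr p (mi_incr m (mi_incr l j))) x) (y - x) (y - x) (y - x) / 6\<bar>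
    \<le> taylor_const^4 * B * dist x y ^ 4"
    (is "\<bar>?f y\<bar> \<le> _")
proof -
  let ?f' = "\<lambda>l z. D (mi_incr l j) z - D (mi_incr l j) x - lin (\<lambda>m. D (mi_incr m (mi_incr l j)) x) (z - x)
    - quad (\<lambda>m p. D (mi_incr p (mi_incr m (mi_incr l j))) x) (z - x) (z - x) / 2"
  have "\<bar>?f y\<bar> \<le> taylor_const * (taylor_const^3 * B) * dist x y ^ Suc 3"
  proof (rule remainder_step[where f = ?f and f' = ?f' and \<eta> = "taylor_radius 3", OF x assms(2)])
    have q: "has_partial_derivative (\<lambda>y. quad (\<lambda>l m. D (mi_incr m (mi_incr l j)) x) (y - x) (y - x) / 2) l
        (lin (\<lambda>m. D (mi_incr m (mi_incr l j)) x) (z - x)) z" for l z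
      by (rule has_partial_derivative_quad) (simp only: mi_incr_commute)
    have t: "has_partial_derivative (\<lambda>y. tri (\<lambda>l m p. D (mi_incr p (mi_incr m (mi_incr l j))) x) (y - x) (y - x) (y - x) / 6) l
        (quad (\<lambda>m p. D (mi_incr p (mi_incr m (mi_incr l j))) x) (z - x) (z - x) / 2) z" for l z
      by (rule has_partial_derivative_tri) (metis mi_incr_commute)+
    show "has_partial_derivative ?f l (?f' l z) z" if "z \<in> G" for l z
      by (rule has_partial_derivative_diff[OF has_partial_derivative_diff[OF has_partial_derivative_diff[OF
              has_partial_derivative_diff_const[OF jet_part] has_partial_derivative_lin] q] t])
        (use assms(1) that in auto)
    show "\<bar>?f' l z\<bar> \<le> taylor_const^3 * B * dist x z ^ 3" if "z \<in> G" "dist x z < taylor_radius 3" for l z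
      using taylor2[of "mi_incr l j" z] assms(1) that closure_subset[of G] by auto
    show "dist x y < taylor_radius 3 / (3 * k)"
      using assms(3) taylor_radius_props(2)[of 3] by (simp add: eval_nat_numeral)
    show "0 \<le> taylor_const^3 * B"
      using taylor_const_pos jet_bound_nonneg by simp
  qed (use assms taylor_radius_props(1) in \<open>auto intro!: continuous_intros lin_cont quad_cont tri_cont jet_cont jet_cont' simp: lin_def quad_def tri_def\<close>)
  then show ?thesis by (simp add: eval_nat_numeral mult_ac)
qed

end
end

section \<open>One step of the chain\<close>

text \<open>The weight absorbs the division by \<alpha>: \<psi> / \<alpha> gives the summands of
  Z_1, 1 / \<alpha> those of Z_2, and the weight 1 gives the quantity 2 r of the error
  terms.\<close>

definition exit_cost :: "(real^'d::finite) set \<Rightarrow> (real^'d \<Rightarrow> real) \<Rightarrow> real^'d \<Rightarrow> real"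
  where "exit_cost G \<phi> y = (if y \<in> closure G then 0
    else 2 * dist y (closest_point (frontier G) y) * \<phi> (closest_point (frontier G) y))"

lemma exit_cost_one_nonneg: "0 \<le> exit_cost G (\<lambda>_. 1) y"
  by (simp add: exit_cost_def)

lemma boundary_sum_eq:
  "boundary_sum G \<nu> b \<sigma> \<phi> h x e n = (\<Sum>k<n. exit_cost G
      (\<lambda>z. \<phi> z / conormal_coeff \<nu> (diffusion_matrix \<sigma>) z)
      (trial_step b \<sigma> h (reflected_walk G \<nu> b \<sigma> h x e k) (e (Suc k))))"
  unfolding boundary_sum_def exit_cost_def Let_def
  by (intro sum.cong) (auto simp: indicator_def)

locale reflecting_domain = quasiconvex G k for G :: "(real^'d::finite) set" and k +
  fixes \<nu> :: "real^'d \<Rightarrow> real^'d" and \<delta> :: real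
  assumes \<delta>: "0 < \<delta>"
    and reflect: "\<And>x y p r. x \<in> closure G \<Longrightarrow> y \<notin> closure G \<Longrightarrow> dist x y < \<delta> \<Longrightarrow>
       p = closest_point (frontier G) y \<Longrightarrow> r = dist y p \<Longrightarrow>
       p \<in> frontier G \<and> norm (\<nu> p) = 1 \<and> r \<le> dist x y \<and> y = p - r *\<^sub>R \<nu> p \<and>
       reflect_step G \<nu> y = p + r *\<^sub>R \<nu> p \<and> p + r *\<^sub>R \<nu> p \<in> G"
begin

lemma reflect_step_in_closure:
  assumes "x \<in> closure G" "dist x y < \<delta>"
  shows "reflect_step G \<nu> y \<in> closure G"
proof (cases "y \<in> closure G")
  case True
  then show ?thesis by (simp add: reflect_step_def)
next
  case False
  then have "reflect_step G \<nu> y \<in> G"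
    using reflect[OF assms(1) False assms(2) refl refl] by metis
  then show ?thesis
    using closure_subset by blast
qed

text \<open>The first three summands multiply h^2: expansion in time, in space, and of the time
  derivative. The other three multiply h r and come from the reflection.\<close>

definition step_const :: "real \<Rightarrow> real \<Rightarrow> real"
  where "step_const B K = B + taylor_const^4 * B * (3 * K)^4 + taylor_const^2 * B * (3 * K)^2
    + 8 * real CARD('d) * (taylor_const^3 * B) * K^3 + real CARD('d)^3 * B * K^2 + real CARD('d) * B"

text \<open>Expansion of u(t + h, x + v), with U0 = u and U1 = u_t at time t. Since h counts like
  |v|^2, everything omitted has order |v|^4, h |v|^2 or h^2. As a polynomial it is available outside
  the closure as well.\<close>

definition taylor_poly ::
    "real \<Rightarrow> (('d \<Rightarrow> nat) \<Rightarrow> real^'d \<Rightarrow> real) \<Rightarrow> (('d \<Rightarrow> nat) \<Rightarrow> real^'d \<Rightarrow> real) \<Rightarrow> real^'d \<Rightarrow> real^'d \<Rightarrow> real"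
  where "taylor_poly h U0 U1 x v = U0 mi_zero x + lin (\<lambda>i. U0 (mi_incr i mi_zero) x) v
    + quad (\<lambda>i j. U0 (mi_incr j (mi_incr i mi_zero)) x) v v / 2
    + tri (\<lambda>i j l. U0 (mi_incr l (mi_incr j (mi_incr i mi_zero))) x) v v v / 6
    + h * (U1 mi_zero x + lin (\<lambda>i. U1 (mi_incr i mi_zero) x) v)"

text \<open>Here \<open>u'\<close> is the solution at the end of the step. A trial point within K
  sqrt h of x has its projection within 2 K sqrt h and its reflection within 3 K sqrt h, hence the
  factor 3.\<close>

context
  fixes B K h :: real and U0 U1 :: "('d \<Rightarrow> nat) \<Rightarrow> real^'d \<Rightarrow> real" and u' \<phi> :: "real^'d \<Rightarrow> real"
    and x :: "real^'d"
  assumes jet0: "smooth_jet 4 G B U0" and jet1: "smooth_jet 2 G B U1"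
    and time: "\<And>y. y \<in> closure G \<Longrightarrow> \<bar>u' y - U0 mi_zero y - h * U1 mi_zero y\<bar> \<le> B * h^2"
    and neumann: "\<And>z. z \<in> frontier G \<Longrightarrow> lin (\<lambda>i. U0 (mi_incr i mi_zero) z) (\<nu> z) = \<phi> z"
    and x: "x \<in> closure G" and K: "1 \<le> K" and h: "0 < h" "h \<le> 1"
    and small: "3 * K * sqrt h < \<delta>" "3 * K * sqrt h < 1 / (3 * k) ^ 4"
begin

lemmas B_nonneg = jet_bound_nonneg[OF jet0 x]

lemma taylor_radius_mono: "m \<le> 4 \<Longrightarrow> 3 * K * sqrt h < 1 / (3 * k) ^ m"
proof -
  assume "m \<le> 4"
  then have "1 / (3 * k) ^ 4 \<le> 1 / (3 * k) ^ m"
    using k by (intro divide_left_mono power_increasing) auto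
  then show ?thesis
    using small by linarith
qed

lemma taylor_poly_approx:
  assumes y: "y \<in> closure G" and d: "dist x y \<le> 3 * K * sqrt h"
  shows "\<bar>u' y - taylor_poly h U0 U1 x (y - x)\<bar>
    \<le> (B + taylor_const^4 * B * (3 * K)^4 + taylor_const^2 * B * (3 * K)^2) * h^2"
proof -
  have r4: "dist x y < taylor_radius 4" and r2: "dist x y < taylor_radius 2"
    using d taylor_radius_mono[of 4] taylor_radius_mono[of 2] by (simp_all add: taylor_radius_def)
  have sq: "sqrt h ^ 2 = h"
    using h by simp
  have sq4: "sqrt h ^ 4 = h^2"
    using power_mult[of "sqrt h" 2 2] sq by simp
  have d4: "dist x y ^ 4 \<le> (3 * K)^4 * h^2"
    using power_mono[OF d, of 4] by (simp add: power_mult_distrib sq4)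
  have d2: "dist x y ^ 2 \<le> (3 * K)^2 * h"
    using power_mono[OF d, of 2] sq by (simp add: power_mult_distrib)
  let ?R0 = "U0 mi_zero y - U0 mi_zero x - lin (\<lambda>i. U0 (mi_incr i mi_zero) x) (y - x)
    - quad (\<lambda>i j. U0 (mi_incr j (mi_incr i mi_zero)) x) (y - x) (y - x) / 2
    - tri (\<lambda>i j l. U0 (mi_incr l (mi_incr j (mi_incr i mi_zero))) x) (y - x) (y - x) (y - x) / 6"
  let ?R1 = "U1 mi_zero y - U1 mi_zero x - lin (\<lambda>i. U1 (mi_incr i mi_zero) x) (y - x)"
  have "\<bar>?R0\<bar> \<le> taylor_const^4 * B * dist x y ^ 4"
    by (rule taylor3[OF jet0 x _ y r4]) simp
  also have "\<dots> \<le> taylor_const^4 * B * ((3 * K)^4 * h^2)"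
    using B_nonneg taylor_const_pos by (intro mult_left_mono d4) auto
  finally have R0: "\<bar>?R0\<bar> \<le> taylor_const^4 * B * (3 * K)^4 * h^2" by simp
  have "\<bar>?R1\<bar> \<le> taylor_const^2 * B * dist x y ^ 2"
    by (rule taylor1[OF jet1 x _ y r2]) simp
  also have "\<dots> \<le> taylor_const^2 * B * ((3 * K)^2 * h)"
    using B_nonneg taylor_const_pos by (intro mult_left_mono d2) auto
  finally have "h * \<bar>?R1\<bar> \<le> h * (taylor_const^2 * B * ((3 * K)^2 * h))"
    using h by (intro mult_left_mono) auto
  then have R1: "\<bar>h * ?R1\<bar> \<le> taylor_const^2 * B * (3 * K)^2 * h^2"
    using h by (simp add: abs_mult power2_eq_square mult_ac)
  have "u' y - taylor_poly h U0 U1 x (y - x) = (u' y - U0 mi_zero y - h * U1 mi_zero y) + ?R0 + h * ?R1"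
    unfolding taylor_poly_def by (simp add: algebra_simps)
  then have "\<bar>u' y - taylor_poly h U0 U1 x (y - x)\<bar> \<le> B * h^2 + taylor_const^4 * B * (3 * K)^4 * h^2
      + taylor_const^2 * B * (3 * K)^2 * h^2"
    using time[OF y] R0 R1 by linarith
  then show ?thesis
    by (simp only: distrib_right)
qed

text \<open>For an exit the Taylor polynomial is compared with \<open>u'\<close> only at the
  reflected point. Its jump from the trial point is, by \<open>cubic_midpoint\<close>, twice an
  approximate gradient at p applied to w, plus a cubic term O(h r). The Neumann condition evaluates
  the true gradient there.\<close>

lemma step_estimate:
  assumes d: "dist x y \<le> K * sqrt h"
  shows "\<bar>u' (reflect_step G \<nu> y) - exit_cost G \<phi> y - taylor_poly h U0 U1 x (y - x)\<bar>
    \<le> step_const B K * (h^2 + h * exit_cost G (\<lambda>_. 1) y)"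
proof -
  let ?c1 = "B + taylor_const^4 * B * (3 * K)^4 + taylor_const^2 * B * (3 * K)^2"
  let ?d = "real CARD('d)"
  let ?c2 = "8 * ?d * (taylor_const^3 * B) * K^3 + ?d^3 * B * K^2 + ?d * B"
  have c: "step_const B K = ?c1 + ?c2" "0 \<le> ?c1" "0 \<le> ?c2"
    using B_nonneg taylor_const_pos K by (simp_all add: step_const_def)
  have K0: "0 \<le> K * sqrt h"
    using K h by simp
  show ?thesis
  proof (cases "y \<in> closure G")
    case True
    have "\<bar>u' y - taylor_poly h U0 U1 x (y - x)\<bar> \<le> ?c1 * h^2"
      using d K0 by (intro taylor_poly_approx True) simp
    also have "\<dots> \<le> step_const B K * h^2"
      using c by (intro mult_right_mono) auto
    finally show ?thesis
      using True by (simp add: reflect_step_def exit_cost_def)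
  next
    case False
    define p where "p = closest_point (frontier G) y"
    define r where "r = dist y p"
    have "dist x y < \<delta>"
      using d K0 small by linarith
    note R = reflect[OF x False this p_def r_def]
    have pf: "p \<in> frontier G" and nv: "norm (\<nu> p) = 1" and rd: "r \<le> dist x y"
      and yp: "y = p - r *\<^sub>R \<nu> p" and Ry: "reflect_step G \<nu> y = p + r *\<^sub>R \<nu> p"
      and RyG: "p + r *\<^sub>R \<nu> p \<in> G"
      using R by blast+
    define v where "v = p - x"
    define w where "w = r *\<^sub>R \<nu> p"
    have r0: "0 \<le> r" by (simp add: r_def)
    have rK: "r \<le> K * sqrt h"
      using rd d by linarith
    have nw: "norm w = r"
      using nv r0 by (simp add: w_def)
    have nv2: "norm v \<le> 2 * (K * sqrt h)"
    proof -
      have "norm v = dist x p"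
        by (simp add: v_def dist_norm norm_minus_commute)
      also have "\<dots> \<le> dist x y + r"
        unfolding r_def by (rule dist_triangle)
      finally show ?thesis
        using d rK by linarith
    qed
    have yx: "y - x = v - w" and Rx: "reflect_step G \<nu> y - x = v + w"
      unfolding Ry by (simp_all add: v_def w_def) (metis add_diff_eq diff_add_eq diff_diff_eq2 yp)
    have "dist x (reflect_step G \<nu> y) = norm (v + w)"
      using Rx by (metis dist_commute dist_norm)
    also have "\<dots> \<le> 3 * K * sqrt h"
      using norm_triangle_ineq[of v w] nv2 nw rK by linarith
    finally have A: "\<bar>u' (reflect_step G \<nu> y) - taylor_poly h U0 U1 x (v + w)\<bar> \<le> ?c1 * h^2"
      using taylor_poly_approx[of "reflect_step G \<nu> y"] RyG closure_subset unfolding Rx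
      by (metis Ry subsetD)
    let ?g = "\<lambda>i. U0 (mi_incr i mi_zero) x"
    let ?H = "\<lambda>i j. U0 (mi_incr j (mi_incr i mi_zero)) x"
    let ?T = "\<lambda>i j l. U0 (mi_incr l (mi_incr j (mi_incr i mi_zero))) x"
    \<comment> \<open>The second-order Taylor polynomial at x of the i-th partial derivative,
      evaluated at p. It is exactly what the midpoint identity produces.\<close>
    let ?P1 = "\<lambda>i. ?g i + lin (?H i) v + quad (?T i) v v / 2"
    have B': "taylor_poly h U0 U1 x (v + w) - taylor_poly h U0 U1 x (v - w)
      = 2 * lin ?P1 w + tri ?T w w w / 3 + 2 * h * lin (\<lambda>i. U1 (mi_incr i mi_zero) x) w"
    proof -
      have "taylor_poly h U0 U1 x (v + w) - taylor_poly h U0 U1 x (v - w)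
          = 2 * lin ?P1 w + tri ?T w w w / 3
            + (h * (U1 mi_zero x + lin (\<lambda>i. U1 (mi_incr i mi_zero) x) (v + w))
              - h * (U1 mi_zero x + lin (\<lambda>i. U1 (mi_incr i mi_zero) x) (v - w)))"
        unfolding taylor_poly_def
        by (subst cubic_midpoint[symmetric, where c = "U0 mi_zero x"]) (simp_all add: mi_incr_commute)
      then show ?thesis
        by (simp add: lin_simps algebra_simps)
    qed
    have rd2: "dist x p < taylor_radius 3"
      using nv2 K0 taylor_radius_mono[of 3] by (simp add: taylor_radius_def v_def dist_norm norm_minus_commute)
    have P1: "\<bar>U0 (mi_incr i mi_zero) p - ?P1 i\<bar> \<le> taylor_const^3 * B * (8 * K^3 * h)" for i
    proof -
      have pc: "p \<in> closure G"
        using pf by (simp add: frontier_def)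
      have "\<bar>U0 (mi_incr i mi_zero) p - ?P1 i\<bar> \<le> taylor_const^3 * B * dist x p ^ 3"
        using taylor2[OF jet0 x _ pc rd2, of "mi_incr i mi_zero"] by (simp add: v_def algebra_simps)
      also have "\<dots> \<le> taylor_const^3 * B * (8 * K^3 * h)"
      proof (intro mult_left_mono)
        have "dist x p ^ 3 \<le> (2 * (K * sqrt h)) ^ 3"
          using nv2 by (intro power_mono) (simp_all add: v_def dist_norm norm_minus_commute)
        also have "\<dots> = 8 * K^3 * (h * sqrt h)"
          using h by (simp add: power_mult_distrib power3_eq_cube)
        \<comment> \<open>The order h^(3/2) is weakened to h: after multiplication by r the error is
          h r, as for the cubic term.\<close>
        also have "\<dots> \<le> 8 * K^3 * (h * 1)"
          using h K by (intro mult_left_mono) auto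
        finally show "dist x p ^ 3 \<le> 8 * K^3 * h" by simp
      qed (use B_nonneg taylor_const_pos in auto)
      finally show ?thesis .
    qed
    have lin_p: "lin (\<lambda>i. U0 (mi_incr i mi_zero) p) w = r * \<phi> p"
      using neumann[OF pf] by (simp add: w_def lin_scaleR)
    have e1: "\<bar>r * \<phi> p - lin ?P1 w\<bar> \<le> ?d * (taylor_const^3 * B * (8 * K^3 * h)) * r"
      using lin_bound[of "\<lambda>i. U0 (mi_incr i mi_zero) p - ?P1 i", OF P1, of w]
      unfolding lin_fun_diff[of "\<lambda>i. U0 (mi_incr i mi_zero) p"] lin_p nw .
    have e2: "\<bar>tri ?T w w w\<bar> \<le> ?d^3 * B * K^2 * h * r"
    proof -
      have "\<bar>tri ?T w w w\<bar> \<le> ?d^3 * B * norm w * norm w * norm w"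
        using jet0 x by (intro tri_bound) (simp add: smooth_jet_def)
      also have "\<dots> = ?d^3 * B * r * r^2"
        by (simp add: nw power2_eq_square)
      also have "\<dots> \<le> ?d^3 * B * r * (K * sqrt h)^2"
        using rK r0 B_nonneg by (intro mult_left_mono power_mono) auto
      finally show ?thesis
        using h by (simp add: power_mult_distrib mult_ac)
    qed
    have e3: "\<bar>h * lin (\<lambda>i. U1 (mi_incr i mi_zero) x) w\<bar> \<le> h * (?d * B * r)"
      unfolding abs_mult using h jet1 x lin_bound[of "\<lambda>i. U1 (mi_incr i mi_zero) x" B w] nw
      by (intro mult_mono) (auto simp: smooth_jet_def)
    have sum_bound: "\<bar>e\<bar> \<le> M + 2 * E1 + E2 + 2 * E3"
      if "e = X - 2 * Y + Z / 3 + 2 * W" "\<bar>X\<bar> \<le> M" "\<bar>Y\<bar> \<le> E1" "\<bar>Z\<bar> \<le> E2" "\<bar>W\<bar> \<le> E3"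
      for e X Y Z W M E1 E2 E3 :: real
      using that by linarith
    have ec: "exit_cost G \<phi> y = 2 * (r * \<phi> p)" "exit_cost G (\<lambda>_. 1) y = 2 * r"
      using False by (simp_all add: exit_cost_def p_def r_def)
    have "\<bar>u' (reflect_step G \<nu> y) - exit_cost G \<phi> y - taylor_poly h U0 U1 x (y - x)\<bar>
      \<le> ?c1 * h^2 + 2 * (?d * (taylor_const^3 * B * (8 * K^3 * h)) * r) + (?d^3 * B * K^2 * h * r) + 2 * (h * (?d * B * r))"
    proof -
      have "u' (reflect_step G \<nu> y) - exit_cost G \<phi> y - taylor_poly h U0 U1 x (y - x)
        = (u' (reflect_step G \<nu> y) - taylor_poly h U0 U1 x (v + w)) - 2 * (r * \<phi> p - lin ?P1 w)
          + tri ?T w w w / 3 + 2 * (h * lin (\<lambda>i. U1 (mi_incr i mi_zero) x) w)"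
        using B' unfolding ec yx by (simp add: algebra_simps)
      from this A e1 e2 e3 show ?thesis
        by (rule sum_bound)
    qed
    also have "\<dots> \<le> ?c1 * h^2 + ?c2 * (h * (2 * r))"
    proof -
      have "0 \<le> ?d^3 * B * K^2 * h * r"
        using B_nonneg h r0 by simp
      then show ?thesis
        by (simp add: algebra_simps)
    qed
    also have "\<dots> \<le> step_const B K * h^2 + step_const B K * (h * (2 * r))"
      using c h r0 by (intro add_mono mult_right_mono) auto
    finally show ?thesis
      unfolding ec by (simp only: distrib_left)
  qed
qed

end

end

section \<open>The chain\<close>

text \<open>The expectation of a function of the first n noise vectors. Paths start at index 1, as
  the noise does.\<close>

definition walk_mean :: "nat \<Rightarrow> ((nat \<Rightarrow> real^'d::finite) \<Rightarrow> real) \<Rightarrow> real"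
  where "walk_mean n F = (\<Sum>w\<in>PiE {1..n} (\<lambda>_. sign_vectors). F w)
    / real (card (sign_vectors :: (real^'d) set)) ^ n"

lemma finite_sign_paths [simp]: "finite (PiE {1..n::nat} (\<lambda>_. sign_vectors :: (real^'d::finite) set))"
  by (intro finite_PiE) auto

lemma card_sign_paths:
  "card (PiE {1..n::nat} (\<lambda>_. sign_vectors :: (real^'d::finite) set)) = card (sign_vectors :: (real^'d) set) ^ n"
  by (simp add: card_PiE)

lemma walk_mean_add: "walk_mean n (\<lambda>w. F w + H w) = walk_mean n F + walk_mean n H"
  by (simp add: walk_mean_def sum.distrib add_divide_distrib)

lemma walk_mean_diff: "walk_mean n (\<lambda>w. F w - H w) = walk_mean n F - walk_mean n H"
  by (simp add: walk_mean_def sum_subtractf diff_divide_distrib)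

lemma walk_mean_cmult: "walk_mean n (\<lambda>w. c * F w) = c * walk_mean n F"
  by (simp add: walk_mean_def sum_distrib_left)

lemma walk_mean_const: "walk_mean n (\<lambda>w::nat \<Rightarrow> real^'d::finite. c) = c"
  unfolding walk_mean_def sum_constant card_sign_paths card_sign_vectors by simp

lemma walk_mean_mono:
  assumes "\<And>w. w \<in> PiE {1..n} (\<lambda>_. sign_vectors) \<Longrightarrow> F w \<le> H w"
  shows "walk_mean n F \<le> walk_mean n H"
  unfolding walk_mean_def by (intro divide_right_mono sum_mono assms) auto

lemma walk_mean_abs: "\<bar>walk_mean n F\<bar> \<le> walk_mean n (\<lambda>w. \<bar>F w\<bar>)"
  unfolding walk_mean_def by (simp add: divide_right_mono sum_abs)

text \<open>The tower property: average over the last noise vector with the first n fixed.\<close>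

lemma walk_mean_Suc:
  "walk_mean (Suc n) F = walk_mean n (\<lambda>w. sign_mean (\<lambda>v. F (w(Suc n := v))))"
proof -
  let ?S = "sign_vectors :: (real^'a) set"
  let ?P = "PiE {1..n} (\<lambda>_. ?S)"
  have ins: "{1..Suc n} = insert (Suc n) {1..n}"
    by auto
  have "(\<Sum>w\<in>PiE {1..Suc n} (\<lambda>_. ?S). F w) = (\<Sum>(v, w)\<in>?S \<times> ?P. F (w(Suc n := v)))"
    unfolding ins PiE_insert_eq
    by (subst sum.reindex) (auto intro!: inj_combinator sum.cong simp: o_def)
  also have "\<dots> = (\<Sum>w\<in>?P. \<Sum>v\<in>?S. F (w(Suc n := v)))"
    by (subst sum.cartesian_product[symmetric]) (rule sum.swap)
  finally show ?thesis
    by (simp add: walk_mean_def sign_mean_def sum_divide_distrib mult.commute)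
qed

text \<open>By independence all sign paths are equally likely. As F sees only the first n noise
  vectors, it is a finite combination of indicators of the path events.\<close>

lemma expectation_random_signs:
  fixes \<xi> :: "nat \<Rightarrow> 'd::finite \<Rightarrow> 'p \<Rightarrow> real" and F :: "(nat \<Rightarrow> real^'d) \<Rightarrow> real"
  assumes signs: "random_signs P \<xi>"
    and dep: "\<And>e e'. (\<And>k. k \<in> {1..n} \<Longrightarrow> e k = e' k) \<Longrightarrow> F e = F e'"
  shows "prob_space.expectation P (\<lambda>\<omega>. F (\<lambda>k. \<chi> i. \<xi> k i \<omega>)) = walk_mean n F"
proof -
  interpret prob_space P
    using signs by (simp add: random_signs_def)
  let ?S = "sign_vectors :: (real^'d) set"
  let ?P = "PiE {1..n} (\<lambda>_. ?S)"
  define E where "E \<omega> k = (\<chi> i. \<xi> k i \<omega>)" for \<omega> k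
  define A where "A w = {\<omega> \<in> space P. \<forall>k\<in>{1..n}. E \<omega> k = w k}" for w
  have indep: "indep_vars (\<lambda>_. borel) (\<lambda>(k, i). \<xi> k i) ({1..} \<times> UNIV)"
    using signs by (simp add: random_signs_def)
  have val: "\<xi> k i \<omega> = 1 \<or> \<xi> k i \<omega> = -1" if "1 \<le> k" "\<omega> \<in> space P" for k i \<omega>
    using signs that by (simp add: random_signs_def)
  have half: "prob {\<omega> \<in> space P. \<xi> k i \<omega> = c} = 1 / 2" if "1 \<le> k" "c = 1 \<or> c = -1" for k i c
    using signs that by (auto simp: random_signs_def)
  have meas: "\<xi> k i \<in> borel_measurable P" if "1 \<le> k" for k i
    using indep that unfolding indep_vars_def2 by auto
  have A_sets: "A w \<in> sets P" for w
  proof -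
    have "A w = {\<omega> \<in> space P. \<forall>k\<in>{1..n}. \<forall>i\<in>UNIV. \<xi> k i \<omega> = w k $ i}"
      by (auto simp: A_def E_def vec_eq_iff)
    also have "\<dots> \<in> sets P"
      using meas by (intro sets.sets_Collect_finite_All borel_measurable_eq) auto
    finally show ?thesis .
  qed
  have prob_A: "prob (A w) = 1 / real (card ?S) ^ n" if w: "w \<in> ?P" for w
  \<comment> \<open>The product rule for independent variables is applied to a nonempty index set,
    so the empty path is separate.\<close>
  proof (cases "n = 0")
    case True
    then show ?thesis
      by (simp add: A_def prob_space)
  next
    case False
    let ?J = "{1..n} \<times> (UNIV :: 'd set)"
    have "A w = (\<Inter>(k, i)\<in>?J. \<xi> k i -` {w k $ i} \<inter> space P)"
    proof (rule set_eqI)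
      fix \<omega>
      have "\<omega> \<in> space P" if "\<omega> \<in> (\<Inter>(k, i)\<in>?J. \<xi> k i -` {w k $ i} \<inter> space P)"
        using INT_D[OF that, of "(1, undefined)"] False by auto
      then show "\<omega> \<in> A w \<longleftrightarrow> \<omega> \<in> (\<Inter>(k, i)\<in>?J. \<xi> k i -` {w k $ i} \<inter> space P)"
        by (auto simp: A_def E_def vec_eq_iff)
    qed
    also have "\<dots> = (\<Inter>j\<in>?J. (case j of (k, i) \<Rightarrow> \<xi> k i) -` (case j of (k, i) \<Rightarrow> {w k $ i}) \<inter> space P)"
      by (intro INF_cong) auto
    finally have A_eq: "A w = \<dots>" .
    have "prob (A w) = (\<Prod>j\<in>?J. prob ((case j of (k, i) \<Rightarrow> \<xi> k i) -` (case j of (k, i) \<Rightarrow> {w k $ i}) \<inter> space P))"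
      unfolding A_eq by (rule indep_varsD[OF indep]) (use False in auto)
    also have "\<dots> = (\<Prod>j\<in>?J. 1 / 2)"
    proof (intro prod.cong refl)
      fix j assume "j \<in> ?J"
      then obtain k i where j: "j = (k, i)" "k \<in> {1..n}" by auto
      then have "w k $ i = 1 \<or> w k $ i = -1"
        using w by (auto simp: PiE_iff sign_vectors_def)
      then have "prob {\<omega> \<in> space P. \<xi> k i \<omega> = w k $ i} = 1 / 2"
        using j by (intro half) auto
      moreover have "\<xi> k i -` {w k $ i} \<inter> space P = {\<omega> \<in> space P. \<xi> k i \<omega> = w k $ i}"
        by auto
      ultimately show "prob ((case j of (k, i) \<Rightarrow> \<xi> k i) -` (case j of (k, i) \<Rightarrow> {w k $ i}) \<inter> space P) = 1 / 2"
        by (simp add: j)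
    qed
    also have "\<dots> = 1 / real (card ?S) ^ n"
      by (simp add: card_sign_vectors card_cartesian_product power_mult[symmetric] mult.commute power_one_over)
    finally show ?thesis .
  qed
  have F_eq: "F (E \<omega>) = (\<Sum>w\<in>?P. F w * indicator (A w) \<omega>)" if \<omega>: "\<omega> \<in> space P" for \<omega>
  proof -
    \<comment> \<open>Elements of the extensional product are fixed outside {1..n}, so the realised
      noise is restricted first; \<open>dep\<close> makes this harmless for F.\<close>
    define w0 where "w0 = restrict (E \<omega>) {1..n}"
    have w0: "w0 \<in> ?P"
      using val \<omega> by (auto simp: w0_def E_def sign_vectors_def)
    have "\<omega> \<in> A w \<longleftrightarrow> w = w0" if "w \<in> ?P" for w
    proof
      assume "\<omega> \<in> A w"
      then show "w = w0"
        using that w0 by (intro PiE_ext[OF that w0]) (auto simp: A_def w0_def)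
    qed (use \<omega> in \<open>auto simp: A_def w0_def\<close>)
    then have "(\<Sum>w\<in>?P. F w * indicator (A w) \<omega>) = (\<Sum>w\<in>?P. if w = w0 then F w else 0)"
      by (intro sum.cong) (auto simp: indicator_def)
    also have "\<dots> = F w0"
      using w0 by (simp del: One_nat_def)
    also have "\<dots> = F (E \<omega>)"
      by (rule dep) (simp add: w0_def)
    finally show ?thesis ..
  qed
  have "expectation (\<lambda>\<omega>. F (E \<omega>)) = expectation (\<lambda>\<omega>. \<Sum>w\<in>?P. F w * indicator (A w) \<omega>)"
    by (intro Bochner_Integration.integral_cong refl F_eq)
  also have "\<dots> = (\<Sum>w\<in>?P. F w * prob (A w))"
    using A_sets by (subst Bochner_Integration.integral_sum) (auto simp: integrable_indicator_iff less_top[symmetric])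
  also have "\<dots> = walk_mean n F"
    by (simp add: prob_A walk_mean_def sum_divide_distrib)
  finally show ?thesis
    by (simp add: E_def[abs_def])
qed

lemma reflected_walk_cong:
  assumes "\<And>j. j \<in> {1..k} \<Longrightarrow> e j = e' j"
  shows "reflected_walk G \<nu> b \<sigma> h x e k = reflected_walk G \<nu> b \<sigma> h x e' k"
  using assms by (induction k) auto

section \<open>Exponential moments of the noise\<close>

lemma exp_pair_lower: "2 + x^2 / 2 \<le> exp x + exp (- x)" for x :: real
proof -
  have "2 + x^2 / 2 \<le> exp x + exp (- x)" if "0 \<le> x" for x :: real
    using exp_lower_Taylor_quadratic[OF that] exp_ge_add_one_self[of "- x"] by linarith
  from this[of x] this[of "- x"] show ?thesis
    by (cases "0 \<le> x") auto
qed

text \<open>Pairing v with - v turns the exponential into a hyperbolic cosine, bounded below by a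
  quadratic whose mean is the diagonal covariance entry. The constant 1/4, instead of the sharp 1/2,
  comes from \<open>exp_pair_lower\<close>.\<close>

lemma sign_mean_exp:
  fixes A :: "real^'d::finite^'d"
  shows "1 + c^2 / 4 * (A ** transpose A) $ i $ i \<le> sign_mean (\<lambda>v. exp (c * (A *v v) $ i))"
proof -
  let ?s = "\<lambda>v. c * (A *v v) $ i"
  have minus: "?s (- v) = - ?s v" for v
    by (simp add: matrix_vector_mult_def sum_negf)
  have "1 + c^2 / 4 * (A ** transpose A) $ i $ i = sign_mean (\<lambda>v. 1 + c^2 / 4 * ((A *v v) $ i * (A *v v) $ i))"
    by (simp only: sign_mean_add sign_mean_const sign_mean_cmult sign_mean_matrix_vector_mult)
  also have "\<dots> \<le> sign_mean (\<lambda>v. 1 / 2 * (exp (?s v) + exp (?s (- v))))"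
  proof (rule sign_mean_mono)
    fix v :: "real^'d"
    show "1 + c^2 / 4 * ((A *v v) $ i * (A *v v) $ i) \<le> 1 / 2 * (exp (?s v) + exp (?s (- v)))"
      using exp_pair_lower[of "?s v"] unfolding minus by (simp add: power2_eq_square mult_ac)
  qed
  also have "\<dots> = sign_mean (\<lambda>v. exp (?s v))"
    unfolding sign_mean_cmult sign_mean_add sign_mean_uminus[of "\<lambda>v. exp (?s v)"] by simp
  finally show ?thesis .
qed

section \<open>Mean exit costs, telescoping and the lower bound\<close>

lemma trial_step_diff: "trial_step b \<sigma> h x v - x = h *\<^sub>R b x + sqrt h *\<^sub>R (\<sigma> x *v v)"
  by (simp add: trial_step_def)

definition cost_mean ::
    "(real^'d::finite) set \<Rightarrow> (real^'d \<Rightarrow> real^'d) \<Rightarrow> (real^'d \<Rightarrow> real^'d) \<Rightarrow> (real^'d \<Rightarrow> real^'d^'d) \<Rightarrow>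
     real \<Rightarrow> real^'d \<Rightarrow> (real^'d \<Rightarrow> real) \<Rightarrow> nat \<Rightarrow> real"
  where "cost_mean G \<nu> b \<sigma> h x \<phi> n = walk_mean n (\<lambda>w. \<Sum>k<n. exit_cost G \<phi>
    (trial_step b \<sigma> h (reflected_walk G \<nu> b \<sigma> h x w k) (w (Suc k))))"

lemma reflected_walk_upd:
  "k \<le> n \<Longrightarrow> reflected_walk G \<nu> b \<sigma> h x (w(Suc n := v)) k = reflected_walk G \<nu> b \<sigma> h x w k"
  by (rule reflected_walk_cong) auto

lemma cost_mean_Suc:
  "cost_mean G \<nu> b \<sigma> h x \<phi> (Suc n) = cost_mean G \<nu> b \<sigma> h x \<phi> n
    + walk_mean n (\<lambda>w. sign_mean (\<lambda>v. exit_cost G \<phi> (trial_step b \<sigma> h (reflected_walk G \<nu> b \<sigma> h x w n) v)))"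
proof -
  have *: "(\<Sum>k<n. exit_cost G \<phi> (trial_step b \<sigma> h (reflected_walk G \<nu> b \<sigma> h x (w(Suc n := v)) k) ((w(Suc n := v)) (Suc k))))
     = (\<Sum>k<n. exit_cost G \<phi> (trial_step b \<sigma> h (reflected_walk G \<nu> b \<sigma> h x w k) (w (Suc k))))" for w v
    by (intro sum.cong refl) (simp add: reflected_walk_upd)
  show ?thesis
    unfolding cost_mean_def walk_mean_Suc sum.lessThan_Suc sign_mean_add * walk_mean_add
    by (simp add: sign_mean_const reflected_walk_upd)
qed

lemma cost_mean_mono:
  assumes "\<And>y. exit_cost G \<phi> y \<le> exit_cost G \<phi>' y"
  shows "cost_mean G \<nu> b \<sigma> h x \<phi> n \<le> cost_mean G \<nu> b \<sigma> h x \<phi>' n"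
  unfolding cost_mean_def by (intro walk_mean_mono sum_mono assms)

lemma cost_mean_diff: "cost_mean G \<nu> b \<sigma> h x (\<lambda>z. \<phi> z - \<phi>' z) n
    = cost_mean G \<nu> b \<sigma> h x \<phi> n - cost_mean G \<nu> b \<sigma> h x \<phi>' n"
  and cost_mean_cmult: "cost_mean G \<nu> b \<sigma> h x (\<lambda>z. c * \<phi> z) n = c * cost_mean G \<nu> b \<sigma> h x \<phi> n"
proof -
  have 1: "exit_cost G (\<lambda>z. \<phi> z - \<phi>' z) y = exit_cost G \<phi> y - exit_cost G \<phi>' y"
    and 2: "exit_cost G (\<lambda>z. c * \<phi> z) y = c * exit_cost G \<phi> y" for y
    by (simp_all add: exit_cost_def algebra_simps)
  show "cost_mean G \<nu> b \<sigma> h x (\<lambda>z. \<phi> z - \<phi>' z) n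
    = cost_mean G \<nu> b \<sigma> h x \<phi> n - cost_mean G \<nu> b \<sigma> h x \<phi>' n"
    unfolding cost_mean_def 1 sum_subtractf walk_mean_diff ..
  show "cost_mean G \<nu> b \<sigma> h x (\<lambda>z. c * \<phi> z) n = c * cost_mean G \<nu> b \<sigma> h x \<phi> n"
    unfolding cost_mean_def 2 sum_distrib_left[symmetric] walk_mean_cmult ..
qed

lemma cost_mean_nonneg:
  fixes G :: "(real^'d::finite) set"
  shows "0 \<le> cost_mean G \<nu> b \<sigma> h x (\<lambda>_. 1) n"
proof -
  have "walk_mean n (\<lambda>w :: nat \<Rightarrow> real^'d. 0) \<le> cost_mean G \<nu> b \<sigma> h x (\<lambda>_. 1) n"
    unfolding cost_mean_def by (intro walk_mean_mono sum_nonneg exit_cost_one_nonneg)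
  then show ?thesis
    by (simp only: walk_mean_const)
qed

lemma walk_mean_walk_Suc:
  "walk_mean (Suc n) (\<lambda>w. V (reflected_walk G \<nu> b \<sigma> h x w (Suc n)))
    = walk_mean n (\<lambda>w. sign_mean (\<lambda>v. V (reflect_step G \<nu> (trial_step b \<sigma> h (reflected_walk G \<nu> b \<sigma> h x w n) v))))"
  unfolding walk_mean_Suc by (simp add: reflected_walk_upd)

locale walk_domain = reflecting_domain G k \<nu> \<delta> for G :: "(real^'d::finite) set" and k \<nu> \<delta> +
  fixes b :: "real^'d \<Rightarrow> real^'d" and \<sigma> :: "real^'d \<Rightarrow> real^'d^'d" and K :: real
  assumes K: "1 \<le> K"
    and b_bound: "\<And>x. x \<in> closure G \<Longrightarrow> norm (b x) \<le> K"
    and \<sigma>_bound: "\<And>x v. x \<in> closure G \<Longrightarrow> v \<in> sign_vectors \<Longrightarrow> norm (\<sigma> x *v v) \<le> K"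
begin

lemma dist_trial_step:
  assumes "x \<in> closure G" "v \<in> sign_vectors" "0 < h" "h \<le> 1"
  shows "dist x (trial_step b \<sigma> h x v) \<le> 2 * K * sqrt h"
proof -
  have "dist x (trial_step b \<sigma> h x v) = norm (h *\<^sub>R b x + sqrt h *\<^sub>R (\<sigma> x *v v))"
    by (simp only: trial_step_diff[symmetric] dist_norm norm_minus_commute)
  also have "\<dots> \<le> h * norm (b x) + sqrt h * norm (\<sigma> x *v v)"
    using norm_triangle_ineq[of "h *\<^sub>R b x" "sqrt h *\<^sub>R (\<sigma> x *v v)"] assms by simp
  also have "\<dots> \<le> sqrt h * K + sqrt h * K"
  proof -
    have "h = sqrt h * sqrt h"
      using assms by simp
    also have "\<dots> \<le> sqrt h * 1"
      using assms by (intro mult_left_mono) auto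
    finally have "h \<le> sqrt h" by simp
    then show ?thesis
      using assms b_bound \<sigma>_bound K by (intro add_mono mult_mono) auto
  qed
  finally show ?thesis by simp
qed

lemma walk_in_closure:
  assumes "x \<in> closure G" "0 < h" "h \<le> 1" "2 * K * sqrt h < \<delta>" "w \<in> PiE {1..n} (\<lambda>_. sign_vectors)" "m \<le> n"
  shows "reflected_walk G \<nu> b \<sigma> h x w m \<in> closure G"
  using assms(6)
proof (induction m)
  case 0
  then show ?case using assms by simp
next
  case (Suc m)
  then have c: "reflected_walk G \<nu> b \<sigma> h x w m \<in> closure G" by simp
  have "w (Suc m) \<in> sign_vectors"
    using assms(5) Suc.prems by auto
  from dist_trial_step[OF c this assms(2,3)]
  show ?case
    unfolding reflected_walk.simps using assms(4) by (intro reflect_step_in_closure[OF c]) linarith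
qed

text \<open>Averaging the Taylor polynomial leaves U0 + h (U1 + A U0) + O(h^2), and the differential
  equation removes the term of order h. Trial steps have length at most 2 K sqrt h, so
  \<open>step_estimate\<close> is used with 2 K; hence \<open>step_const B (2 * K)\<close> and the
  factor 6 K.\<close>

lemma step_mean:
  fixes B h :: real and U0 U1 :: "('d \<Rightarrow> nat) \<Rightarrow> real^'d \<Rightarrow> real" and u' \<phi> :: "real^'d \<Rightarrow> real"
  assumes jet0: "smooth_jet 4 G B U0" and jet1: "smooth_jet 2 G B U1"
    and time: "\<And>y. y \<in> closure G \<Longrightarrow> \<bar>u' y - U0 mi_zero y - h * U1 mi_zero y\<bar> \<le> B * h^2"
    and neumann: "\<And>z. z \<in> frontier G \<Longrightarrow> lin (\<lambda>i. U0 (mi_incr i mi_zero) z) (\<nu> z) = \<phi> z"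
    and pde: "U1 mi_zero x + (\<Sum>i\<in>UNIV. \<Sum>j\<in>UNIV. (\<sigma> x ** transpose (\<sigma> x)) $ i $ j
        * U0 (mi_incr j (mi_incr i mi_zero)) x) / 2 + lin (\<lambda>i. U0 (mi_incr i mi_zero) x) (b x) = 0"
    and x: "x \<in> closure G" and h: "0 < h" "h \<le> 1"
    and small: "6 * K * sqrt h < \<delta>" "6 * K * sqrt h < 1 / (3 * k) ^ 4"
  defines "S \<equiv> step_const B (2 * K)"
  shows "\<bar>sign_mean (\<lambda>v. u' (reflect_step G \<nu> (trial_step b \<sigma> h x v)) - exit_cost G \<phi> (trial_step b \<sigma> h x v)) - U0 mi_zero x\<bar>
    \<le> (S + 2 * real CARD('d)^3 * B * K^3 + real CARD('d) * B * K) * h^2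
      + S * h * sign_mean (\<lambda>v. exit_cost G (\<lambda>_. 1) (trial_step b \<sigma> h x v))"
proof -
  let ?y = "\<lambda>v. trial_step b \<sigma> h x v"
  let ?f = "\<lambda>v. u' (reflect_step G \<nu> (?y v)) - exit_cost G \<phi> (?y v)"
  let ?q = "\<lambda>v. taylor_poly h U0 U1 x (?y v - x)"
  have small': "3 * (2 * K) * sqrt h < \<delta>" "3 * (2 * K) * sqrt h < 1 / (3 * k) ^ 4"
    using small by simp_all
  have "\<bar>sign_mean ?f - sign_mean ?q\<bar> \<le> sign_mean (\<lambda>v. \<bar>?f v - ?q v\<bar>)"
    using sign_mean_abs[of "\<lambda>v. ?f v - ?q v"] by (simp add: sign_mean_diff)
  also have "\<dots> \<le> sign_mean (\<lambda>v. S * h^2 + (S * h) * exit_cost G (\<lambda>_. 1) (?y v))"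
  proof (rule sign_mean_mono)
    fix v :: "real^'d" assume v: "v \<in> sign_vectors"
    have "\<bar>?f v - ?q v\<bar> \<le> S * (h^2 + h * exit_cost G (\<lambda>_. 1) (?y v))"
      unfolding S_def using K
      by (intro step_estimate[OF jet0 jet1 time neumann x _ h small' dist_trial_step[OF x v h]]) auto
    then show "\<bar>?f v - ?q v\<bar> \<le> S * h^2 + (S * h) * exit_cost G (\<lambda>_. 1) (?y v)"
      by (simp add: algebra_simps)
  qed
  also have "\<dots> = S * h^2 + (S * h) * sign_mean (\<lambda>v. exit_cost G (\<lambda>_. 1) (?y v))"
    by (simp only: sign_mean_add sign_mean_const sign_mean_cmult)
  finally have 1: "\<bar>sign_mean ?f - sign_mean ?q\<bar> \<le> \<dots>" .
  let ?g = "\<lambda>i. U0 (mi_incr i mi_zero) x"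
  let ?H = "\<lambda>i j. U0 (mi_incr j (mi_incr i mi_zero)) x"
  let ?T = "\<lambda>i j l. U0 (mi_incr l (mi_incr j (mi_incr i mi_zero))) x"
  let ?g1 = "\<lambda>i. U1 (mi_incr i mi_zero) x"
  let ?v = "\<lambda>v. h *\<^sub>R b x + sqrt h *\<^sub>R (\<sigma> x *v v)"
  let ?cub = "\<lambda>v. lin ?g (?v v) + quad ?H (?v v) (?v v) / 2 + tri ?T (?v v) (?v v) (?v v) / 6"
  let ?A = "lin ?g (b x) + (\<Sum>i\<in>UNIV. \<Sum>j\<in>UNIV. (\<sigma> x ** transpose (\<sigma> x)) $ i $ j * ?H i j) / 2"
  have HB: "\<bar>?H i j\<bar> \<le> B" and TB: "\<bar>?T i j l\<bar> \<le> B" and g1B: "\<bar>?g1 i\<bar> \<le> B" for i j l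
    using jet0 jet1 x by (simp_all add: smooth_jet_def)
  have cub: "\<bar>sign_mean ?cub - h * ?A\<bar> \<le> 2 * real CARD('d)^3 * B * K^3 * h^2"
    by (rule sign_mean_cubic[OF HB TB h b_bound[OF x] \<sigma>_bound[OF x] K])
  have lin0: "sign_mean (\<lambda>v. lin ?g1 (\<sigma> x *v v)) = 0"
    by (simp add: lin_def sign_mean_sum sign_mean_cmult sign_mean_matrix_vector)
  have "sign_mean ?q = sign_mean (\<lambda>v. U0 mi_zero x + (?cub v + (h * U1 mi_zero x
      + (h * h * lin ?g1 (b x) + h * sqrt h * lin ?g1 (\<sigma> x *v v)))))"
    by (intro sign_mean_cong) (simp add: taylor_poly_def trial_step_diff lin_simps distrib_left mult.assoc)
  also have "\<dots> = U0 mi_zero x + (sign_mean ?cub + (h * U1 mi_zero x + h * h * lin ?g1 (b x)))"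
    unfolding sign_mean_add[of "\<lambda>v. U0 mi_zero x"] sign_mean_add[of ?cub] sign_mean_add[of "\<lambda>v. h * U1 mi_zero x"]
      sign_mean_add[of "\<lambda>v. h * h * lin ?g1 (b x)"] sign_mean_const sign_mean_cmult lin0 by simp
  finally have q: "sign_mean ?q - U0 mi_zero x = (sign_mean ?cub - h * ?A) + h * (U1 mi_zero x + ?A) + h * h * lin ?g1 (b x)"
    by (simp add: algebra_simps)
  have pde0: "U1 mi_zero x + ?A = 0"
    using pde by (simp add: algebra_simps)
  have "\<bar>lin ?g1 (b x)\<bar> \<le> real CARD('d) * B * norm (b x)"
    by (rule lin_bound[OF g1B])
  also have "\<dots> \<le> real CARD('d) * B * K"
    using b_bound[OF x] g1B[of undefined] by (intro mult_left_mono mult_nonneg_nonneg) auto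
  finally have "h * h * \<bar>lin ?g1 (b x)\<bar> \<le> h * h * (real CARD('d) * B * K)"
    using h by (intro mult_left_mono) auto
  then have l1: "\<bar>h * h * lin ?g1 (b x)\<bar> \<le> real CARD('d) * B * K * h^2"
    by (simp add: abs_mult power2_eq_square mult_ac)
  have 2: "\<bar>sign_mean ?q - U0 mi_zero x\<bar> \<le> 2 * real CARD('d)^3 * B * K^3 * h^2 + real CARD('d) * B * K * h^2"
    unfolding q pde0 using cub l1 by linarith
  have "\<bar>sign_mean ?f - U0 mi_zero x\<bar> \<le> S * h^2 + (S * h) * sign_mean (\<lambda>v. exit_cost G (\<lambda>_. 1) (?y v))
      + (2 * real CARD('d)^3 * B * K^3 * h^2 + real CARD('d) * B * K * h^2)"
    using 1 2 by linarith
  then show ?thesis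
    by (simp only: distrib_right)
qed

text \<open>\<open>V n\<close> stands for the solution at time n h. The one-step bound depends on
  the current position through its mean exit cost, and averaging over the past turns these costs
  into the increments of \<open>cost_mean\<close>.\<close>

lemma telescope:
  fixes V :: "nat \<Rightarrow> real^'d \<Rightarrow> real"
  assumes x: "x \<in> closure G" and h: "0 < h" "h \<le> 1" and small: "2 * K * sqrt h < \<delta>"
    and step: "\<And>n y. n < N \<Longrightarrow> y \<in> closure G \<Longrightarrow>
      \<bar>sign_mean (\<lambda>v. V (Suc n) (reflect_step G \<nu> (trial_step b \<sigma> h y v)) - exit_cost G \<phi> (trial_step b \<sigma> h y v)) - V n y\<bar>
        \<le> c1 + c2 * sign_mean (\<lambda>v. exit_cost G (\<lambda>_. 1) (trial_step b \<sigma> h y v))"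
    and n: "n \<le> N"
  shows "\<bar>walk_mean n (\<lambda>w. V n (reflected_walk G \<nu> b \<sigma> h x w n)) - V 0 x - cost_mean G \<nu> b \<sigma> h x \<phi> n\<bar>
    \<le> n * c1 + c2 * cost_mean G \<nu> b \<sigma> h x (\<lambda>_. 1) n"
  using n
proof (induction n)
  case 0
  then show ?case
    by (simp add: cost_mean_def walk_mean_const)
next
  case (Suc n)
  let ?X = "\<lambda>w. reflected_walk G \<nu> b \<sigma> h x w n"
  let ?f = "\<lambda>y. sign_mean (\<lambda>v. V (Suc n) (reflect_step G \<nu> (trial_step b \<sigma> h y v)) - exit_cost G \<phi> (trial_step b \<sigma> h y v))"
  let ?e = "\<lambda>y. sign_mean (\<lambda>v. exit_cost G (\<lambda>_. 1) (trial_step b \<sigma> h y v))"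
  have "\<bar>walk_mean n (\<lambda>w. ?f (?X w) - V n (?X w))\<bar> \<le> walk_mean n (\<lambda>w. c1 + c2 * ?e (?X w))"
  proof (rule order_trans[OF walk_mean_abs], rule walk_mean_mono)
    fix w :: "nat \<Rightarrow> real^'d" assume "w \<in> PiE {1..n} (\<lambda>_. sign_vectors)"
    then show "\<bar>?f (?X w) - V n (?X w)\<bar> \<le> c1 + c2 * ?e (?X w)"
      using Suc.prems by (intro step walk_in_closure[OF x h small]) auto
  qed
  also have "\<dots> = c1 + c2 * walk_mean n (\<lambda>w. ?e (?X w))"
    by (simp only: walk_mean_add walk_mean_const walk_mean_cmult)
  finally have 1: "\<bar>walk_mean n (\<lambda>w. ?f (?X w)) - walk_mean n (\<lambda>w. V n (?X w))\<bar> \<le> c1 + c2 * walk_mean n (\<lambda>w. ?e (?X w))"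
    by (simp only: walk_mean_diff)
  have 2: "walk_mean n (\<lambda>w. ?f (?X w)) = walk_mean (Suc n) (\<lambda>w. V (Suc n) (reflected_walk G \<nu> b \<sigma> h x w (Suc n)))
      - (cost_mean G \<nu> b \<sigma> h x \<phi> (Suc n) - cost_mean G \<nu> b \<sigma> h x \<phi> n)"
    unfolding walk_mean_walk_Suc cost_mean_Suc sign_mean_diff walk_mean_diff by simp
  have 3: "cost_mean G \<nu> b \<sigma> h x (\<lambda>_. 1) (Suc n) = cost_mean G \<nu> b \<sigma> h x (\<lambda>_. 1) n + walk_mean n (\<lambda>w. ?e (?X w))"
    by (rule cost_mean_Suc)
  have 4: "real (Suc n) * c1 = n * c1 + c1"
    by (simp add: distrib_right)
  have IH: "\<bar>walk_mean n (\<lambda>w. V n (?X w)) - V 0 x - cost_mean G \<nu> b \<sigma> h x \<phi> n\<bar>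
    \<le> n * c1 + c2 * cost_mean G \<nu> b \<sigma> h x (\<lambda>_. 1) n"
    using Suc by simp
  show ?case
    unfolding 3 4 distrib_left using IH 1 unfolding 2 by linarith
qed

text \<open>For large \<theta> the diffusion contributes order \<theta>^2 to the growth rate of
  exp(\<theta> x_i), while the drift can remove only order \<theta>.\<close>

lemma exp_growth:
  assumes a0: "0 < a0" "\<And>x. x \<in> closure G \<Longrightarrow> a0 \<le> (\<sigma> x ** transpose (\<sigma> x)) $ i $ i"
  obtains \<theta> h1 where "0 < \<theta>" "0 < h1"
    "\<And>x h. x \<in> closure G \<Longrightarrow> 0 < h \<Longrightarrow> h < h1 \<Longrightarrow>
      exp (\<theta> * x $ i) * (1 + h) \<le> sign_mean (\<lambda>v. exp (\<theta> * trial_step b \<sigma> h x v $ i))"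
proof -
  \<comment> \<open>Makes \<open>\<theta> * a0 / 4 - K\<close> at least 2; with
    \<open>1 \<le> \<theta>\<close> the net rate is then at least 2.\<close>
  define \<theta> where "\<theta> = max 1 (4 * (K + 2) / a0)"
  have l1: "1 \<le> \<theta>" and "4 * (K + 2) / a0 \<le> \<theta>"
    by (simp_all add: \<theta>_def)
  then have "K + 2 \<le> \<theta> * a0 / 4"
    using a0(1) by (simp add: field_simps)
  then have "2 \<le> \<theta> * (\<theta> * a0 / 4 - K)"
    using mult_mono[of 1 \<theta> 2 "\<theta> * a0 / 4 - K"] l1 by simp
  then have l2: "2 \<le> \<theta>^2 * a0 / 4 - \<theta> * K"
    by (simp add: power2_eq_square algebra_simps)
  \<comment> \<open>The coefficient of - h^2 in the product of the drift and diffusion factors. For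
    h below 1 / (E + 1) it costs at most h, so h remains of the gain 2 h.\<close>
  define E where "E = \<theta> * K * (\<theta>^2 * a0 / 4)"
  have E: "0 \<le> E"
    using l1 K a0(1) by (simp add: E_def)
  show thesis
  proof (rule that[of \<theta> "1 / (E + 1)"])
    fix x h assume x: "x \<in> closure G" and h: "0 < h" "h < 1 / (E + 1)"
    let ?q = "\<theta>^2 * a0 / 4"
    have hE: "h * E \<le> 1"
    proof -
      have "h * (E + 1) < 1"
        using h E by (simp add: pos_less_divide_eq)
      then show ?thesis
        using h by (simp add: distrib_left)
    qed
    have "h * (h * E) \<le> h * 1"
      using hE h by (intro mult_left_mono) auto
    moreover have "h * 2 \<le> h * (?q - \<theta> * K)"
      using l2 h by (intro mult_left_mono) auto
    moreover have "(1 - \<theta> * h * K) * (1 + h * ?q) = 1 + h * (?q - \<theta> * K) - h * (h * E)"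
    proof -
      have "(1 - \<theta> * h * K) * (1 + h * q) = 1 + h * (q - \<theta> * K) - h * (h * (\<theta> * K * q))" for q
        by (simp add: algebra_simps)
      then show ?thesis
        unfolding E_def .
    qed
    ultimately have "1 + h \<le> (1 - \<theta> * h * K) * (1 + h * ?q)"
      by linarith
    also have "\<dots> \<le> exp (\<theta> * h * b x $ i) * (1 + h * ?q)"
    proof (rule mult_right_mono)
      have "\<bar>b x $ i\<bar> \<le> K"
        using component_le_norm_cart[of "b x" i] b_bound[OF x] by linarith
      then have "\<theta> * h * (- K) \<le> \<theta> * h * b x $ i"
        using l1 h by (intro mult_left_mono) auto
      then show "1 - \<theta> * h * K \<le> exp (\<theta> * h * b x $ i)"
        using exp_ge_add_one_self[of "\<theta> * h * b x $ i"] by linarith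
      show "0 \<le> 1 + h * ?q"
        using h a0(1) by simp
    qed
    also have "\<dots> \<le> exp (\<theta> * h * b x $ i) * sign_mean (\<lambda>v. exp ((\<theta> * sqrt h) * (\<sigma> x *v v) $ i))"
    proof (rule mult_left_mono)
      have "h * ?q \<le> (\<theta> * sqrt h)^2 / 4 * (\<sigma> x ** transpose (\<sigma> x)) $ i $ i"
      proof -
        have "\<theta>^2 * h / 4 * a0 \<le> \<theta>^2 * h / 4 * (\<sigma> x ** transpose (\<sigma> x)) $ i $ i"
          using a0(2)[OF x] h by (intro mult_left_mono) auto
        then show ?thesis
          using h by (simp add: power_mult_distrib mult_ac)
      qed
      then show "1 + h * ?q \<le> sign_mean (\<lambda>v. exp ((\<theta> * sqrt h) * (\<sigma> x *v v) $ i))"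
        using sign_mean_exp[of "\<theta> * sqrt h" "\<sigma> x" i] by linarith
    qed simp
    finally have "exp (\<theta> * x $ i) * (1 + h) \<le> exp (\<theta> * x $ i) * (exp (\<theta> * h * b x $ i)
        * sign_mean (\<lambda>v. exp ((\<theta> * sqrt h) * (\<sigma> x *v v) $ i)))"
      by (intro mult_left_mono) auto
    also have "\<dots> = sign_mean (\<lambda>v. exp (\<theta> * trial_step b \<sigma> h x v $ i))"
      unfolding sign_mean_cmult[symmetric]
      by (intro sign_mean_cong) (simp add: trial_step_def exp_add[symmetric] algebra_simps)
    finally show "exp (\<theta> * x $ i) * (1 + h) \<le> sign_mean (\<lambda>v. exp (\<theta> * trial_step b \<sigma> h x v $ i))" .
  qed (use l1 E in auto)
qed

end

text \<open>On the closure f lies between two positive constants \<open>c0\<close> and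
  \<open>c1\<close>. Each trial step raises its mean by at least \<open>c0 * h\<close>, and a
  reflection lowers it by at most L times the exit cost. As the mean never exceeds
  \<open>c1\<close>, L times the total cost must make up for
  \<open>c0 * (real n * h) - c1\<close>.\<close>

lemma (in walk_domain) cost_mean_lower:
  assumes "bounded G" and a0: "0 < a0" "\<And>x. x \<in> closure G \<Longrightarrow> a0 \<le> (\<sigma> x ** transpose (\<sigma> x)) $ i $ i"
  obtains c C h1 where "0 < c" "0 < C" "0 < h1"
    "\<And>x h n. x \<in> closure G \<Longrightarrow> 0 < h \<Longrightarrow> h < h1 \<Longrightarrow> h \<le> 1 \<Longrightarrow> 2 * K * sqrt h < \<delta> \<Longrightarrow>
      c * (real n * h) - C \<le> cost_mean G \<nu> b \<sigma> h x (\<lambda>_. 1) n"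
proof -
  obtain \<theta> h1 where \<theta>: "0 < \<theta>" "0 < h1"
    and growth: "\<And>x h. x \<in> closure G \<Longrightarrow> 0 < h \<Longrightarrow> h < h1 \<Longrightarrow>
      exp (\<theta> * x $ i) * (1 + h) \<le> sign_mean (\<lambda>v. exp (\<theta> * trial_step b \<sigma> h x v $ i))"
    using exp_growth[OF a0] by blast
  obtain M where M: "\<forall>x\<in>closure G. norm x \<le> M"
    using bounded_closure[OF assms(1)] by (auto simp: bounded_iff)
  have Mi: "\<bar>x $ i\<bar> \<le> M" if "x \<in> closure G" for x
    using M that component_le_norm_cart[of x i] by fastforce
  define f where "f y = exp (\<theta> * y $ i)" for y :: "real^'d"
  define c0 where "c0 = exp (- (\<theta> * M))"
  define c1 where "c1 = exp (\<theta> * M)"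
  \<comment> \<open>A bound for the derivative of exp(\<theta> s) on s \<le> M + 2 K, the range of
    the i-th coordinate of trial points when h \<le> 1.\<close>
  define L where "L = \<theta> * exp (\<theta> * (M + 2 * K))"
  have pos: "0 < c0" "0 < c1" "0 < L"
    using \<theta> by (simp_all add: c0_def c1_def L_def)
  have f_bounds: "c0 \<le> f y" "f y \<le> c1" if "y \<in> closure G" for y
  proof -
    have "\<theta> * \<bar>y $ i\<bar> \<le> \<theta> * M"
      using Mi[OF that] \<theta> by (intro mult_left_mono) auto
    then have "\<bar>\<theta> * y $ i\<bar> \<le> \<theta> * M"
      using \<theta> by (simp add: abs_mult)
    then show "c0 \<le> f y" "f y \<le> c1"
      by (simp_all add: f_def c0_def c1_def abs_le_iff)
  qed
  \<comment> \<open>The reflection moves coordinate i down by at most 2 r; exp z \<ge> 1 + z bounds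
    the resulting loss.\<close>
  have refl_lower: "f y - L * exit_cost G (\<lambda>_. 1) y \<le> f (reflect_step G \<nu> y)"
    if x: "x \<in> closure G" and d: "dist x y < \<delta>" "dist x y \<le> 2 * K" for x y
  proof (cases "y \<in> closure G")
    case True
    then show ?thesis
      by (simp add: exit_cost_def reflect_step_def)
  next
    case False
    define p where "p = closest_point (frontier G) y"
    define r where "r = dist y p"
    have nv: "norm (\<nu> p) = 1"
      using reflect[OF x False d(1) p_def r_def] by blast
    have Ry: "reflect_step G \<nu> y = y + (2 * r) *\<^sub>R \<nu> p"
      using False by (simp add: reflect_step_def p_def r_def Let_def)
    have r0: "0 \<le> r" by (simp add: r_def)
    have "\<bar>\<nu> p $ i\<bar> \<le> 1"
      using component_le_norm_cart[of "\<nu> p" i] nv by simp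
    then have "2 * r * (- 1) \<le> 2 * r * \<nu> p $ i"
      using r0 by (intro mult_left_mono) auto
    then have "\<theta> * (- 2 * r) \<le> \<theta> * (2 * r * \<nu> p $ i)"
      using \<theta> by (intro mult_left_mono) auto
    then have "1 - \<theta> * (2 * r) \<le> exp (\<theta> * (2 * r * \<nu> p $ i))"
      using exp_ge_add_one_self[of "\<theta> * (2 * r * \<nu> p $ i)"] by linarith
    then have "f y * (1 - \<theta> * (2 * r)) \<le> f y * exp (\<theta> * (2 * r * \<nu> p $ i))"
      by (intro mult_left_mono) (simp_all add: f_def)
    also have "\<dots> = f (reflect_step G \<nu> y)"
      by (simp add: f_def Ry exp_add[symmetric] distrib_left)
    finally have 1: "f y - f y * (\<theta> * (2 * r)) \<le> f (reflect_step G \<nu> y)"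
      by (simp add: right_diff_distrib)
    have "y $ i \<le> M + 2 * K"
    proof -
      have "\<bar>(y - x) $ i\<bar> \<le> dist x y"
        by (metis component_le_norm_cart dist_norm norm_minus_commute)
      then show ?thesis
        using Mi[OF x] d by (simp add: abs_le_iff)
    qed
    then have "f y \<le> exp (\<theta> * (M + 2 * K))"
      using \<theta> by (simp add: f_def)
    then have "f y * (\<theta> * (2 * r)) \<le> exp (\<theta> * (M + 2 * K)) * (\<theta> * (2 * r))"
      using \<theta> r0 by (intro mult_right_mono) auto
    then have "f y * (\<theta> * (2 * r)) \<le> L * exit_cost G (\<lambda>_. 1) y"
      using False by (simp add: L_def exit_cost_def p_def r_def mult_ac)
    then show ?thesis
      using 1 by linarith
  qed
  have main: "f x + c0 * (real n * h) - L * cost_mean G \<nu> b \<sigma> h x (\<lambda>_. 1) n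
      \<le> walk_mean n (\<lambda>w. f (reflected_walk G \<nu> b \<sigma> h x w n))"
    if x: "x \<in> closure G" and h: "0 < h" "h < h1" "h \<le> 1" and small: "2 * K * sqrt h < \<delta>" for x h n
  proof (induction n)
    case 0
    then show ?case
      by (simp add: cost_mean_def walk_mean_const)
  next
    case (Suc n)
    let ?X = "\<lambda>w. reflected_walk G \<nu> b \<sigma> h x w n"
    let ?e = "\<lambda>y. sign_mean (\<lambda>v. exit_cost G (\<lambda>_. 1) (trial_step b \<sigma> h y v))"
    have step: "f y + c0 * h - L * ?e y \<le> sign_mean (\<lambda>v. f (reflect_step G \<nu> (trial_step b \<sigma> h y v)))"
      if y: "y \<in> closure G" for y
    proof -
      have "c0 * h \<le> f y * h"
        using f_bounds(1)[OF y] h by (intro mult_right_mono) auto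
      then have "f y + c0 * h \<le> f y * (1 + h)"
        by (simp add: distrib_left)
      also have "\<dots> \<le> sign_mean (\<lambda>v. f (trial_step b \<sigma> h y v))"
        unfolding f_def by (rule growth[OF y h(1,2)])
      finally have "f y + c0 * h - L * ?e y
          \<le> sign_mean (\<lambda>v. f (trial_step b \<sigma> h y v) - L * exit_cost G (\<lambda>_. 1) (trial_step b \<sigma> h y v))"
        by (simp add: sign_mean_diff sign_mean_cmult)
      also have "\<dots> \<le> sign_mean (\<lambda>v. f (reflect_step G \<nu> (trial_step b \<sigma> h y v)))"
      proof (rule sign_mean_mono)
        fix v :: "real^'d" assume v: "v \<in> sign_vectors"
        have d: "dist y (trial_step b \<sigma> h y v) \<le> 2 * K * sqrt h"
          by (rule dist_trial_step[OF y v h(1,3)])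
        have "2 * K * sqrt h \<le> 2 * K * 1"
          using K h by (intro mult_left_mono) auto
        then show "f (trial_step b \<sigma> h y v) - L * exit_cost G (\<lambda>_. 1) (trial_step b \<sigma> h y v)
            \<le> f (reflect_step G \<nu> (trial_step b \<sigma> h y v))"
          using d small by (intro refl_lower[OF y]) linarith+
      qed
      finally show ?thesis .
    qed
    have "walk_mean n (\<lambda>w. f (?X w)) + c0 * h - L * walk_mean n (\<lambda>w. ?e (?X w))
        = walk_mean n (\<lambda>w. f (?X w) + c0 * h - L * ?e (?X w))"
      by (simp only: walk_mean_diff walk_mean_add walk_mean_const walk_mean_cmult)
    also have "\<dots> \<le> walk_mean n (\<lambda>w. sign_mean (\<lambda>v. f (reflect_step G \<nu> (trial_step b \<sigma> h (?X w) v))))"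
      by (intro walk_mean_mono step walk_in_closure[OF x h(1,3) small]) auto
    also have "\<dots> = walk_mean (Suc n) (\<lambda>w. f (reflected_walk G \<nu> b \<sigma> h x w (Suc n)))"
      by (rule walk_mean_walk_Suc[symmetric])
    finally have 1: "walk_mean n (\<lambda>w. f (?X w)) + c0 * h - L * walk_mean n (\<lambda>w. ?e (?X w)) \<le> \<dots>" .
    have 2: "c0 * (real (Suc n) * h) = c0 * (real n * h) + c0 * h"
      by (simp add: algebra_simps)
    show ?case
      unfolding cost_mean_Suc[of _ _ _ _ _ _ "\<lambda>_. 1"] 2 distrib_left[of L] using Suc.IH 1 by linarith
  qed
  show thesis
  proof (rule that[of "c0 / L" "c1 / L" h1])
    fix x h n
    assume x: "x \<in> closure G" and h: "0 < h" "h < h1" "h \<le> 1" and small: "2 * K * sqrt h < \<delta>"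
    have "walk_mean n (\<lambda>w. f (reflected_walk G \<nu> b \<sigma> h x w n)) \<le> walk_mean n (\<lambda>w :: nat \<Rightarrow> real^'d. c1)"
      by (intro walk_mean_mono f_bounds walk_in_closure[OF x h(1,3) small]) auto
    then have "walk_mean n (\<lambda>w. f (reflected_walk G \<nu> b \<sigma> h x w n)) \<le> c1"
      by (simp only: walk_mean_const)
    then have "c0 * (real n * h) - c1 \<le> L * cost_mean G \<nu> b \<sigma> h x (\<lambda>_. 1) n"
      using main[OF x h small, of n] f_bounds(1)[OF x] pos by linarith
    then have "(c0 * (real n * h) - c1) / L \<le> cost_mean G \<nu> b \<sigma> h x (\<lambda>_. 1) n"
      using pos by (simp add: pos_divide_le_eq mult.commute)
    then show "c0 / L * (real n * h) - c1 / L \<le> cost_mean G \<nu> b \<sigma> h x (\<lambda>_. 1) n"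
      by (simp add: diff_divide_distrib)
  qed (use pos \<theta> in auto)
qed

section \<open>Bounds drawn from the regularity assumptions\<close>

lemma finite_mi_order_le: "finite {j :: 'd::finite \<Rightarrow> nat. mi_order j \<le> n}"
proof (rule finite_subset)
  show "{j :: 'd \<Rightarrow> nat. mi_order j \<le> n} \<subseteq> PiE UNIV (\<lambda>_. {..n})"
  proof
    fix j :: "'d \<Rightarrow> nat" assume j: "j \<in> {j. mi_order j \<le> n}"
    have "j i \<le> mi_order j" for i
      unfolding mi_order_def by (rule member_le_sum) auto
    then show "j \<in> PiE UNIV (\<lambda>_. {..n})"
      using j by (auto intro: order_trans)
  qed
qed (intro finite_PiE, auto)

lemma parabolic_norm4_bound:
  fixes G :: "(real^'d::finite) set"
  assumes "parabolic_norm4 T G D \<le> ennreal C" "0 \<le> C" "2 * i + mi_order j \<le> 4" "t \<in> {0..<T}" "x \<in> closure G"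
  shows "\<bar>D i j t x\<bar> \<le> C"
proof -
  let ?f = "\<lambda>(i, j). SUP (t, x)\<in>{0..<T} \<times> closure G. ennreal \<bar>D i j t x\<bar>"
  let ?I = "\<lambda>p. {(i, j :: 'd \<Rightarrow> nat). 2 * i + mi_order j = p}"
  let ?p = "2 * i + mi_order j"
  \<comment> \<open>Finiteness matters: each supremum is bounded by the sum only because that sum is
    not the default 0 of an infinite index set.\<close>
  have fin: "finite (?I p)" for p
    by (rule finite_subset[of _ "{..p} \<times> {j. mi_order j \<le> p}"]) (auto simp: finite_mi_order_le)
  have "ennreal \<bar>D i j t x\<bar> \<le> ?f (i, j)"
    using assms by (auto intro!: SUP_upper2[of "(t, x)"])
  also have "\<dots> \<le> sum ?f (?I ?p)"
    using fin by (intro member_le_sum) auto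
  also have "\<dots> \<le> (\<Sum>p=0..4. sum ?f (?I p))"
    using assms(3) by (intro member_le_sum[of ?p "{0..4}" "\<lambda>p. sum ?f (?I p)"]) auto
  also have "\<dots> = parabolic_norm4 T G D"
    by (simp add: parabolic_norm4_def)
  also have "\<dots> \<le> ennreal C" by fact
  finally show ?thesis
    using assms(2) by (simp add: ennreal_le_iff)
qed

lemma parabolic_smooth_jet:
  fixes D :: "nat \<Rightarrow> ('d::finite \<Rightarrow> nat) \<Rightarrow> real \<Rightarrow> real^'d \<Rightarrow> real"
  assumes "parabolic_derivatives T G u D" "t \<in> {0..<T}" "2 * i + n \<le> 4"
    and C: "\<And>i j t x. 2 * i + mi_order j \<le> 4 \<Longrightarrow> t \<in> {0..<T} \<Longrightarrow> x \<in> closure G \<Longrightarrow> \<bar>D i j t x\<bar> \<le> C"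
  shows "smooth_jet n G C (\<lambda>j. D i j t)"
  unfolding smooth_jet_def
proof (intro conjI allI impI ballI)
  fix j :: "'d \<Rightarrow> nat" assume "mi_order j \<le> n"
  then have ij: "2 * i + mi_order j \<le> 4"
    using assms(3) by simp
  then have "continuous_on ({0..<T} \<times> closure G) (\<lambda>(t, x). D i j t x)"
    using assms(1) unfolding parabolic_derivatives_def by blast
  then have "continuous_on (closure G) (\<lambda>x. (\<lambda>(t, x). D i j t x) (t, x))"
    by (rule continuous_on_compose2) (use assms(2) in \<open>auto intro!: continuous_intros\<close>)
  then show "continuous_on (closure G) (D i j t)"
    by simp
  show "\<bar>D i j t x\<bar> \<le> C" if "x \<in> closure G" for x
    using C[OF ij assms(2) that] .
next
  fix l and j :: "'d \<Rightarrow> nat" and x assume "mi_order (mi_incr l j) \<le> n" "x \<in> G"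
  then have "2 * i + mi_order (mi_incr l j) \<le> 4"
    using assms(3) by linarith
  then show "has_partial_derivative (D i j t) l (D i (mi_incr l j) t x) x"
    using assms(1,2) \<open>x \<in> G\<close> unfolding parabolic_derivatives_def by blast
qed

text \<open>Two mean value theorems in time reach the second time derivative, which the parabolic
  norm of order 4 controls. The condition \<open>t + h < T\<close> keeps all points in the half-open
  interval where the derivatives are bounded.\<close>

lemma parabolic_time_taylor:
  fixes D :: "nat \<Rightarrow> ('d::finite \<Rightarrow> nat) \<Rightarrow> real \<Rightarrow> real^'d \<Rightarrow> real"
  assumes "parabolic_derivatives T G u D" "0 \<le> t" "0 < h" "t + h < T" "x \<in> closure G"
    and C: "\<And>i j t x. 2 * i + mi_order j \<le> 4 \<Longrightarrow> t \<in> {0..<T} \<Longrightarrow> x \<in> closure G \<Longrightarrow> \<bar>D i j t x\<bar> \<le> C"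
  shows "\<bar>D 0 mi_zero (t + h) x - D 0 mi_zero t x - h * D 1 mi_zero t x\<bar> \<le> C * h^2"
proof -
  have d: "((\<lambda>s. D i mi_zero s x) has_real_derivative D (Suc i) mi_zero s x) (at s within {0..<T})"
    if "2 * Suc i \<le> 4" "s \<in> {0..<T}" for i s
    using assms(1,5) that unfolding parabolic_derivatives_def by (simp del: One_nat_def)
  have der: "((\<lambda>s. D i mi_zero s x) has_derivative (*) (D (Suc i) mi_zero s x)) (at s within {t..t'})"
    if "2 * Suc i \<le> 4" "s \<in> {t..t'}" "t' < T" for i s t'
  proof -
    have "((\<lambda>s. D i mi_zero s x) has_real_derivative D (Suc i) mi_zero s x) (at s within {t..t'})"
      by (rule DERIV_subset[OF d]) (use that assms(2) in auto)
    then show ?thesis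
      by (simp only: has_field_derivative_def)
  qed
  obtain s1 where s1: "s1 \<in> {t..t + h}" "D 0 mi_zero (t + h) x - D 0 mi_zero t x = D 1 mi_zero s1 x * h"
    using mvt_very_simple[of t "t + h" "\<lambda>s. D 0 mi_zero s x", OF _ der[of 0]] assms(3,4) by auto
  have s1T: "s1 < T"
    using s1 assms by auto
  obtain s2 where s2: "s2 \<in> {t..s1}" "D 1 mi_zero s1 x - D 1 mi_zero t x = D 2 mi_zero s2 x * (s1 - t)"
    using mvt_very_simple[of t s1 "\<lambda>s. D 1 mi_zero s x", OF _ der[of 1]] s1(1) s1T
    by (auto simp: numeral_2_eq_2)
  have "\<bar>D 2 mi_zero s2 x * (s1 - t)\<bar> \<le> C * h"
    unfolding abs_mult
  proof (rule mult_mono)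
    show b: "\<bar>D 2 mi_zero s2 x\<bar> \<le> C"
      using s2(1) s1T assms by (intro C) auto
    show "0 \<le> C"
      using b by linarith
  qed (use s1 in auto)
  then have "\<bar>D 1 mi_zero s1 x - D 1 mi_zero t x\<bar> * h \<le> C * h * h"
    unfolding s2 using assms(3) by (intro mult_right_mono) auto
  moreover have "D 0 mi_zero (t + h) x - D 0 mi_zero t x - h * D 1 mi_zero t x
      = (D 1 mi_zero s1 x - D 1 mi_zero t x) * h"
    unfolding s1(2) by (simp add: algebra_simps)
  ultimately show ?thesis
    using assms(3) by (simp add: abs_mult power2_eq_square mult_ac)
qed

text \<open>With a nonempty frontier the closest point is a boundary point, so weights need to be
  compared only there.\<close>

lemma exit_cost_mono:
  assumes "frontier G \<noteq> {}" "\<And>z. z \<in> frontier G \<Longrightarrow> \<phi> z \<le> \<phi>' z"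
  shows "exit_cost G \<phi> y \<le> exit_cost G \<phi>' y"
  using assms(2)[OF closest_point_in_set[OF frontier_closed assms(1), of y]]
  by (simp add: exit_cost_def mult_left_mono)

lemma expectation_boundary_sum:
  fixes G :: "(real^'d::finite) set"
  assumes "random_signs P \<xi>"
  shows "prob_space.expectation P (\<lambda>\<omega>. boundary_sum G \<nu> b \<sigma> \<phi> h x (\<lambda>k. \<chi> i. \<xi> k i \<omega>) n)
    = cost_mean G \<nu> b \<sigma> h x (\<lambda>z. \<phi> z / conormal_coeff \<nu> (diffusion_matrix \<sigma>) z) n"
  unfolding boundary_sum_eq cost_mean_def
proof (rule expectation_random_signs[OF assms])
  fix e e' :: "nat \<Rightarrow> real^'d"
  assume e: "\<And>k. k \<in> {1..n} \<Longrightarrow> e k = e' k"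
  have "reflected_walk G \<nu> b \<sigma> h x e k = reflected_walk G \<nu> b \<sigma> h x e' k" if "k < n" for k
    using that by (intro reflected_walk_cong e) auto
  then show "(\<Sum>k<n. exit_cost G (\<lambda>z. \<phi> z / conormal_coeff \<nu> (diffusion_matrix \<sigma>) z)
      (trial_step b \<sigma> h (reflected_walk G \<nu> b \<sigma> h x e k) (e (Suc k)))) =
    (\<Sum>k<n. exit_cost G (\<lambda>z. \<phi> z / conormal_coeff \<nu> (diffusion_matrix \<sigma>) z)
      (trial_step b \<sigma> h (reflected_walk G \<nu> b \<sigma> h x e' k) (e' (Suc k))))"
    using e by (intro sum.cong refl) simp
qed

lemma continuous_on_closure_bounded:
  fixes f :: "'a::euclidean_space \<Rightarrow> 'b::real_normed_vector"
  assumes "bounded G" "continuous_on (closure G) f"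
  obtains B where "0 < B" "\<And>x. x \<in> closure G \<Longrightarrow> norm (f x) \<le> B"
proof -
  have "bounded (f ` closure G)"
    using assms by (intro compact_imp_bounded compact_continuous_image) auto
  then show thesis
    using that unfolding bounded_pos by auto
qed

lemma norm_matrix_vector_le:
  fixes A :: "real^'m::finite^'n::finite" and B :: real
  assumes "\<And>i j. \<bar>A $ i $ j\<bar> \<le> B" "\<And>j. \<bar>v $ j\<bar> \<le> 1"
  shows "norm (A *v v) \<le> CARD('n) * (CARD('m) * B)"
proof -
  have "norm (A *v v) \<le> (\<Sum>i\<in>(UNIV::'n set). CARD('m) * B)"
  proof (rule order_trans[OF norm_le_l1_cart], rule sum_mono)
    fix i
    have "\<bar>(A *v v) $ i\<bar> \<le> (\<Sum>j\<in>(UNIV::'m set). B * 1)"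
      unfolding matrix_vector_mult_def vec_lambda_beta
      by (intro order_trans[OF sum_abs] sum_mono)
        (unfold abs_mult, intro mult_mono assms, use assms(1) in \<open>auto intro: order_trans[OF abs_ge_zero]\<close>)
    then show "\<bar>(A *v v) $ i\<bar> \<le> CARD('m) * B" by simp
  qed
  then show ?thesis by simp
qed

lemma holder_class_mat_bounded:
  fixes f :: "real^'d::finite \<Rightarrow> real^'n::finite^'m::finite"
  assumes "bounded G" "holder_class_mat m \<epsilon> G f"
  obtains B where "0 < B" "\<And>x i j. x \<in> closure G \<Longrightarrow> \<bar>f x $ i $ j\<bar> \<le> B"
proof -
  have "continuous_on (closure G) (\<lambda>x. f x $ i $ j)" for i j
    using assms(2) holder_class_continuous_on unfolding holder_class_mat_def by blast
  then have "continuous_on (closure G) (\<lambda>x. \<chi> i. \<chi> j. f x $ i $ j)"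
    by (intro continuous_on_vec_lambda)
  then have "continuous_on (closure G) f"
    by simp
  then obtain B where B: "0 < B" "\<And>x. x \<in> closure G \<Longrightarrow> norm (f x) \<le> B"
    using continuous_on_closure_bounded[OF assms(1)] by blast
  have "\<bar>f x $ i $ j\<bar> \<le> B" if "x \<in> closure G" for x i j
  proof -
    have "\<bar>f x $ i $ j\<bar> \<le> norm (f x $ i)"
      by (rule component_le_norm_cart)
    also have "\<dots> \<le> norm (f x)"
      by (rule Finite_Cartesian_Product.norm_nth_le)
    finally show ?thesis
      using B(2)[OF that] by linarith
  qed
  then show thesis
    using that B(1) by blast
qed

lemma holder_class_vec_bounded:
  fixes f :: "real^'d::finite \<Rightarrow> real^'m::finite"
  assumes "bounded G" "holder_class_vec m \<epsilon> G f"
  obtains B where "0 < B" "\<And>x. x \<in> closure G \<Longrightarrow> norm (f x) \<le> B"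
proof -
  have "continuous_on (closure G) (\<lambda>x. f x $ i)" for i
    using assms(2) holder_class_continuous_on unfolding holder_class_vec_def by blast
  then have "continuous_on (closure G) (\<lambda>x. \<chi> i. f x $ i)"
    by (intro continuous_on_vec_lambda)
  then have "continuous_on (closure G) f"
    by simp
  then show thesis
    using continuous_on_closure_bounded[OF assms(1)] that by blast
qed

lemma walk_domain_exists:
  fixes G :: "(real^'d::finite) set"
  assumes G: "open G" "bounded G" "holder_boundary m \<epsilon> G" "1 \<le> m"
    and normal: "\<And>z. z \<in> frontier G \<Longrightarrow> inward_unit_normal G z (\<nu> z)"
    and coeff: "holder_class_mat m' \<epsilon> G \<sigma>" "holder_class_vec m'' \<epsilon> G b"
  obtains k \<delta> K where "walk_domain G k \<nu> \<delta> b \<sigma> K"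
proof -
  obtain k where k: "1 \<le> k" "\<And>x y. x \<in> closure G \<Longrightarrow> y \<in> closure G \<Longrightarrow> dist x y < 1 / k \<Longrightarrow> linked k G x y"
    using linked_uniform[OF G] by blast
  obtain B1 where "0 < B1" and B1: "\<And>x i j. x \<in> closure G \<Longrightarrow> \<bar>\<sigma> x $ i $ j\<bar> \<le> B1"
    by (rule holder_class_mat_bounded[OF G(2) coeff(1)], rule that)
  obtain B2 where "0 < B2" and B2: "\<And>x. x \<in> closure G \<Longrightarrow> norm (b x) \<le> B2"
    by (rule holder_class_vec_bounded[OF G(2) coeff(2)], rule that)
  let ?d = "real CARD('d)"
  define K where "K = max 1 (max B2 (?d * (?d * B1)))"
  note conclude = that
  show thesis
  proof (rule reflect_step_geometry[OF G, of \<nu>])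
    show "inward_unit_normal G z (\<nu> z)" if "z \<in> frontier G" for z
      using normal[OF that] .
  next
    fix \<delta>
    assume \<delta>: "0 < \<delta>"
      "\<And>x y p r. x \<in> closure G \<Longrightarrow> y \<notin> closure G \<Longrightarrow> dist x y < \<delta> \<Longrightarrow>
       p = closest_point (frontier G) y \<Longrightarrow> r = dist y p \<Longrightarrow>
       p \<in> frontier G \<and> norm (\<nu> p) = 1 \<and> r \<le> dist x y \<and> y = p - r *\<^sub>R \<nu> p \<and>
       reflect_step G \<nu> y = p + r *\<^sub>R \<nu> p \<and> p + r *\<^sub>R \<nu> p \<in> G"
    have "walk_domain G k \<nu> \<delta> b \<sigma> K"
    proof
      show "open G" "1 \<le> k" "0 < \<delta>" by fact+
      show "linked k G x y" if "x \<in> closure G" "y \<in> closure G" "dist x y < 1 / k" for x y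
        by (rule k(2)[OF that])
      show "1 \<le> K" by (simp add: K_def)
      show "norm (b x) \<le> K" if "x \<in> closure G" for x
        using B2[OF that] by (simp add: K_def)
      show "norm (\<sigma> x *v v) \<le> K" if "x \<in> closure G" "v \<in> sign_vectors" for x v
      proof -
        have "\<bar>v $ j\<bar> \<le> 1" for j
          using that(2) by (cases "v $ j = 1") (auto simp: sign_vectors_def)
        then have "norm (\<sigma> x *v v) \<le> ?d * (?d * B1)"
          by (rule norm_matrix_vector_le[OF B1[OF that(1)]])
        then show ?thesis by (simp add: K_def)
      qed
    qed (rule \<delta>(2))
    then show thesis
      by (rule conclude)
  qed
qed

text \<open>The upper bound lets E Z_2 dominate the unweighted exit cost; the lower one keeps
  \<alpha> positive. They come from continuity and from ellipticity tested on the unit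
  normal.\<close>

lemma conormal_coeff_bounds:
  fixes G :: "(real^'d::finite) set"
  assumes "bounded G" "uniformly_elliptic G a" "holder_class_mat m \<epsilon> G a"
    and normal: "\<And>z. z \<in> frontier G \<Longrightarrow> inward_unit_normal G z (\<nu> z)"
  obtains l L where "0 < l" "0 < L"
    "\<And>z. z \<in> frontier G \<Longrightarrow> l \<le> conormal_coeff \<nu> a z \<and> conormal_coeff \<nu> a z \<le> L"
proof -
  obtain a0 where a0: "0 < a0" "\<And>x y. x \<in> closure G \<Longrightarrow> a0 * (norm y)\<^sup>2 \<le> (a x *v y) \<bullet> y"
    using assms(2) unfolding uniformly_elliptic_def by blast
  obtain A where A: "0 < A" "\<And>x i j. x \<in> closure G \<Longrightarrow> \<bar>a x $ i $ j\<bar> \<le> A"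
    using holder_class_mat_bounded[OF assms(1,3)] by blast
  let ?d = "real CARD('d)"
  show thesis
  proof (rule that[of "a0 / 2" "?d * (?d * A)"])
    fix z assume z: "z \<in> frontier G"
    then have zc: "z \<in> closure G"
      by (simp add: frontier_def)
    have nv: "norm (\<nu> z) = 1"
      using normal[OF z] by (simp add: inward_unit_normal_def)
    have "\<bar>\<nu> z $ j\<bar> \<le> 1" for j
      using component_le_norm_cart[of "\<nu> z" j] nv by simp
    then have n: "norm (a z *v \<nu> z) \<le> ?d * (?d * A)"
      by (rule norm_matrix_vector_le[OF A(2)[OF zc]])
    have "\<nu> z \<bullet> (a z *v \<nu> z) \<le> ?d * (?d * A)"
      using norm_cauchy_schwarz[of "\<nu> z" "a z *v \<nu> z"] nv n by simp
    moreover have "0 \<le> ?d * (?d * A)"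
      using A(1) by simp
    moreover have "a0 \<le> \<nu> z \<bullet> (a z *v \<nu> z)"
      using a0(2)[OF zc, of "\<nu> z"] nv by (simp add: inner_commute)
    ultimately show "a0 / 2 \<le> conormal_coeff \<nu> a z \<and> conormal_coeff \<nu> a z \<le> ?d * (?d * A)"
      unfolding conormal_coeff_def by linarith
  qed (use a0 A in auto)
qed

lemma elliptic_diagonal:
  assumes "uniformly_elliptic G a"
  obtains a0 where "0 < a0" "\<And>x i. x \<in> closure G \<Longrightarrow> a0 \<le> a x $ i $ i"
proof -
  obtain a0 where a0: "0 < a0" "\<And>x y. x \<in> closure G \<Longrightarrow> a0 * (norm y)\<^sup>2 \<le> (a x *v y) \<bullet> y"
    using assms unfolding uniformly_elliptic_def by blast
  have "a0 \<le> a x $ i $ i" if "x \<in> closure G" for x i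
    using a0(2)[OF that, of "axis i 1"]
    by (simp add: matrix_vector_mult_basis inner_axis column_def)
  then show thesis
    using that a0(1) by blast
qed

context walk_domain
begin

text \<open>The telescoping of \<open>u(t\<^sub>n, X\<^sub>n)\<close> stops one step before the terminal time, so that only
  derivatives on \<open>{0..<T}\<close> enter.\<close>

lemma neumann_cost_mean:
  fixes C T h :: real
  assumes sol: "solves_neumann_problem T G \<nu> b (diffusion_matrix \<sigma>) \<phi> u D"
    and bound: "parabolic_norm4 T G D \<le> ennreal C" "0 \<le> C"
    and x: "x \<in> closure G" and h: "0 < h" "h \<le> 1"
    and small: "6 * K * sqrt h < \<delta>" "6 * K * sqrt h < 1 / (3 * k) ^ 4"
    and n: "real n * h < T"
  defines "S \<equiv> step_const C (2 * K)"
  shows "\<bar>cost_mean G \<nu> b \<sigma> h x \<phi> n\<bar> \<le> 2 * C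
    + real n * ((S + 2 * real CARD('d)^3 * C * K^3 + real CARD('d) * C * K) * h^2)
    + S * h * cost_mean G \<nu> b \<sigma> h x (\<lambda>_. 1) n"
proof -
  let ?S' = "S + 2 * real CARD('d)^3 * C * K^3 + real CARD('d) * C * K"
  have pd: "parabolic_derivatives T G u D"
    using sol by (simp add: solves_neumann_problem_def)
  have B: "\<bar>D i j t y\<bar> \<le> C" if "2 * i + mi_order j \<le> 4" "t \<in> {0..<T}" "y \<in> closure G" for i j t y
    using parabolic_norm4_bound[OF bound that] .
  \<comment> \<open>\<open>D 0 mi_zero\<close> agrees with u on {0..<T} and is the function to which
    the derivative bounds refer.\<close>
  define V where "V m y = D 0 mi_zero (real m * h) y" for m y
  have time_in: "real m * h \<in> {0..<T}" if "m \<le> n" for m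
  proof -
    have "real m * h \<le> real n * h"
      using that h by (intro mult_right_mono) auto
    then have "real m * h < T"
      using n by linarith
    then show ?thesis
      using h by simp
  qed
  have V_bound: "\<bar>V m y\<bar> \<le> C" if "m \<le> n" "y \<in> closure G" for m y
    unfolding V_def using that by (intro B time_in) auto
  have small2: "2 * K * sqrt h < \<delta>"
  proof -
    have "0 \<le> K * sqrt h" using K h by simp
    then show ?thesis using small by linarith
  qed
  have "\<bar>walk_mean n (\<lambda>w. V n (reflected_walk G \<nu> b \<sigma> h x w n)) - V 0 x - cost_mean G \<nu> b \<sigma> h x \<phi> n\<bar>
      \<le> n * (?S' * h^2) + (S * h) * cost_mean G \<nu> b \<sigma> h x (\<lambda>_. 1) n"
  proof (rule telescope[OF x h small2 _ order_refl])
    fix m y assume m: "m < n" and y: "y \<in> closure G"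
    let ?t = "real m * h"
    have t: "?t \<in> {0..<T}" "?t + h \<in> {0..<T}"
      using time_in[of m] time_in[of "Suc m"] m by (auto simp: algebra_simps)
    have pde: "D 1 mi_zero ?t y + (\<Sum>i\<in>UNIV. \<Sum>j\<in>UNIV. (\<sigma> y ** transpose (\<sigma> y)) $ i $ j
        * D 0 (mi_incr j (mi_incr i mi_zero)) ?t y) / 2 + lin (\<lambda>i. D 0 (mi_incr i mi_zero) ?t y) (b y) = 0"
    proof -
      have "D 1 mi_zero ?t y
       + (1/2) * (\<Sum>i\<in>UNIV. \<Sum>j\<in>UNIV. diffusion_matrix \<sigma> y $ i $ j * D 0 (mi_incr i (mi_incr j mi_zero)) ?t y)
       + (\<Sum>i\<in>UNIV. b y $ i * D 0 (mi_incr i mi_zero) ?t y) = 0"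
        using sol t(1) y unfolding solves_neumann_problem_def by blast
      then show ?thesis
        by (simp add: lin_def diffusion_matrix_def mult.commute mi_incr_commute[of _ _ mi_zero])
    qed
    have neu: "lin (\<lambda>i. D 0 (mi_incr i mi_zero) ?t z) (\<nu> z) = \<phi> z" if "z \<in> frontier G" for z
    proof -
      have "(\<Sum>i\<in>UNIV. \<nu> z $ i * D 0 (mi_incr i mi_zero) ?t z) = \<phi> z"
        using sol t(1) that unfolding solves_neumann_problem_def by blast
      then show ?thesis
        by (simp add: lin_def mult.commute)
    qed
    have Vs: "V (Suc m) y' = D 0 mi_zero (?t + h) y'" for y'
      by (simp add: V_def algebra_simps)
    have "\<bar>sign_mean (\<lambda>v. V (Suc m) (reflect_step G \<nu> (trial_step b \<sigma> h y v)) - exit_cost G \<phi> (trial_step b \<sigma> h y v))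
        - D 0 mi_zero ?t y\<bar>
      \<le> ?S' * h^2 + S * h * sign_mean (\<lambda>v. exit_cost G (\<lambda>_. 1) (trial_step b \<sigma> h y v))"
      unfolding S_def
    proof (rule step_mean[where ?U0.0 = "\<lambda>j. D 0 j ?t" and ?U1.0 = "\<lambda>j. D 1 j ?t", OF _ _ _ neu pde y h small])
      show "smooth_jet 4 G C (\<lambda>j. D 0 j ?t)" "smooth_jet 2 G C (\<lambda>j. D 1 j ?t)"
        by (rule parabolic_smooth_jet[OF pd t(1) _ B]; simp)+
      show "\<bar>V (Suc m) y' - D 0 mi_zero ?t y' - h * D 1 mi_zero ?t y'\<bar> \<le> C * h^2" if "y' \<in> closure G" for y'
        unfolding Vs using t h(1) by (intro parabolic_time_taylor[OF pd _ _ _ that B]) auto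
    qed
    then show "\<bar>sign_mean (\<lambda>v. V (Suc m) (reflect_step G \<nu> (trial_step b \<sigma> h y v)) - exit_cost G \<phi> (trial_step b \<sigma> h y v))
        - V m y\<bar> \<le> ?S' * h^2 + S * h * sign_mean (\<lambda>v. exit_cost G (\<lambda>_. 1) (trial_step b \<sigma> h y v))"
      by (simp only: V_def)
  qed
  moreover have "\<bar>walk_mean n (\<lambda>w. V n (reflected_walk G \<nu> b \<sigma> h x w n))\<bar> \<le> C"
  proof -
    have "walk_mean n (\<lambda>w. \<bar>V n (reflected_walk G \<nu> b \<sigma> h x w n)\<bar>) \<le> walk_mean n (\<lambda>w :: nat \<Rightarrow> real^'d. C)"
      by (intro walk_mean_mono V_bound walk_in_closure[OF x h small2]) auto
    then show ?thesis
      using walk_mean_abs[of n "\<lambda>w. V n (reflected_walk G \<nu> b \<sigma> h x w n)"] unfolding walk_mean_const by linarith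
  qed
  moreover have "\<bar>V 0 x\<bar> \<le> C"
    by (rule V_bound[OF _ x]) simp
  \<comment> \<open>The term 2 C consists of the two end values of V.\<close>
  ultimately show ?thesis by linarith
qed

end

text \<open>Before T0 the ratio is bounded by B and 1 \<le> T0 / T, so a constant error is O(1/T).
  From T0 on, s is at least c T / 2 and the main estimate can be divided by z2.\<close>

lemma ratio_bound:
  fixes z1 z2 s \<psi>b T h nh c C' m B C C1 C2 :: real
  assumes T: "0 < T" and h: "0 < h" "h \<le> 1" and nh: "nh = T - h"
    and c: "0 < c" "0 < C'" and lower: "c * nh - C' \<le> s"
    and m: "0 < m" "m * s \<le> z2" "0 \<le> z2" and B: "\<bar>z1\<bar> \<le> B * z2" "0 \<le> B"
    and C: "0 \<le> C" "0 \<le> C1" "0 \<le> C2"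
    and main: "\<bar>z1 - \<psi>b * z2\<bar> \<le> 2 * C + nh * (C1 * h) + C2 * h * s"
  defines "T0 \<equiv> 2 * (C' + c) / c"
  shows "\<bar>z1 / z2 - \<psi>b\<bar>
    \<le> (4 * C / (m * c) + 2 * C1 / (m * c) + C2 / m + (B + \<bar>\<psi>b\<bar>) * T0 + 1) * (h + 1 / T)"
proof -
  let ?A = "4 * C / (m * c)" and ?D = "2 * C1 / (m * c)" and ?E = "C2 / m" and ?F = "(B + \<bar>\<psi>b\<bar>) * T0"
  have nonneg: "0 \<le> ?A" "0 \<le> ?D" "0 \<le> ?E" "0 \<le> ?F" "0 \<le> 1 / T"
    using c m B C T by (simp_all add: T0_def)
  have expand: "(?A + ?D + ?E + ?F + 1) * (h + 1 / T)
      = (?A * h + ?A * (1 / T)) + (?D * h + ?D * (1 / T)) + (?E * h + ?E * (1 / T))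
        + (?F * h + ?F * (1 / T)) + (h + 1 / T)"
    by (simp only: distrib_left distrib_right mult_1)
  have prods: "0 \<le> ?A * h" "0 \<le> ?A * (1 / T)" "0 \<le> ?D * h" "0 \<le> ?D * (1 / T)" "0 \<le> ?E * h" "0 \<le> ?E * (1 / T)"
    "0 \<le> ?F * h" "0 \<le> ?F * (1 / T)"
    by (intro nonneg less_imp_le[OF h(1)] mult_nonneg_nonneg)+
  show ?thesis
  proof (cases "T < T0")
    case True
    have "\<bar>z1 / z2\<bar> \<le> B"
    \<comment> \<open>Division by zero yields 0, which also satisfies the bound.\<close>
    proof (cases "z2 = 0")
      case False
      then show ?thesis
        using B m(3) by (simp add: abs_divide divide_le_eq)
    qed (use B in simp)
    then have "\<bar>z1 / z2 - \<psi>b\<bar> \<le> B + \<bar>\<psi>b\<bar>"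
      by linarith
    also have "\<dots> \<le> (B + \<bar>\<psi>b\<bar>) * (T0 / T)"
    proof -
      have "1 \<le> T0 / T"
        using True T by simp
      then show ?thesis
        using mult_left_mono[of 1 "T0 / T" "B + \<bar>\<psi>b\<bar>"] B(2) by simp
    qed
    also have "\<dots> = ?F * (1 / T)"
      by simp
    also have "\<dots> \<le> (?A + ?D + ?E + ?F + 1) * (h + 1 / T)"
      unfolding expand using prods nonneg h by linarith
    finally show ?thesis .
  next
    case False
    then have T_ge: "2 * (C' + c) \<le> c * T"
      using c by (simp add: T0_def field_simps)
    have ch: "c * h \<le> c"
      using c h by simp
    have cnh: "c * nh = c * T - c * h"
      unfolding nh by (rule right_diff_distrib)
    have "p / 2 \<le> s" if "2 * (C' + c) \<le> p" "q \<le> c" "r = p - q" "r - C' \<le> s" for p q r :: real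
      using that by simp
    \<comment> \<open>Because h \<le> 1, \<open>c * nh - C'\<close> is at least
      \<open>c * T - (C' + c)\<close>, and the choice of T0 bounds the subtracted part by half of
      \<open>c * T\<close>.\<close>
    from this[OF T_ge ch cnh lower] have s: "c * T / 2 \<le> s" .
    have cT: "0 < c * T"
      using c T by simp
    have s0: "0 < s"
      using s cT by linarith
    have z2: "m * (c * T / 2) \<le> z2"
      using m(1,2) mult_left_mono[OF s, of m] by linarith
    have mz: "0 < m * (c * T / 2)"
      using m(1) cT by simp
    then have z2_pos: "0 < z2"
      using z2 by linarith
    have "\<bar>z1 / z2 - \<psi>b\<bar> = \<bar>z1 - \<psi>b * z2\<bar> / z2"
      using z2_pos by (simp add: field_simps abs_divide[symmetric])
    also have "\<dots> \<le> (2 * C + nh * (C1 * h) + C2 * h * s) / z2"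
      using main z2_pos by (simp add: divide_right_mono)
    also have "\<dots> \<le> (2 * C + T * (C1 * h)) / z2 + C2 * h * s / z2"
    proof -
      have "nh * (C1 * h) \<le> T * (C1 * h)"
        using nh h C by (intro mult_right_mono) auto
      then show ?thesis
        unfolding add_divide_distrib[symmetric] using z2_pos by (intro divide_right_mono) auto
    qed
    \<comment> \<open>Two lower bounds for z2 are used: m c T / 2 for the first quotient and m s for
      the second, where s then cancels.\<close>
    also have "\<dots> \<le> (2 * C + T * (C1 * h)) / (m * (c * T / 2)) + C2 * h * s / (m * s)"
      using z2 mz m s0 C h T by (intro add_mono divide_left_mono) auto
    also have "\<dots> = ?A * (1 / T) + ?D * h + ?E * h"
      using m(1) c T s0 by (simp add: field_simps)
    also have "\<dots> \<le> (?A + ?D + ?E + ?F + 1) * (h + 1 / T)"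
      unfolding expand using prods nonneg h by linarith
    finally show ?thesis .
  qed
qed

theorem theorem4p12:
  fixes G :: "(real^'d::finite) set"
    and \<nu> b :: "real^'d \<Rightarrow> real^'d"
    and \<sigma> a :: "real^'d \<Rightarrow> real^'d^'d"
    and \<alpha> \<rho> \<psi> :: "real^'d \<Rightarrow> real"
    and \<epsilon> \<psi>bar :: real
    and M :: "'w measure" and F :: "real \<Rightarrow> 'w measure"
    and W :: "real \<Rightarrow> 'w \<Rightarrow> real^'d"
    and X :: "real^'d \<Rightarrow> real \<Rightarrow> 'w \<Rightarrow> real^'d"
    and L :: "real^'d \<Rightarrow> real \<Rightarrow> 'w \<Rightarrow> real"
    and u :: "real \<Rightarrow> real \<Rightarrow> real^'d \<Rightarrow> real"
    and Du :: "real \<Rightarrow> nat \<Rightarrow> ('d \<Rightarrow> nat) \<Rightarrow> real \<Rightarrow> real^'d \<Rightarrow> real"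
    and P :: "'p measure" and \<xi> :: "nat \<Rightarrow> 'd \<Rightarrow> 'p \<Rightarrow> real"
    and x :: "real^'d"
    and Z1 Z2 :: "real \<Rightarrow> nat \<Rightarrow> 'p \<Rightarrow> real"
  assumes eps: "0 < \<epsilon>" "\<epsilon> < 1"
    and domain: "open G" "connected G" "G \<noteq> {}" "bounded G"
    and boundary: "holder_boundary 4 \<epsilon> G"
    and normal: "\<And>z. z \<in> frontier G \<Longrightarrow> inward_unit_normal G z (\<nu> z)"
    and a_def: "a = diffusion_matrix \<sigma>"
    and alpha_def: "\<alpha> = conormal_coeff \<nu> a"
    and elliptic: "uniformly_elliptic G a"
    and coeff_reg: "holder_class_mat 2 \<epsilon> G \<sigma>" "holder_class_mat 3 \<epsilon> G a" "holder_class_vec 2 \<epsilon> G b"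
    and psi_reg: "holder_class_boundary 3 \<epsilon> G \<psi>"
    and prob: "filtered_prob_space M F"
    and wiener: "wiener_process M F W"
    and sde: "\<And>y. y \<in> closure G \<Longrightarrow> reflected_sde_solution M F W G \<nu> b \<sigma> y (X y) (L y)"
    and rho_reg: "holder_class 2 \<epsilon> G \<rho>"
    and rho_pos: "\<And>y. y \<in> closure G \<Longrightarrow> 0 < \<rho> y"
    and rho_invariant: "invariant_prob M (closure G) X (density_on (closure G) \<rho>)"
    and psibar_def: "\<psi>bar = boundary_mean G \<rho> \<psi>"
    and parabolic: "\<And>T. 0 < T \<Longrightarrow>
      solves_neumann_problem T G \<nu> b a (\<lambda>z. (\<psi> z - \<psi>bar) / \<alpha> z) (u T) (Du T)"
    and boundedness: "\<exists>C>0. \<forall>T>0. parabolic_norm4 T G (Du T) \<le> ennreal C"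
    and signs: "random_signs P \<xi>"
    and start: "x \<in> closure G"
    and Z1_def: "\<And>h n \<omega>. Z1 h n \<omega> = boundary_sum G \<nu> b \<sigma> \<psi> h x (\<lambda>k. \<chi> i. \<xi> k i \<omega>) n"
    and Z2_def: "\<And>h n \<omega>. Z2 h n \<omega> = boundary_sum G \<nu> b \<sigma> (\<lambda>_. 1) h x (\<lambda>k. \<chi> i. \<xi> k i \<omega>) n"
  shows "\<exists>C>0. \<exists>h\<^sub>0>0. \<forall>h N T. 0 < h \<and> h < h\<^sub>0 \<and> 1 \<le> N \<and> T = real N * h \<longrightarrow>
    \<bar>prob_space.expectation P (Z1 h (N - 1)) / prob_space.expectation P (Z2 h (N - 1)) - \<psi>bar\<bar>
      \<le> C * (h + 1 / T)"
proof -
  obtain k \<delta> K where "walk_domain G k \<nu> \<delta> b \<sigma> K"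
    using walk_domain_exists[OF domain(1,4) boundary _ normal coeff_reg(1,3)] by auto
  then interpret walk_domain G k \<nu> \<delta> b \<sigma> K .
  interpret P: prob_space P
    using signs by (simp add: random_signs_def)
  \<comment> \<open>Guarantees that \<open>closest_point\<close> always returns a boundary
    point.\<close>
  have frontier_ne: "frontier G \<noteq> {}"
    using domain(3,4) frontier_not_empty not_bounded_UNIV by blast
  obtain C where C: "0 < C" "\<And>T. 0 < T \<Longrightarrow> parabolic_norm4 T G (Du T) \<le> ennreal C"
    using boundedness by blast
  obtain B where B: "1 \<le> B" "\<And>z. z \<in> frontier G \<Longrightarrow> \<bar>\<psi> z\<bar> \<le> B"
    using holder_class_boundary_bounded[OF psi_reg _ domain(1,4)] by auto
  obtain l A where l: "0 < l" and A: "0 < A" and \<alpha>: "\<And>z. z \<in> frontier G \<Longrightarrow> l \<le> \<alpha> z \<and> \<alpha> z \<le> A"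
    using conormal_coeff_bounds[OF domain(4) elliptic coeff_reg(2) normal] unfolding alpha_def by blast
  obtain a0 where a0: "0 < a0" "\<And>y i. y \<in> closure G \<Longrightarrow> a0 \<le> a y $ i $ i"
    using elliptic_diagonal[OF elliptic] by blast
  \<comment> \<open>Any coordinate may serve as the exponent of the test function;
    \<open>undefined\<close> merely selects one.\<close>
  obtain c C' h1 where c: "0 < c" "0 < C'" "0 < h1"
    and lower: "\<And>y h n. y \<in> closure G \<Longrightarrow> 0 < h \<Longrightarrow> h < h1 \<Longrightarrow> h \<le> 1 \<Longrightarrow> 2 * K * sqrt h < \<delta> \<Longrightarrow>
      c * (real n * h) - C' \<le> cost_mean G \<nu> b \<sigma> h y (\<lambda>_. 1) n"
    using cost_mean_lower[OF domain(4) a0(1), of undefined] a0(2) unfolding a_def diffusion_matrix_def by blast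
  define S where "S = step_const C (2 * K)"
  define C1 where "C1 = S + 2 * real CARD('d)^3 * C * K^3 + real CARD('d) * C * K"
  have S0: "0 \<le> S"
    using C(1) K taylor_const_pos by (simp add: S_def step_const_def)
  have C10: "0 \<le> C1"
    using S0 C(1) K by (simp add: C1_def)
  define \<eta> where "\<eta> = min \<delta> (1 / (3 * k) ^ 4)"
  have \<eta>: "0 < \<eta>"
    using \<delta> k by (simp add: \<eta>_def)
  \<comment> \<open>The square makes 6 K sqrt h less than \<eta>, the smaller of the reflection
    length and the Taylor radius; \<open>h1\<close> is the threshold for exponential growth.\<close>
  define h0 where "h0 = min (min 1 h1) ((\<eta> / (6 * K))\<^sup>2)"
  have h0: "0 < h0"
    using c \<eta> K by (simp add: h0_def)
  \<comment> \<open>The constant of \<open>ratio_bound\<close> for \<open>m = 1 / A\<close> and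
    error coefficient S; its summand 1 makes it positive.\<close>
  define Q where "Q = 4 * C / (1 / A * c) + 2 * C1 / (1 / A * c) + S / (1 / A)
    + (B + \<bar>\<psi>bar\<bar>) * (2 * (C' + c) / c) + 1"
  have Q: "0 < Q"
    unfolding Q_def using C(1) A c C10 S0 B(1) by (intro add_nonneg_pos add_nonneg_nonneg) auto
  have \<alpha>_eq: "conormal_coeff \<nu> (diffusion_matrix \<sigma>) = \<alpha>"
    by (simp add: alpha_def a_def)
  have "\<bar>P.expectation (Z1 h (N - 1)) / P.expectation (Z2 h (N - 1)) - \<psi>bar\<bar> \<le> Q * (h + 1 / T)"
    if h: "0 < h" "h < h0" and N: "1 \<le> N" and T: "T = real N * h" for h N T
  proof -
    \<comment> \<open>The N - 1 steps end at time T - h, strictly before T, where all derivative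
      bounds hold. For N = 1 both sums are empty and the quotient is 0; then T = h \<le> 1 falls
      under the small-T case.\<close>
    define n where "n = N - 1"
    let ?c = "\<lambda>\<phi>. cost_mean G \<nu> b \<sigma> h x \<phi> n"
    have hh: "h \<le> 1" "h < h1"
      using h by (simp_all add: h0_def)
    have "h < (\<eta> / (6 * K))\<^sup>2"
      using h by (simp add: h0_def)
    then have "sqrt h < \<eta> / (6 * K)"
      using \<eta> K by (intro real_less_lsqrt) auto
    then have small: "6 * K * sqrt h < \<eta>"
      using K by (simp add: field_simps)
    then have small1: "6 * K * sqrt h < \<delta>" "6 * K * sqrt h < 1 / (3 * k) ^ 4"
      by (simp_all add: \<eta>_def)
    have "0 \<le> K * sqrt h"
      using K h by simp
    then have small2: "2 * K * sqrt h < \<delta>"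
      using small1 by linarith
    have T0: "0 < T"
      using T N h by simp
    have nh: "real n * h = T - h"
      using N by (simp add: T n_def of_nat_diff algebra_simps)
    have EZ1: "P.expectation (Z1 h (N - 1)) = ?c (\<lambda>z. \<psi> z / \<alpha> z)"
      and EZ2: "P.expectation (Z2 h (N - 1)) = ?c (\<lambda>z. 1 / \<alpha> z)"
      using expectation_boundary_sum[OF signs, of G \<nu> b \<sigma> _ h x n]
      by (simp_all add: Z1_def[abs_def] Z2_def[abs_def] n_def \<alpha>_eq)
    have \<alpha>_pos: "0 < \<alpha> z" if "z \<in> frontier G" for z
      using \<alpha>[OF that] l by linarith
    have cost_le: "?c \<phi> \<le> ?c \<phi>'" if "\<And>z. z \<in> frontier G \<Longrightarrow> \<phi> z \<le> \<phi>' z" for \<phi> \<phi>'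
      by (intro cost_mean_mono exit_cost_mono[OF frontier_ne that])
    show ?thesis
      unfolding Q_def EZ1 EZ2
    proof (rule ratio_bound[where s = "?c (\<lambda>_. 1)"])
      show "0 < T" "0 < h" "h \<le> 1" "real n * h = T - h" "0 < c" "0 < C'" by fact+
      show "c * (real n * h) - C' \<le> ?c (\<lambda>_. 1)"
        by (rule lower[OF start h(1) hh(2,1) small2])
      show "0 < 1 / A" using A by simp
      show Z2_lower: "1 / A * ?c (\<lambda>_. 1) \<le> ?c (\<lambda>z. 1 / \<alpha> z)"
        unfolding cost_mean_cmult[symmetric]
        using \<alpha> \<alpha>_pos A by (intro cost_le) (simp add: frac_le)
      have "0 \<le> 1 / A * ?c (\<lambda>_. 1)"
        using A cost_mean_nonneg by (intro mult_nonneg_nonneg) auto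
      then show "0 \<le> ?c (\<lambda>z. 1 / \<alpha> z)"
        using Z2_lower by linarith
      have "?c (\<lambda>z. \<psi> z / \<alpha> z) \<le> ?c (\<lambda>z. B * (1 / \<alpha> z))"
        using B(2) \<alpha>_pos by (intro cost_le) (simp add: divide_right_mono abs_le_iff less_imp_le)
      moreover have "?c (\<lambda>z. - B * (1 / \<alpha> z)) \<le> ?c (\<lambda>z. \<psi> z / \<alpha> z)"
      proof (rule cost_le)
        fix z assume z: "z \<in> frontier G"
        have "- B / \<alpha> z \<le> \<psi> z / \<alpha> z"
          using B(2)[OF z] \<alpha>_pos[OF z] by (intro divide_right_mono) auto
        then show "- B * (1 / \<alpha> z) \<le> \<psi> z / \<alpha> z" by simp
      qed
      ultimately show "\<bar>?c (\<lambda>z. \<psi> z / \<alpha> z)\<bar> \<le> B * ?c (\<lambda>z. 1 / \<alpha> z)"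
        unfolding cost_mean_cmult by linarith
      show "0 \<le> B" "0 \<le> C" "0 \<le> C1" "0 \<le> S"
        using B(1) C(1) C10 S0 by auto
      have sol: "solves_neumann_problem T G \<nu> b (diffusion_matrix \<sigma>) (\<lambda>z. (\<psi> z - \<psi>bar) / \<alpha> z) (u T) (Du T)"
        using parabolic[OF T0] by (simp add: a_def)
      have "\<bar>?c (\<lambda>z. (\<psi> z - \<psi>bar) / \<alpha> z)\<bar> \<le> 2 * C + real n * (C1 * h^2) + S * h * ?c (\<lambda>_. 1)"
        unfolding C1_def S_def
        using C(1) nh h(1) by (intro neumann_cost_mean[OF sol C(2)[OF T0] _ start h(1) hh(1) small1]) auto
      \<comment> \<open>Linearity in the weight: the Neumann data are chosen so that their exit cost
        is Z_1 minus \<psi>bar times Z_2.\<close>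
      moreover have "?c (\<lambda>z. (\<psi> z - \<psi>bar) / \<alpha> z) = ?c (\<lambda>z. \<psi> z / \<alpha> z) - \<psi>bar * ?c (\<lambda>z. 1 / \<alpha> z)"
        unfolding cost_mean_cmult[symmetric] cost_mean_diff[symmetric] by (simp add: diff_divide_distrib)
      ultimately show "\<bar>?c (\<lambda>z. \<psi> z / \<alpha> z) - \<psi>bar * ?c (\<lambda>z. 1 / \<alpha> z)\<bar>
          \<le> 2 * C + real n * h * (C1 * h) + S * h * ?c (\<lambda>_. 1)"
        by (simp add: power2_eq_square mult_ac)
    qed
  qed
  then show ?thesis
    using Q h0 by blast
qed

end
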